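(* Let $U$ be an open subset of a Riemannian manifold $M$ and let $k$ be an integer with $0\le k\le \dim M$. The space ${}'\mathcal B_k(U)$ carries the subspace topology of $\mathcal B_k'(U)$, where $\mathcal B_k'(U)$ is given the strong topology $\beta(\mathcal B_k'(U),\mathcal B_k(U))$; i.e. the canonical evaluation map $u:{}'\mathcal B_k(U)\to(\mathcal B_k'(U),\beta(\mathcal B_k'(U),\mathcal B_k(U)))$ is a topological isomorphism onto its image with the subspace topology.
   Context: Pointed chains: $\mathcal P_k=\mathcal P_k(U)$ is the real vector space of finitely supported sections of $\Lambda_k(TU)$ (the $k$-th exterior power of the tangent bundle of $U$), i.e. finite formal sums $A=\sum_{i=1}^s (p_i;\alpha_i)$ with $p_i\in U$, $\alpha_i\in\Lambda_k(T_{p_i}U)$, with $(p;\cdot)$ linear. For a $k$-form $\omega$ on $U$ put $\int_A\omega:=\sum_{i=1}^s\omega(p_i;\alpha_i)$, where $\omega(p;\alpha)$ is the value of $\omega$ at $p$ on the $k$-vector $\alpha$. Forms: $\mathcal B_k^r=\mathcal B_k^r(U)$ ($r\ge 0$) is the space of $C^r$ $k$-forms on $U$ whose derivatives of order $\le r$ are bounded on $U$, with norm $\|\omega\|_{C^r}$ the supremum over $U$ of the pointwise norms of these derivatives (for $U\subset\mathbb R^n$: Lie derivatives $L_{v_1}\cdots L_{v_j}\omega$, $0\le j\le r$, along constant unit vector fields; in general, iterated covariant derivatives with respect to the Riemannian metric). $\mathcal B_k=\mathcal B_k(U)=\varprojlim_r\mathcal B_k^r$ is the Fréchet space of smooth $k$-forms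 with all derivatives bounded, topologized by the norms $\|\cdot\|_{C^r}$, $r\ge0$; $\mathcal B_k'$ is its continuous dual. Chains: on $\mathcal P_k$ define norms $\|A\|_{B^r}=\sup_{0\neq\omega\in\mathcal B_k^r}\frac{\int_A\omega}{\|\omega\|_{C^r}}$, decreasing in $r$. Let $\hat{\mathcal B}_k^r$ be the Banach space completion of $(\mathcal P_k,\|\cdot\|_{B^r})$, and let $\hat{\mathcal B}_k=\varinjlim_r\hat{\mathcal B}_k^r$ along the canonical maps $\hat{\mathcal B}_k^r\to\hat{\mathcal B}_k^{r+1}$, with the locally convex inductive limit topology. Let ${}'\mathcal B_k={}'\mathcal B_k(U)$ be the completion of the locally convex space $\hat{\mathcal B}_k$ (the space of differential $k$-chains in $U$). Each $\omega\in\mathcal B_k$ extends uniquely from $\mathcal P_k$ to a continuous linear functional on ${}'\mathcal B_k$, and in this way $({}'\mathcal B_k)'=\mathcal B_k$. The map $u$ sends $J\in{}'\mathcal B_k$ to the functional $\omega\mapsto\omega(J)$ on $\mathcal B_k$. The strong topology $\beta(\mathcal B_k',\mathcal B_k)$ is that of uniform convergence on bounded subsets of $\mathcal B_k$. *)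

theory Defs
  imports "HOL-Analysis.Analysis" "HOL-Library.Function_Algebras"
begin

section \<open>Function spaces as real vector spaces\<close>

instantiation "fun" :: (type, real_vector) real_vector
begin

definition scaleR_fun :: "real \<Rightarrow> ('a \<Rightarrow> 'b) \<Rightarrow> 'a \<Rightarrow> 'b"
  where "scaleR_fun c f = (\<lambda>x. c *\<^sub>R f x)"

instance
  by standard (auto simp: scaleR_fun_def fun_eq_iff scaleR_add_right scaleR_add_left)

end


section \<open>Locally convex spaces on carriers\<close>

text \<open>A topological vector space is given by a topology whose \<^const>\<open>topspace\<close> is a linear subspace
  of an ambient real vector space; the ambient type itself carries no topology.\<close>

definition linear_on :: "'a::real_vector set \<Rightarrow> ('a \<Rightarrow> 'b::real_vector) \<Rightarrow> bool"
  where "linear_on V f \<longleftrightarrow>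
    (\<forall>x\<in>V. \<forall>y\<in>V. f (x + y) = f x + f y) \<and> (\<forall>c. \<forall>x\<in>V. f (c *\<^sub>R x) = c *\<^sub>R f x)"

definition seminorm_topology :: "'a::real_vector set \<Rightarrow> ('a \<Rightarrow> real) set \<Rightarrow> 'a topology"
  where "seminorm_topology V P = topology (\<lambda>W. W \<subseteq> V \<and>
    (\<forall>x\<in>W. \<exists>F \<epsilon>. finite F \<and> F \<subseteq> P \<and> 0 < \<epsilon> \<and> {y\<in>V. \<forall>p\<in>F. p (y - x) < \<epsilon>} \<subseteq> W))"

lemma openin_seminorm_topology:
  "openin (seminorm_topology V P) W \<longleftrightarrow> W \<subseteq> V \<and>
    (\<forall>x\<in>W. \<exists>F \<epsilon>. finite F \<and> F \<subseteq> P \<and> 0 < \<epsilon> \<and> {y\<in>V. \<forall>p\<in>F. p (y - x) < \<epsilon>} \<subseteq> W)"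
proof -
  define nbhd where "nbhd = (\<lambda>x W. \<exists>F \<epsilon>. finite F \<and> F \<subseteq> P \<and> (0::real) < \<epsilon> \<and>
    {y\<in>V. \<forall>p\<in>F. p (y - x) < \<epsilon>} \<subseteq> W)"
  have mono: "nbhd x T" if "nbhd x S" "S \<subseteq> T" for x S T
    using that unfolding nbhd_def by (meson subset_trans)
  have int: "nbhd x (S \<inter> T)" if S: "nbhd x S" and T: "nbhd x T" for x S T
  proof -
    obtain F a where F: "finite F" "F \<subseteq> P" "0 < a" "{y\<in>V. \<forall>p\<in>F. p (y - x) < a} \<subseteq> S"
      using S unfolding nbhd_def by (elim exE conjE)
    obtain G b where G: "finite G" "G \<subseteq> P" "0 < b" "{y\<in>V. \<forall>p\<in>G. p (y - x) < b} \<subseteq> T"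
      using T unfolding nbhd_def by (elim exE conjE)
    have "{y\<in>V. \<forall>p\<in>F \<union> G. p (y - x) < min a b} \<subseteq> S \<inter> T"
    proof
      fix y assume y: "y \<in> {y\<in>V. \<forall>p\<in>F \<union> G. p (y - x) < min a b}"
      then have "y \<in> {y\<in>V. \<forall>p\<in>F. p (y - x) < a}" "y \<in> {y\<in>V. \<forall>p\<in>G. p (y - x) < b}"
        by simp_all
      then show "y \<in> S \<inter> T"
        using subsetD[OF F(4)] subsetD[OF G(4)] by simp
    qed
    moreover have "finite (F \<union> G)" "F \<union> G \<subseteq> P" "0 < min a b"
      using F(1-3) G(1-3) by simp_all
    ultimately show ?thesis
      unfolding nbhd_def by (intro exI conjI)
  qed
  have "istopology (\<lambda>W. W \<subseteq> V \<and> (\<forall>x\<in>W. nbhd x W))"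
    unfolding istopology_def
  proof (rule conjI; intro allI impI)
    fix S T assume "S \<subseteq> V \<and> (\<forall>x\<in>S. nbhd x S)" "T \<subseteq> V \<and> (\<forall>x\<in>T. nbhd x T)"
    then show "S \<inter> T \<subseteq> V \<and> (\<forall>x\<in>S \<inter> T. nbhd x (S \<inter> T))"
      by (simp add: int le_infI1)
  next
    fix K assume "\<forall>W\<in>K. W \<subseteq> V \<and> (\<forall>x\<in>W. nbhd x W)"
    then show "\<Union>K \<subseteq> V \<and> (\<forall>x\<in>\<Union>K. nbhd x (\<Union>K))"
      by (meson Union_iff Union_upper Union_least mono)
  qed
  then show ?thesis
    unfolding seminorm_topology_def nbhd_def by (subst topology_inverse') simp_all
qed

lemma topspace_seminorm_topology: "topspace (seminorm_topology V P) = V"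
proof
  show "topspace (seminorm_topology V P) \<subseteq> V"
    using openin_topspace[of "seminorm_topology V P"]
    unfolding openin_seminorm_topology by (rule conjunct1)
  have "\<exists>F \<epsilon>. finite F \<and> F \<subseteq> P \<and> (0::real) < \<epsilon> \<and> {y\<in>V. \<forall>p\<in>F. p (y - x) < \<epsilon>} \<subseteq> V" for x
    by (rule exI[of _ "{}"], rule exI[of _ 1]) simp
  then have "openin (seminorm_topology V P) V"
    unfolding openin_seminorm_topology by simp
  then show "V \<subseteq> topspace (seminorm_topology V P)"
    by (rule openin_subset)
qed

text \<open>Local convexity does not include the Hausdorff axiom.\<close>

definition lcs :: "'a::real_vector topology \<Rightarrow> bool"
  where "lcs X \<longleftrightarrow>
    subspace (topspace X) \<and>
    continuous_map (prod_topology X X) X (\<lambda>(x, y). x + y) \<and>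
    continuous_map (prod_topology euclideanreal X) X (\<lambda>(c, x). c *\<^sub>R x) \<and>
    (\<forall>W. openin X W \<and> 0 \<in> W \<longrightarrow> (\<exists>C. openin X C \<and> convex C \<and> 0 \<in> C \<and> C \<subseteq> W))"

definition tvs_bounded :: "'a::real_vector topology \<Rightarrow> 'a set \<Rightarrow> bool"
  where "tvs_bounded X S \<longleftrightarrow> S \<subseteq> topspace X \<and>
    (\<forall>W. openin X W \<and> 0 \<in> W \<longrightarrow> (\<exists>t>0. S \<subseteq> (\<lambda>x. t *\<^sub>R x) ` W))"

text \<open>Functionals are extended by 0 off the carrier, so that equality of elements of the dual is
  equality of functions.\<close>

definition tvs_dual :: "'a::real_vector topology \<Rightarrow> ('a \<Rightarrow> real) set"
  where "tvs_dual X = {f. linear_on (topspace X) f \<and> continuous_map X euclideanreal f \<and>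
    (\<forall>x. x \<notin> topspace X \<longrightarrow> f x = 0)}"

definition strong_dual :: "'a::real_vector topology \<Rightarrow> ('a \<Rightarrow> real) topology"
  where "strong_dual X = seminorm_topology (tvs_dual X)
    {(\<lambda>f. SUP x\<in>S. \<bar>f x\<bar>) | S. tvs_bounded X S \<and> S \<noteq> {}}"

definition tvs_cauchy :: "'a::real_vector topology \<Rightarrow> 'a filter \<Rightarrow> bool"
  where "tvs_cauchy X F \<longleftrightarrow> F \<noteq> bot \<and> eventually (\<lambda>x. x \<in> topspace X) F \<and>
    (\<forall>W. openin X W \<and> 0 \<in> W \<longrightarrow>
      (\<exists>S. eventually (\<lambda>x. x \<in> S) F \<and> (\<forall>x\<in>S. \<forall>y\<in>S. x - y \<in> W)))"

definition tvs_complete :: "'a::real_vector topology \<Rightarrow> bool"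
  where "tvs_complete X \<longleftrightarrow> (\<forall>F. tvs_cauchy X F \<longrightarrow> (\<exists>l. limitin X (\<lambda>x. x) l F))"

text \<open>\<open>\<kappa> : X \<rightarrow> Y\<close> is the completion of the locally convex space \<open>X\<close>.  Since \<open>X\<close> is not required to be
  Hausdorff, this is the Hausdorff completion: \<open>X\<close> carries the topology induced by \<open>\<kappa>\<close>, and \<open>\<kappa>\<close> is
  injective, i.e. an embedding, exactly when \<open>X\<close> is Hausdorff.\<close>

definition lcs_completion ::
    "'a::real_vector topology \<Rightarrow> 'b::real_vector topology \<Rightarrow> ('a \<Rightarrow> 'b) \<Rightarrow> bool"
  where "lcs_completion X Y \<kappa> \<longleftrightarrow>
    lcs Y \<and> Hausdorff_space Y \<and> tvs_complete Y \<and>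
    linear_on (topspace X) \<kappa> \<and> \<kappa> ` topspace X \<subseteq> topspace Y \<and>
    X = pullback_topology (topspace X) \<kappa> Y \<and>
    Y closure_of (\<kappa> ` topspace X) = topspace Y"

definition banach_on :: "'a::real_vector set \<Rightarrow> ('a \<Rightarrow> real) \<Rightarrow> bool"
  where "banach_on E N \<longleftrightarrow>
    subspace E \<and>
    (\<forall>x\<in>E. 0 \<le> N x \<and> (N x = 0 \<longleftrightarrow> x = 0)) \<and>
    (\<forall>x\<in>E. \<forall>y\<in>E. N (x + y) \<le> N x + N y) \<and>
    (\<forall>c. \<forall>x\<in>E. N (c *\<^sub>R x) = \<bar>c\<bar> * N x) \<and>
    (\<forall>X. range X \<subseteq> E \<and> (\<forall>\<epsilon>>0. \<exists>n0. \<forall>m\<ge>n0. \<forall>n\<ge>n0. N (X m - X n) < \<epsilon>) \<longrightarrow>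
      (\<exists>l\<in>E. (\<lambda>n. N (X n - l)) \<longlonglongrightarrow> 0))"

definition banach_completion ::
    "'a::real_vector set \<Rightarrow> ('a \<Rightarrow> real) \<Rightarrow> 'b::real_vector set \<Rightarrow> ('b \<Rightarrow> real) \<Rightarrow> ('a \<Rightarrow> 'b) \<Rightarrow> bool"
  where "banach_completion P N E N' e \<longleftrightarrow>
    banach_on E N' \<and>
    linear_on P e \<and> e ` P \<subseteq> E \<and> (\<forall>A\<in>P. N' (e A) = N A) \<and>
    (\<forall>x\<in>E. \<forall>\<epsilon>>0. \<exists>A\<in>P. N' (x - e A) < \<epsilon>)"

definition norm_topology :: "'a::real_vector set \<Rightarrow> ('a \<Rightarrow> real) \<Rightarrow> 'a topology"
  where "norm_topology E N = seminorm_topology E {N}"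

text \<open>\<open>iterate_from i r n\<close> is the composite \<open>X r \<rightarrow> X (r + n)\<close> of the maps \<open>i s : X s \<rightarrow> X (s + 1)\<close>.\<close>

primrec iterate_from :: "(nat \<Rightarrow> 'a \<Rightarrow> 'a) \<Rightarrow> nat \<Rightarrow> nat \<Rightarrow> 'a \<Rightarrow> 'a"
  where "iterate_from i r 0 x = x"
  | "iterate_from i r (Suc n) x = i (r + n) (iterate_from i r n x)"

text \<open>\<open>L\<close> with the maps \<open>lam r : X r \<rightarrow> L\<close> is the locally convex inductive limit of the sequence \<open>X\<close>
  along \<open>i\<close>: the algebraic direct limit, with the finest locally convex topology for which all
  \<open>lam r\<close> are continuous.\<close>

definition lc_inductive_limit :: "(nat \<Rightarrow> 'a::real_vector topology) \<Rightarrow> (nat \<Rightarrow> 'a \<Rightarrow> 'a) \<Rightarrow>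
    'b::real_vector topology \<Rightarrow> (nat \<Rightarrow> 'a \<Rightarrow> 'b) \<Rightarrow> bool"
  where "lc_inductive_limit X i L lam \<longleftrightarrow>
    (\<forall>r. linear_on (topspace (X r)) (lam r)) \<and>
    (\<forall>r. \<forall>x\<in>topspace (X r). lam (Suc r) (i r x) = lam r x) \<and>
    topspace L = (\<Union>r. lam r ` topspace (X r)) \<and>
    (\<forall>r. \<forall>x\<in>topspace (X r). lam r x = 0 \<longrightarrow> (\<exists>n. iterate_from i r n x = 0)) \<and>
    lcs L \<and> (\<forall>r. continuous_map (X r) L (lam r)) \<and>
    (\<forall>L'. lcs L' \<and> topspace L' = topspace L \<and> (\<forall>r. continuous_map (X r) L' (lam r)) \<longrightarrow>
      (\<forall>W. openin L' W \<longrightarrow> openin L W))"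


section \<open>Riemannian manifolds\<close>

text \<open>Manifolds are modelled on a type of sort \<open>{real_inner, heine_borel}\<close>.  By Riesz' theorem such a
  space is finite-dimensional; in contrast to \<^class>\<open>euclidean_space\<close>, dimension 0 is allowed.\<close>

text \<open>On an open set \<open>S\<close> of a finite-dimensional space, \<open>C_on r S f\<close> says that \<open>f\<close> is of class \<open>C\<^sup>r\<close>.\<close>

primrec C_on :: "nat \<Rightarrow> 'a::real_normed_vector set \<Rightarrow> ('a \<Rightarrow> 'b::real_normed_vector) \<Rightarrow> bool"
  where "C_on 0 S f \<longleftrightarrow> continuous_on S f"
  | "C_on (Suc r) S f \<longleftrightarrow> (\<forall>x\<in>S. f differentiable (at x)) \<and>
      (\<forall>v. C_on r S (\<lambda>x. frechet_derivative f (at x) v))"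

definition smooth_on :: "'a::real_normed_vector set \<Rightarrow> ('a \<Rightarrow> 'b::real_normed_vector) \<Rightarrow> bool"
  where "smooth_on S f \<longleftrightarrow> (\<forall>r. C_on r S f)"

type_synonym ('m, 'e) chart = "'m set \<times> ('m \<Rightarrow> 'e)"

definition chart_inv :: "('m, 'e) chart \<Rightarrow> 'e \<Rightarrow> 'm"
  where "chart_inv c = inv_into (fst c) (snd c)"

definition smooth_atlas ::
    "('m::topological_space, 'e::{real_inner, heine_borel}) chart set \<Rightarrow> bool"
  where "smooth_atlas \<A> \<longleftrightarrow>
    (\<Union>c\<in>\<A>. fst c) = UNIV \<and>
    (\<forall>c\<in>\<A>. open (fst c) \<and> open (snd c ` fst c) \<and>
      homeomorphism (fst c) (snd c ` fst c) (snd c) (chart_inv c)) \<and>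
    (\<forall>c\<in>\<A>. \<forall>d\<in>\<A>. smooth_on (snd c ` (fst c \<inter> fst d)) (snd d \<circ> chart_inv c))"

text \<open>The tangent space at \<open>p\<close> is the model space \<open>'e\<close>, a tangent vector being identified with its
  coordinate vector in the chart \<open>chart_at M p\<close>.  Thus \<open>rmetric M p\<close> is an inner product on \<open>'e\<close>, and a
  covariant tensor field is a function assigning to \<open>p\<close> a function of lists over \<open>'e\<close>.\<close>

record ('m, 'e) rmanifold =
  charts :: "('m, 'e) chart set"
  rmetric :: "'m \<Rightarrow> 'e \<Rightarrow> 'e \<Rightarrow> real"

definition chart_at :: "('m, 'e) rmanifold \<Rightarrow> 'm \<Rightarrow> ('m, 'e) chart"
  where "chart_at M p = (SOME c. c \<in> charts M \<and> p \<in> fst c)"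

text \<open>\<open>to_tangent M c x v\<close> is the tangent vector at \<open>chart_inv c x\<close> whose coordinate vector in the
  chart \<open>c\<close> is \<open>v\<close>.\<close>

definition to_tangent ::
    "('m, 'e::real_normed_vector) rmanifold \<Rightarrow> ('m, 'e) chart \<Rightarrow> 'e \<Rightarrow> 'e \<Rightarrow> 'e"
  where "to_tangent M c x =
    frechet_derivative (snd (chart_at M (chart_inv c x)) \<circ> chart_inv c) (at x)"

definition tensor_in_chart :: "('m, 'e::real_normed_vector) rmanifold \<Rightarrow> ('m, 'e) chart \<Rightarrow>
    ('m \<Rightarrow> 'e list \<Rightarrow> real) \<Rightarrow> 'e \<Rightarrow> 'e list \<Rightarrow> real"
  where "tensor_in_chart M c T x vs = T (chart_inv c x) (map (to_tangent M c x) vs)"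

definition metric_in_chart ::
    "('m, 'e::real_normed_vector) rmanifold \<Rightarrow> ('m, 'e) chart \<Rightarrow> 'e \<Rightarrow> 'e \<Rightarrow> 'e \<Rightarrow> real"
  where "metric_in_chart M c x v w =
    rmetric M (chart_inv c x) (to_tangent M c x v) (to_tangent M c x w)"

definition riemannian_manifold ::
    "('m::topological_space, 'e::{real_inner, heine_borel}) rmanifold \<Rightarrow> bool"
  where "riemannian_manifold M \<longleftrightarrow>
    smooth_atlas (charts M) \<and>
    (\<forall>p. bilinear (rmetric M p) \<and> (\<forall>v w. rmetric M p v w = rmetric M p w v) \<and>
      (\<forall>v. v \<noteq> 0 \<longrightarrow> 0 < rmetric M p v v)) \<and>
    (\<forall>c\<in>charts M. \<forall>v w. smooth_on (snd c ` fst c) (\<lambda>x. metric_in_chart M c x v w))"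

text \<open>The Levi-Civita connection in the chart \<open>chart_at M p\<close>: \<open>christoffel M p v w\<close> is the covariant
  derivative at \<open>p\<close>, in direction \<open>v\<close>, of the coordinate vector field with constant components \<open>w\<close>,
  as given by the Koszul formula.\<close>

definition christoffel ::
    "('m, 'e::real_normed_vector) rmanifold \<Rightarrow> 'm \<Rightarrow> 'e \<Rightarrow> 'e \<Rightarrow> 'e"
  where "christoffel M p v w =
    (let c = chart_at M p;
         D = (\<lambda>a b d. frechet_derivative (\<lambda>x. metric_in_chart M c x b d) (at (snd c p)) a)
     in THE z. \<forall>y. 2 * rmetric M p z y = D v w y + D w v y - D y v w)"

text \<open>Covariant derivative of a covariant tensor field; the direction of differentiation is the new
  first argument.\<close>

definition cov_deriv :: "('m, 'e::real_normed_vector) rmanifold \<Rightarrow>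
    ('m \<Rightarrow> 'e list \<Rightarrow> real) \<Rightarrow> 'm \<Rightarrow> 'e list \<Rightarrow> real"
  where "cov_deriv M T p vs = (case vs of [] \<Rightarrow> 0 | v # ws \<Rightarrow>
    (let c = chart_at M p
     in frechet_derivative (\<lambda>x. tensor_in_chart M c T x ws) (at (snd c p)) v
        - (\<Sum>i<length ws. T p (ws[i := christoffel M p v (ws ! i)]))))"


section \<open>Differential forms\<close>

definition k_covectors :: "nat \<Rightarrow> ('e::real_vector list \<Rightarrow> real) set"
  where "k_covectors k = {\<eta>.
    (\<forall>vs. length vs \<noteq> k \<longrightarrow> \<eta> vs = 0) \<and>
    (\<forall>vs i. length vs = k \<and> i < k \<longrightarrow> linear (\<lambda>v. \<eta> (vs[i := v]))) \<and>
    (\<forall>vs. length vs = k \<and> \<not> distinct vs \<longrightarrow> \<eta> vs = 0)}"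

text \<open>The \<open>C\<^sup>r\<close> forms of degree \<open>k\<close> on the open set \<open>U\<close>, extended by 0 off \<open>U\<close>.\<close>

definition C_forms :: "('m::topological_space, 'e::{real_inner, heine_borel}) rmanifold \<Rightarrow>
    'm set \<Rightarrow> nat \<Rightarrow> nat \<Rightarrow> ('m \<Rightarrow> 'e list \<Rightarrow> real) set"
  where "C_forms M U k r = {\<omega>.
    (\<forall>p\<in>U. \<omega> p \<in> k_covectors k) \<and> (\<forall>p. p \<notin> U \<longrightarrow> \<omega> p = 0) \<and>
    (\<forall>c\<in>charts M. \<forall>vs. C_on r (snd c ` (fst c \<inter> U)) (\<lambda>x. tensor_in_chart M c \<omega> x vs))}"

text \<open>The pointwise norm of an \<open>m\<close>-covariant tensor is its supremum over arguments of length at most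
  1 in the Riemannian metric; for a \<open>k\<close>-covector this is the comass.\<close>

definition tensor_norm :: "('m, 'e) rmanifold \<Rightarrow> 'm \<Rightarrow> nat \<Rightarrow> ('e list \<Rightarrow> real) \<Rightarrow> real"
  where "tensor_norm M p m \<tau> =
    (SUP vs\<in>{vs. length vs = m \<and> (\<forall>v\<in>set vs. rmetric M p v v \<le> 1)}. \<bar>\<tau> vs\<bar>)"

definition deriv_norms :: "('m, 'e::real_normed_vector) rmanifold \<Rightarrow> 'm set \<Rightarrow> nat \<Rightarrow> nat \<Rightarrow>
    ('m \<Rightarrow> 'e list \<Rightarrow> real) \<Rightarrow> real set"
  where "deriv_norms M U k r \<omega> =
    {tensor_norm M p (j + k) ((cov_deriv M ^^ j) \<omega> p) | p j. p \<in> U \<and> j \<le> r}"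

definition B_forms :: "('m::topological_space, 'e::{real_inner, heine_borel}) rmanifold \<Rightarrow>
    'm set \<Rightarrow> nat \<Rightarrow> nat \<Rightarrow> ('m \<Rightarrow> 'e list \<Rightarrow> real) set"
  where "B_forms M U k r = {\<omega> \<in> C_forms M U k r. bdd_above (deriv_norms M U k r \<omega>)}"

text \<open>Inserting 0, here and in \<open>B_norm\<close>, only matters if the set is empty (e.g. if \<open>U\<close> is).\<close>

definition C_norm :: "('m, 'e::real_normed_vector) rmanifold \<Rightarrow> 'm set \<Rightarrow> nat \<Rightarrow> nat \<Rightarrow>
    ('m \<Rightarrow> 'e list \<Rightarrow> real) \<Rightarrow> real"
  where "C_norm M U k r \<omega> = Sup (insert 0 (deriv_norms M U k r \<omega>))"

text \<open>The projective limit of the decreasing sequence \<open>B_forms M U k r\<close>, as a Frechet space.\<close>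

definition B_smooth_forms :: "('m::topological_space, 'e::{real_inner, heine_borel}) rmanifold \<Rightarrow>
    'm set \<Rightarrow> nat \<Rightarrow> ('m \<Rightarrow> 'e list \<Rightarrow> real) set"
  where "B_smooth_forms M U k = (\<Inter>r. B_forms M U k r)"

definition B_space :: "('m::topological_space, 'e::{real_inner, heine_borel}) rmanifold \<Rightarrow>
    'm set \<Rightarrow> nat \<Rightarrow> ('m \<Rightarrow> 'e list \<Rightarrow> real) topology"
  where "B_space M U k = seminorm_topology (B_smooth_forms M U k) (range (C_norm M U k))"


section \<open>Pointed chains\<close>

text \<open>The \<open>k\<close>-th exterior power of a finite-dimensional space, realised inside the dual of the space
  of \<open>k\<close>-covectors: \<open>v\<^sub>1 \<and> \<dots> \<and> v\<^sub>k\<close> is evaluation at \<open>(v\<^sub>1, \<dots>, v\<^sub>k)\<close>.  The value of a \<open>k\<close>-covector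
  \<open>\<eta>\<close> on a \<open>k\<close>-vector \<open>\<alpha>\<close> is then \<open>\<alpha> \<eta>\<close>.\<close>

definition wedge :: "'e::real_vector list \<Rightarrow> ('e list \<Rightarrow> real) \<Rightarrow> real"
  where "wedge vs = (\<lambda>\<eta>. if \<eta> \<in> k_covectors (length vs) then \<eta> vs else 0)"

definition exterior_power :: "nat \<Rightarrow> (('e::real_vector list \<Rightarrow> real) \<Rightarrow> real) set"
  where "exterior_power k = span {wedge vs | vs. length vs = k}"

definition pointed_chains ::
    "'m set \<Rightarrow> nat \<Rightarrow> ('m \<Rightarrow> ('e::real_vector list \<Rightarrow> real) \<Rightarrow> real) set"
  where "pointed_chains U k = {A.
    finite {p. A p \<noteq> 0} \<and> {p. A p \<noteq> 0} \<subseteq> U \<and> (\<forall>p. A p \<in> exterior_power k)}"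

definition chain_integral ::
    "('m \<Rightarrow> ('e list \<Rightarrow> real) \<Rightarrow> real) \<Rightarrow> ('m \<Rightarrow> 'e list \<Rightarrow> real) \<Rightarrow> real"
  where "chain_integral A \<omega> = (\<Sum>p | A p \<noteq> 0. A p (\<omega> p))"

definition B_norm :: "('m::topological_space, 'e::{real_inner, heine_borel}) rmanifold \<Rightarrow>
    'm set \<Rightarrow> nat \<Rightarrow> nat \<Rightarrow> ('m \<Rightarrow> ('e list \<Rightarrow> real) \<Rightarrow> real) \<Rightarrow> real"
  where "B_norm M U k r A =
    Sup (insert 0 {chain_integral A \<omega> / C_norm M U k r \<omega> | \<omega>. \<omega> \<in> B_forms M U k r \<and> \<omega> \<noteq> 0})"

text \<open>The canonical maps between the completions \<open>E r\<close> of the pointed chains: the continuous linear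
  extensions of the identity of \<open>P\<close>.\<close>

definition canonical_maps :: "'a set \<Rightarrow> (nat \<Rightarrow> 'b::real_vector set) \<Rightarrow> (nat \<Rightarrow> 'b \<Rightarrow> real) \<Rightarrow>
    (nat \<Rightarrow> 'a \<Rightarrow> 'b) \<Rightarrow> (nat \<Rightarrow> 'b \<Rightarrow> 'b) \<Rightarrow> bool"
  where "canonical_maps P E N e i \<longleftrightarrow> (\<forall>r.
    linear_on (E r) (i r) \<and>
    continuous_map (norm_topology (E r) (N r)) (norm_topology (E (Suc r)) (N (Suc r))) (i r) \<and>
    (\<forall>A\<in>P. i r (e r A) = e (Suc r) A))"

text \<open>For a topological vector space \<open>C\<close> with a dense map \<open>\<iota>\<close> from the pointed chains: the extension
  of a form to a continuous linear functional on \<open>C\<close>, and the evaluation map.\<close>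

definition form_extension :: "'m set \<Rightarrow> nat \<Rightarrow> 'c::real_vector topology \<Rightarrow>
    (('m \<Rightarrow> ('e::real_vector list \<Rightarrow> real) \<Rightarrow> real) \<Rightarrow> 'c) \<Rightarrow> ('m \<Rightarrow> 'e list \<Rightarrow> real) \<Rightarrow> 'c \<Rightarrow> real"
  where "form_extension U k C \<iota> \<omega> =
    (THE f. f \<in> tvs_dual C \<and> (\<forall>A\<in>pointed_chains U k. f (\<iota> A) = chain_integral A \<omega>))"

definition evaluation_map :: "('m::topological_space, 'e::{real_inner, heine_borel}) rmanifold \<Rightarrow>
    'm set \<Rightarrow> nat \<Rightarrow> 'c::real_vector topology \<Rightarrow>
    (('m \<Rightarrow> ('e list \<Rightarrow> real) \<Rightarrow> real) \<Rightarrow> 'c) \<Rightarrow> 'c \<Rightarrow> ('m \<Rightarrow> 'e list \<Rightarrow> real) \<Rightarrow> real"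
  where "evaluation_map M U k C \<iota> J =
    (\<lambda>\<omega>. if \<omega> \<in> B_smooth_forms M U k then form_extension U k C \<iota> \<omega> J else 0)"

end

theory Submission
  imports Defs
begin

text \<open>Let \<open>q\<close> be the Minkowski functional of a convex neighbourhood of 0 in the space \<open>C\<close> of chains. By
  Hahn-Banach, \<open>q\<close> is the supremum of the functionals that it dominates, and such a functional \<open>f\<close>
  satisfies \<open>f A \<le> K r * B_norm r A\<close> on pointed chains for every \<open>r\<close>, with constants depending only on
  \<open>q\<close>. The main point is that \<open>f\<close> is then integration of a smooth form whose \<open>C\<^sup>r\<close> norms are
  controlled by the \<open>K r\<close>: again by Hahn-Banach, \<open>f\<close> is a mean over the ball of radius \<open>K r\<close> in
  the \<open>C\<^sup>r\<close> forms, and covariant derivatives of order less than \<open>r\<close> commute with such means. So the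
  polar of the neighbourhood is a bounded set of forms, and \<open>u\<close> is open onto its image. Conversely, a
  bounded set of forms is equicontinuous on each Banach space \<open>E r\<close>, hence on the inductive limit and on
  its completion, which makes \<open>u\<close> continuous.\<close>

text \<open>A mean produced by Hahn-Banach is only finitely additive, so pointwise convergence of
  difference quotients is not enough: every limit has to be uniform over the ball of forms. Locally
  uniform second-order Taylor remainders provide this, and continuity of the top derivative is again
  obtained from differentiability; hence the shift by two in \<open>K (Suc (Suc r))\<close>. The
  form itself is read off from the values of the functional on simple pointed chains, so the means
  for all orders describe one and the same form. The norms of forms use covariant derivatives,
  whereas differentiation under a mean happens in charts. Since \<open>cov_deriv\<close> uses at
  every point the chart chosen there, and that choice may jump, the change-of-chart law of the
  Christoffel symbols is needed before an iterated covariant derivative can be treated as a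
  differentiable field in one fixed chart. The completions and the limit are arbitrary realisations,
  and \<open>\<kappa>\<close> and \<open>i r\<close> are not assumed injective, so functionals are
  carried along them by domination and density.\<close>

section \<open>Finite orthonormal bases\<close>

definition onb :: "'e::{real_inner, heine_borel} set"
  where "onb = (SOME B. finite B \<and> (\<forall>b\<in>B. norm b = 1) \<and> (\<forall>b\<in>B. \<forall>c\<in>B. b \<noteq> c \<longrightarrow> inner b c = 0) \<and>
    (\<forall>x. x = (\<Sum>b\<in>B. inner x b *\<^sub>R b)))"

text \<open>Otherwise every finite orthonormal set could be enlarged by a normalised remainder of
  the expansion, giving an infinite orthonormal sequence. Its members have pairwise distance sqrt 2,
  so no subsequence is Cauchy, against the Heine-Borel property.\<close>

lemma ex_onb:
  "\<exists>B::'e::{real_inner, heine_borel} set. finite B \<and> (\<forall>b\<in>B. norm b = 1) \<and>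
    (\<forall>b\<in>B. \<forall>c\<in>B. b \<noteq> c \<longrightarrow> inner b c = 0) \<and> (\<forall>x. x = (\<Sum>b\<in>B. inner x b *\<^sub>R b))"
proof (rule ccontr)
  assume neg: "\<not> ?thesis"
  have ext: "\<exists>y. norm y = 1 \<and> (\<forall>b\<in>B. inner y b = 0)"
    if B: "finite B" "\<forall>b\<in>B. norm b = 1" "\<forall>b\<in>B. \<forall>c\<in>B. b \<noteq> c \<longrightarrow> inner b c = 0" for B :: "'e set"
  proof -
    have "\<not> (\<forall>x. x = (\<Sum>b\<in>B. inner x b *\<^sub>R b))"
      using neg B by blast
    then obtain x where x: "x \<noteq> (\<Sum>b\<in>B. inner x b *\<^sub>R b)"
      by blast
    define y where "y = x - (\<Sum>b\<in>B. inner x b *\<^sub>R b)"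
    have y0: "y \<noteq> 0" using x by (simp add: y_def)
    have "inner y b = 0" if b: "b \<in> B" for b
    proof -
      have "inner (\<Sum>c\<in>B. inner x c *\<^sub>R c) b = (\<Sum>c\<in>B. inner x c * inner c b)"
        by (simp add: inner_sum_left)
      also have "\<dots> = (\<Sum>c\<in>B. if c = b then inner x b else 0)"
        using B b by (intro sum.cong refl) (simp add: dot_square_norm)
      also have "\<dots> = inner x b"
        using B b by simp
      finally show ?thesis by (simp add: y_def inner_diff_left)
    qed
    then show ?thesis
      using y0 by (intro exI[of _ "y /\<^sub>R norm y"]) simp
  qed
  have "\<exists>f::nat \<Rightarrow> 'e. \<forall>n. norm (f n) = 1 \<and> (\<forall>m<n. inner (f n) (f m) = 0)"
  proof (rule dependent_wellorder_choice)
    fix n and f :: "nat \<Rightarrow> 'e"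
    assume *: "\<And>m. m < n \<Longrightarrow> norm (f m) = 1 \<and> (\<forall>l<m. inner (f m) (f l) = 0)"
    have "\<exists>y. norm y = 1 \<and> (\<forall>b\<in>f ` {..<n}. inner y b = 0)"
    proof (rule ext)
      show "\<forall>b\<in>f ` {..<n}. \<forall>c\<in>f ` {..<n}. b \<noteq> c \<longrightarrow> inner b c = 0"
      proof (intro ballI impI)
        fix b c assume "b \<in> f ` {..<n}" "c \<in> f ` {..<n}" "b \<noteq> c"
        then obtain l m where lm: "b = f l" "c = f m" "l < n" "m < n" "l \<noteq> m" by auto
        then show "inner b c = 0"
          using *[of l] *[of m] inner_commute[of "f l" "f m"] by (cases l m rule: linorder_cases) auto
      qed
    qed (use * in auto)
    then show "\<exists>r. norm r = 1 \<and> (\<forall>m<n. inner r (f m) = 0)" by auto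
  qed auto
  then obtain f :: "nat \<Rightarrow> 'e" where f: "\<And>n. norm (f n) = 1" "\<And>n m. m < n \<Longrightarrow> inner (f n) (f m) = 0"
    by blast
  have "bounded (range f)"
    using f(1) by (intro boundedI[of _ 1]) auto
  then obtain l r where r: "strict_mono (r::nat \<Rightarrow> nat)" "(f \<circ> r) \<longlonglongrightarrow> l"
    using bounded_imp_convergent_subsequence by blast
  then have "Cauchy (f \<circ> r)" by (simp add: LIMSEQ_imp_Cauchy)
  then obtain n0 where n0: "\<And>m n. m \<ge> n0 \<Longrightarrow> n \<ge> n0 \<Longrightarrow> dist (f (r m)) (f (r n)) < 1"
    unfolding Cauchy_def by (metis comp_apply zero_less_one)
  have "r n0 < r (Suc n0)" using r(1) by (simp add: strict_mono_Suc_iff)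
  then have "inner (f (r (Suc n0))) (f (r n0)) = 0" by (rule f(2))
  then have "(norm (f (r (Suc n0)) - f (r n0)))\<^sup>2 = 2"
    using f(1) unfolding power2_norm_eq_inner norm_eq_1
    by (simp add: inner_diff inner_commute[of "f (r n0)"])
  moreover have "norm (f (r (Suc n0)) - f (r n0)) < 1"
    using n0[of "Suc n0" n0] by (simp add: dist_norm)
  ultimately show False
    using power_le_one[of "norm (f (r (Suc n0)) - f (r n0))" 2] by simp
qed

lemma
  shows finite_onb [simp]: "finite (onb :: 'e::{real_inner, heine_borel} set)"
    and norm_onb [simp]: "b \<in> (onb :: 'e set) \<Longrightarrow> norm b = 1"
    and orthogonal_onb: "b \<in> (onb :: 'e set) \<Longrightarrow> c \<in> onb \<Longrightarrow> b \<noteq> c \<Longrightarrow> inner b c = 0"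
    and onb_expansion: "x = (\<Sum>b\<in>onb. inner x b *\<^sub>R (b::'e))"
proof -
  have *: "finite (onb :: 'e set) \<and> (\<forall>b\<in>(onb :: 'e set). norm b = 1) \<and>
      (\<forall>b\<in>(onb :: 'e set). \<forall>c\<in>onb. b \<noteq> c \<longrightarrow> inner b c = 0) \<and> (\<forall>x::'e. x = (\<Sum>b\<in>onb. inner x b *\<^sub>R b))"
    unfolding onb_def by (rule someI_ex[OF ex_onb])
  show "finite (onb :: 'e set)" "b \<in> (onb :: 'e set) \<Longrightarrow> norm b = 1"
      "b \<in> (onb :: 'e set) \<Longrightarrow> c \<in> onb \<Longrightarrow> b \<noteq> c \<Longrightarrow> inner b c = 0"
    using * by blast+
  show "x = (\<Sum>b\<in>onb. inner x b *\<^sub>R b)"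
    using * by blast
qed

lemma linear_onb_expansion:
  fixes f :: "'e::{real_inner, heine_borel} \<Rightarrow> 'b::real_vector"
  assumes "linear f"
  shows "f x = (\<Sum>b\<in>onb. inner x b *\<^sub>R f b)"
proof -
  have "f x = f (\<Sum>b\<in>onb. inner x b *\<^sub>R b)"
    using onb_expansion[of x] by simp
  also have "\<dots> = (\<Sum>b\<in>onb. inner x b *\<^sub>R f b)"
    using assms by (simp add: linear_sum linear_scale)
  finally show ?thesis .
qed

lemma norm_linear_onb_le:
  fixes f :: "'e::{real_inner, heine_borel} \<Rightarrow> 'b::real_normed_vector"
  assumes "linear f"
  shows "norm (f x) \<le> (\<Sum>b\<in>onb. norm (f b)) * norm x"
proof -
  have "norm (f x) \<le> (\<Sum>b\<in>onb. norm (inner x b *\<^sub>R f b))"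
    unfolding linear_onb_expansion[OF assms, of x] by (rule norm_sum)
  also have "\<dots> \<le> (\<Sum>b\<in>onb. norm (f b) * norm x)"
  proof (rule sum_mono)
    fix b :: 'e assume b: "b \<in> onb"
    have "\<bar>inner x b\<bar> \<le> norm x"
      using Cauchy_Schwarz_ineq2[of x b] b by simp
    then show "norm (inner x b *\<^sub>R f b) \<le> norm (f b) * norm x"
      by (simp add: mult.commute[of "norm (f b)"] mult_right_mono)
  qed
  finally show ?thesis by (simp add: sum_distrib_right)
qed

lemma linear_imp_bounded_linear_onb:
  fixes f :: "'e::{real_inner, heine_borel} \<Rightarrow> 'b::real_normed_vector"
  assumes "linear f"
  shows "bounded_linear f"
  using norm_linear_onb_le[OF assms] assms
  by (auto intro!: bounded_linear_intro[of _ "\<Sum>b\<in>onb. norm (f b)"] simp: linear_add linear_scale mult.commute)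

text \<open>The locale of finite-dimensional spaces asks for an explicit finite basis; a maximal
  independent subset of \<open>onb\<close> serves as one.\<close>

lemma linear_inj_imp_surj_onb:
  fixes f :: "'e::{real_inner, heine_borel} \<Rightarrow> 'e"
  assumes "linear f" "inj f"
  shows "surj f"
proof -
  have "span (onb :: 'e set) = UNIV"
  proof (intro set_eqI iffI UNIV_I)
    fix x :: 'e
    show "x \<in> span onb"
      by (subst onb_expansion[of x]) (intro span_sum span_scale span_base)
  qed
  moreover obtain B :: "'e set" where "B \<subseteq> onb" "independent B" "onb \<subseteq> span B"
    using maximal_independent_subset[of onb] by blast
  ultimately have B: "finite B" "independent B" "span B = UNIV"
    using finite_subset[of B onb] span_mono[of onb "span B"] by (auto simp: span_span)
  interpret fd: finite_dimensional_vector_space "scaleR :: real \<Rightarrow> 'e \<Rightarrow> 'e" B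
    by standard (use B in \<open>auto simp: dependent_raw_def[symmetric] span_raw_def[symmetric]\<close>)
  show ?thesis
    using fd.linear_inj_imp_surj[of f] assms by (simp add: linear_def)
qed

section \<open>The Hahn-Banach theorem\<close>

text \<open>Partial extensions are represented by their graphs, which are subspaces of the product
  with the reals, so that extension is inclusion and Zorn's lemma applies to sets. A maximal graph
  is single-valued because \<open>q 0 = 0\<close>, and total by the usual extension along one more
  vector.\<close>

lemma hahn_banach:
  fixes q :: "'a::real_vector \<Rightarrow> real"
  assumes V: "subspace V" and W: "subspace W" "W \<subseteq> V"
    and q: "\<And>x y. x \<in> V \<Longrightarrow> y \<in> V \<Longrightarrow> q (x + y) \<le> q x + q y"
      "\<And>c x. 0 < c \<Longrightarrow> x \<in> V \<Longrightarrow> q (c *\<^sub>R x) = c * q x"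
    and f: "linear_on W f" "\<And>x. x \<in> W \<Longrightarrow> f x \<le> q x"
  shows "\<exists>g. linear_on V g \<and> (\<forall>x\<in>W. g x = f x) \<and> (\<forall>x\<in>V. g x \<le> q x) \<and> (\<forall>x. x \<notin> V \<longrightarrow> g x = 0)"
proof -
  define \<G> where "\<G> = {G :: ('a \<times> real) set. subspace G \<and> (\<lambda>x. (x, f x)) ` W \<subseteq> G \<and>
    (\<forall>(x, a)\<in>G. x \<in> V \<and> a \<le> q x)}"
  have q0: "q 0 = 0"
    using q(2)[of 2 0] subspace_0[OF V] by simp
  have G0: "(\<lambda>x. (x, f x)) ` W \<in> \<G>"
  proof -
    have "subspace ((\<lambda>x. (x, f x)) ` W)"
    proof (rule subspaceI)
      have "f 0 = 0" using f(1) W subspace_0[of W] unfolding linear_on_def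
        by (metis scaleR_zero_left)
      then show "0 \<in> (\<lambda>x. (x, f x)) ` W"
        using subspace_0[OF W(1)] by (auto simp: zero_prod_def image_iff intro!: bexI[of _ 0])
    next
      fix u v assume "u \<in> (\<lambda>x. (x, f x)) ` W" "v \<in> (\<lambda>x. (x, f x)) ` W"
      then obtain x y where "u = (x, f x)" "v = (y, f y)" "x \<in> W" "y \<in> W" by auto
      then show "u + v \<in> (\<lambda>x. (x, f x)) ` W"
        using f(1) subspace_add[OF W(1), of x y] by (auto simp: linear_on_def image_iff)
    next
      fix c u assume "u \<in> (\<lambda>x. (x, f x)) ` W"
      then obtain x where "u = (x, f x)" "x \<in> W" by auto
      then show "c *\<^sub>R u \<in> (\<lambda>x. (x, f x)) ` W"
        using f(1) subspace_scale[OF W(1), of x c] by (auto simp: linear_on_def image_iff)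
    qed
    then show ?thesis unfolding \<G>_def using W f by auto
  qed
  have "\<exists>M\<in>\<G>. \<forall>X\<in>\<G>. M \<subseteq> X \<longrightarrow> X = M"
  proof (rule subset_Zorn_nonempty)
    show "\<G> \<noteq> {}" using G0 by auto
  next
    fix \<C> assume ne: "\<C> \<noteq> {}" and ch: "subset.chain \<G> \<C>"
    have "\<And>G. G \<in> \<C> \<Longrightarrow> G \<in> \<G>" using ch by (auto simp: subset_chain_def)
    then have sub: "\<And>G. G \<in> \<C> \<Longrightarrow> subspace G" "\<And>G. G \<in> \<C> \<Longrightarrow> (\<lambda>x. (x, f x)) ` W \<subseteq> G"
      and subq: "\<And>G x a. G \<in> \<C> \<Longrightarrow> (x, a) \<in> G \<Longrightarrow> x \<in> V \<and> a \<le> q x"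
      unfolding \<G>_def by blast+
    have "subspace (\<Union>\<C>)"
    proof (rule subspaceI)
      show "0 \<in> \<Union>\<C>" using ne sub(1) subspace_0 by blast
    next
      fix u v assume "u \<in> \<Union>\<C>" "v \<in> \<Union>\<C>"
      then obtain G H where "G \<in> \<C>" "H \<in> \<C>" "u \<in> G" "v \<in> H" by auto
      then obtain K where "K \<in> \<C>" "u \<in> K" "v \<in> K"
        using ch unfolding subset_chain_def by blast
      then show "u + v \<in> \<Union>\<C>" using sub(1)[of K] subspace_add by blast
    next
      fix c u assume "u \<in> \<Union>\<C>"
      then show "c *\<^sub>R u \<in> \<Union>\<C>" using sub(1) subspace_scale by blast
    qed
    moreover have "(\<lambda>x. (x, f x)) ` W \<subseteq> \<Union>\<C>"
      using ne sub(2) by blast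
    moreover have "\<forall>(x, a)\<in>\<Union>\<C>. x \<in> V \<and> a \<le> q x"
      using subq by blast
    ultimately show "\<Union>\<C> \<in> \<G>" by (simp add: \<G>_def)
  qed
  then obtain G where G: "G \<in> \<G>" and max: "\<And>X. X \<in> \<G> \<Longrightarrow> G \<subseteq> X \<Longrightarrow> X = G" by blast
  have subG: "subspace G" and fG: "\<And>x. x \<in> W \<Longrightarrow> (x, f x) \<in> G"
    and GV: "\<And>x a. (x, a) \<in> G \<Longrightarrow> x \<in> V" and Gq: "\<And>x a. (x, a) \<in> G \<Longrightarrow> a \<le> q x"
    using G by (auto simp: \<G>_def)
  have single: "a = b" if "(x, a) \<in> G" "(x, b) \<in> G" for x a b
  proof -
    have "(0, a - b) \<in> G" "(0, b - a) \<in> G"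
      using subspace_diff[OF subG that] subspace_diff[OF subG that(2,1)] by auto
    then show ?thesis using Gq[of 0 "a - b"] Gq[of 0 "b - a"] q0 by simp
  qed
  have dom: "\<exists>a. (x0, a) \<in> G" if x0: "x0 \<in> V" for x0
  proof (rule ccontr)
    assume nex: "\<nexists>a. (x0, a) \<in> G"
    \<comment> \<open>Every lower bound for the value at \<open>x0\<close> lies below every upper
      bound; \<open>a0\<close> is the supremum of the lower ones, which exists because the pair (0,
      0) belongs to \<open>G\<close>.\<close>
    have cross: "a - q (x - x0) \<le> q (y + x0) - b" if "(x, a) \<in> G" "(y, b) \<in> G" for x y a b
    proof -
      have "(x + y, a + b) \<in> G" using subspace_add[OF subG that] by simp
      then have "a + b \<le> q (x + y)" by (rule Gq)
      also have "x + y = (x - x0) + (y + x0)" by simp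
      also have "q \<dots> \<le> q (x - x0) + q (y + x0)"
        using that x0 V by (intro q) (auto intro: subspace_diff subspace_add GV)
      finally show ?thesis by simp
    qed
    define a0 where "a0 = Sup {a - q (x - x0) | x a. (x, a) \<in> G}"
    have z: "(0, 0) \<in> G" using subspace_0[OF subG] by (simp add: zero_prod_def)
    have up: "a - q (x - x0) \<le> a0" if "(x, a) \<in> G" for x a
      unfolding a0_def
      by (rule cSup_upper, use that in blast, rule bdd_aboveI[of _ "q (0 + x0) - 0"])
        (use cross[OF _ z] in auto)
    have lo: "a0 \<le> q (y + x0) - b" if "(y, b) \<in> G" for y b
      unfolding a0_def by (rule cSup_least) (use z cross[OF _ that] in auto)
    define H where "H = span (insert (x0, a0) G)"
    have Hmem: "\<exists>t. \<exists>(y, b)\<in>G. x = y + t *\<^sub>R x0 \<and> a = b + t * a0" if "(x, a) \<in> H" for x a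
    proof -
      from that obtain t where "(x, a) - t *\<^sub>R (x0, a0) \<in> span G"
        unfolding H_def span_insert by blast
      then have "(x - t *\<^sub>R x0, a - t * a0) \<in> G"
        using span_eq_iff[THEN iffD2, OF subG] by simp
      then show ?thesis by (intro exI[of _ t] bexI[of _ "(x - t *\<^sub>R x0, a - t * a0)"]) auto
    qed
    have "x \<in> V \<and> a \<le> q x" if xa: "(x, a) \<in> H" for x a
    proof -
      obtain t y b where y: "(y, b) \<in> G" "x = y + t *\<^sub>R x0" "a = b + t * a0"
        using Hmem[OF xa] by auto
      have xV: "x \<in> V" using y GV x0 V by (auto intro: subspace_add subspace_scale)
      \<comment> \<open>Dividing by the absolute value of \<open>t\<close> reduces both signs to the
        bounds \<open>lo\<close> and \<open>up\<close> at coefficient 1.\<close>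
      consider "t = 0" | "t > 0" | "t < 0" by linarith
      then have "a \<le> q x"
      proof cases
        case 1 then show ?thesis using y Gq by auto
      next
        case 2
        have "((1/t) *\<^sub>R y, (1/t) * b) \<in> G" using subspace_scale[OF subG y(1), of "1/t"] by simp
        from lo[OF this] have "t * a0 \<le> t * q ((1/t) *\<^sub>R y + x0) - b"
          using 2 by (simp add: field_simps)
        also have "t * q ((1/t) *\<^sub>R y + x0) = q (t *\<^sub>R ((1/t) *\<^sub>R y + x0))"
          using 2 y GV x0 V by (intro q(2)[symmetric]) (auto intro: subspace_add subspace_scale)
        also have "t *\<^sub>R ((1/t) *\<^sub>R y + x0) = x" using 2 y by (simp add: scaleR_add_right)
        finally show ?thesis using y by simp
      next
        case 3
        define s where "s = - t"
        have s: "s > 0" using 3 by (simp add: s_def)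
        have "((1/s) *\<^sub>R y, (1/s) * b) \<in> G" using subspace_scale[OF subG y(1), of "1/s"] by simp
        from up[OF this] have "b - s * q ((1/s) *\<^sub>R y - x0) \<le> s * a0"
          using s by (simp add: field_simps)
        also have "s * q ((1/s) *\<^sub>R y - x0) = q (s *\<^sub>R ((1/s) *\<^sub>R y - x0))"
          using s y GV x0 V by (intro q(2)[symmetric]) (auto intro: subspace_diff subspace_scale)
        also have "s *\<^sub>R ((1/s) *\<^sub>R y - x0) = x" using s y by (simp add: scaleR_diff_right s_def)
        finally show ?thesis using y by (simp add: s_def)
      qed
      with xV show ?thesis by simp
    qed
    moreover have GH: "insert (x0, a0) G \<subseteq> H" unfolding H_def by (rule span_superset)
    ultimately have "H \<in> \<G>" using fG by (auto simp: \<G>_def H_def)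
    then have "H = G" using max GH by blast
    then show False using GH nex by auto
  qed
  define g where "g = (\<lambda>x. if x \<in> V then THE a. (x, a) \<in> G else 0)"
  have g: "(x, g x) \<in> G" if x: "x \<in> V" for x
  proof -
    obtain a where a: "(x, a) \<in> G" using dom[OF x] ..
    then have "(THE a. (x, a) \<in> G) = a" using single by blast
    then show ?thesis using a x by (simp add: g_def)
  qed
  have geq: "g x = a" if xa: "(x, a) \<in> G" for x a
    using single[OF g[OF GV[OF xa]] xa] .
  show ?thesis
  proof (intro exI[of _ g] conjI ballI allI impI)
    show "linear_on V g"
      unfolding linear_on_def
    proof (intro conjI ballI allI)
      fix x y assume "x \<in> V" "y \<in> V"
      then show "g (x + y) = g x + g y"
        using subspace_add[OF subG g g, of x y] by (simp add: geq)
    next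
      fix c x assume "x \<in> V"
      then show "g (c *\<^sub>R x) = c *\<^sub>R g x"
        using subspace_scale[OF subG g, of x c] by (simp add: geq)
    qed
    show "g x = f x" if "x \<in> W" for x using fG[OF that] by (rule geq)
    show "g x \<le> q x" if "x \<in> V" for x using Gq[OF g[OF that]] .
    show "g x = 0" if "x \<notin> V" for x using that by (simp add: g_def)
  qed
qed

section \<open>Seminorms on a linear subspace\<close>

definition seminorm_on :: "'a::real_vector set \<Rightarrow> ('a \<Rightarrow> real) \<Rightarrow> bool"
  where "seminorm_on V q \<longleftrightarrow> (\<forall>x\<in>V. 0 \<le> q x) \<and> (\<forall>x\<in>V. \<forall>y\<in>V. q (x + y) \<le> q x + q y) \<and>
    (\<forall>c. \<forall>x\<in>V. q (c *\<^sub>R x) = \<bar>c\<bar> * q x)"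

lemma seminorm_onD:
  assumes "seminorm_on V q"
  shows "x \<in> V \<Longrightarrow> 0 \<le> q x" "x \<in> V \<Longrightarrow> y \<in> V \<Longrightarrow> q (x + y) \<le> q x + q y" "x \<in> V \<Longrightarrow> q (c *\<^sub>R x) = \<bar>c\<bar> * q x"
  using assms by (auto simp: seminorm_on_def)

lemma seminorm_on_zero: "seminorm_on V q \<Longrightarrow> subspace V \<Longrightarrow> q 0 = 0"
  using seminorm_onD(3)[of V q 0 0] subspace_0[of V] by simp

lemma seminorm_on_minus: "seminorm_on V q \<Longrightarrow> x \<in> V \<Longrightarrow> q (- x) = q x"
  using seminorm_onD(3)[of V q x "-1"] by simp

text \<open>Nonnegativity follows from \<open>q 0 \<le> q x + q (- x)\<close>, and one inequality
  for homogeneity suffices because it can be applied to \<open>1/c\<close> as well.\<close>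

lemma seminorm_onI:
  assumes V: "subspace V" and zero: "q 0 = 0"
    and tri: "\<And>x y. x \<in> V \<Longrightarrow> y \<in> V \<Longrightarrow> q (x + y) \<le> q x + q y"
    and hom: "\<And>c x. c \<noteq> 0 \<Longrightarrow> x \<in> V \<Longrightarrow> q (c *\<^sub>R x) \<le> \<bar>c\<bar> * q x"
  shows "seminorm_on V q"
  unfolding seminorm_on_def
proof (intro conjI ballI allI tri)
  show "0 \<le> q x" if x: "x \<in> V" for x
    using tri[OF x subspace_scale[OF V x, of "-1"]] hom[OF _ x, of "-1"] zero by simp
  show "q (c *\<^sub>R x) = \<bar>c\<bar> * q x" if x: "x \<in> V" for c x
  proof (cases "c = 0")
    case False
    have "q ((1/c) *\<^sub>R (c *\<^sub>R x)) \<le> \<bar>1/c\<bar> * q (c *\<^sub>R x)"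
      using False by (intro hom subspace_scale[OF V x]) simp
    then have "\<bar>c\<bar> * q x \<le> q (c *\<^sub>R x)" using False by (simp add: field_simps)
    then show ?thesis using hom[OF False x] by simp
  qed (simp add: zero)
qed

lemma seminorm_on_triangle:
  assumes "seminorm_on V q" "subspace V" "x \<in> V" "y \<in> V" "z \<in> V"
  shows "q (x - z) \<le> q (x - y) + q (y - z)"
  using seminorm_onD(2)[OF assms(1), of "x - y" "y - z"] assms by (simp add: subspace_diff)

lemma linear_onD:
  assumes "linear_on V f"
  shows "x \<in> V \<Longrightarrow> y \<in> V \<Longrightarrow> f (x + y) = f x + f y" "x \<in> V \<Longrightarrow> f (c *\<^sub>R x) = c *\<^sub>R f x"
  using assms by (auto simp: linear_on_def)

lemma linear_on_zero: "linear_on V f \<Longrightarrow> subspace V \<Longrightarrow> f 0 = 0"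
  using linear_onD(2)[of V f 0 0] subspace_0[of V] by simp

lemma linear_on_diff:
  assumes "linear_on V f" "subspace V" "x \<in> V" "y \<in> V"
  shows "f (x - y) = f x - f y"
  using linear_onD(1)[OF assms(1), of x "- y"] linear_onD(2)[OF assms(1,4), of "-1"] assms
  by (simp add: subspace_neg)

lemma seminorm_on_abs_linear: "linear_on V f \<Longrightarrow> seminorm_on V (\<lambda>x. \<bar>f x :: real\<bar>)"
  by (auto simp: seminorm_on_def linear_on_def abs_mult abs_triangle_ineq)

lemma seminorm_on_SUP:
  assumes V: "subspace V" and I: "I \<noteq> {}" and f: "\<And>i. i \<in> I \<Longrightarrow> linear_on V (f i)"
    and bdd: "\<And>x. x \<in> V \<Longrightarrow> bdd_above ((\<lambda>i. \<bar>f i x\<bar>) ` I)"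
  shows "seminorm_on V (\<lambda>x. SUP i\<in>I. \<bar>f i x :: real\<bar>)"
proof (rule seminorm_onI[OF V])
  have ge: "\<bar>f i x\<bar> \<le> (SUP i\<in>I. \<bar>f i x\<bar>)" if "x \<in> V" "i \<in> I" for x i
    by (rule cSUP_upper[OF that(2) bdd[OF that(1)]])
  have "(\<lambda>i. \<bar>f i 0\<bar>) ` I = {0}" using I linear_on_zero[OF f V] by auto
  then show "(SUP i\<in>I. \<bar>f i 0\<bar>) = 0" by simp
  show "(SUP i\<in>I. \<bar>f i (x + y)\<bar>) \<le> (SUP i\<in>I. \<bar>f i x\<bar>) + (SUP i\<in>I. \<bar>f i y\<bar>)" if "x \<in> V" "y \<in> V" for x y
  proof (rule cSUP_least[OF I])
    fix i assume i: "i \<in> I"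
    show "\<bar>f i (x + y)\<bar> \<le> (SUP i\<in>I. \<bar>f i x\<bar>) + (SUP i\<in>I. \<bar>f i y\<bar>)"
      using linear_onD(1)[OF f[OF i] that] ge[OF that(1) i] ge[OF that(2) i] by simp
  qed
  show "(SUP i\<in>I. \<bar>f i (c *\<^sub>R x)\<bar>) \<le> \<bar>c\<bar> * (SUP i\<in>I. \<bar>f i x\<bar>)" if "x \<in> V" for c x
  proof (rule cSUP_least[OF I])
    fix i assume i: "i \<in> I"
    show "\<bar>f i (c *\<^sub>R x)\<bar> \<le> \<bar>c\<bar> * (SUP i\<in>I. \<bar>f i x\<bar>)"
      using linear_onD(2)[OF f[OF i] that] mult_left_mono[OF ge[OF that i] abs_ge_zero[of c]] by (simp add: abs_mult)
  qed
qed

lemma abs_le_of_le_seminorm: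
  assumes "linear_on V f" "subspace V" "seminorm_on V q" "\<And>x. x \<in> V \<Longrightarrow> f x \<le> q x" "x \<in> V"
  shows "\<bar>f x :: real\<bar> \<le> q x"
  using assms(4)[of x] assms(4)[of "- x"] linear_onD(2)[OF assms(1,5), of "-1"] assms
  by (simp add: abs_le_iff seminorm_on_minus subspace_neg)

text \<open>The functional is given on the source of a map \<open>j\<close> that may have a kernel.
  Domination bounds \<open>f\<close> by \<open>q 0 = 0\<close> on that kernel in both signs, so
  \<open>f\<close> descends to the image of \<open>j\<close>, where Hahn-Banach applies; evenness of
  \<open>q\<close> gives the bound on the absolute value.\<close>

lemma dominated_extension:
  fixes j :: "'p::real_vector \<Rightarrow> 'a::real_vector"
  assumes V: "subspace V" and P: "subspace P" and j: "linear_on P j" "j ` P \<subseteq> V"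
    and q: "seminorm_on V q" and f: "linear_on P f" "\<And>A. A \<in> P \<Longrightarrow> f A \<le> q (j A)"
  shows "\<exists>g. linear_on V g \<and> (\<forall>A\<in>P. g (j A) = f A) \<and> (\<forall>x\<in>V. \<bar>g x :: real\<bar> \<le> q x) \<and> (\<forall>x. x \<notin> V \<longrightarrow> g x = 0)"
proof -
  have W: "subspace (j ` P)"
  proof (rule subspaceI)
    show "0 \<in> j ` P" using linear_on_zero[OF j(1) P] subspace_0[OF P] by (metis image_eqI)
    show "x + y \<in> j ` P" if "x \<in> j ` P" "y \<in> j ` P" for x y
      using that linear_onD(1)[OF j(1)] subspace_add[OF P] by (auto simp: image_iff) metis
    show "c *\<^sub>R x \<in> j ` P" if "x \<in> j ` P" for c x
      using that linear_onD(2)[OF j(1)] subspace_scale[OF P] by (auto simp: image_iff) metis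
  qed
  have eq: "f A = f B" if A: "A \<in> P" and B: "B \<in> P" and "j A = j B" for A B
  proof -
    have "j (A - B) = 0" "j (B - A) = 0"
      using linear_on_diff[OF j(1) P A B] linear_on_diff[OF j(1) P B A] that by auto
    then show ?thesis
      using f(2)[OF subspace_diff[OF P A B]] f(2)[OF subspace_diff[OF P B A]] seminorm_on_zero[OF q V]
        linear_on_diff[OF f(1) P A B] linear_on_diff[OF f(1) P B A] by simp
  qed
  define f' where "f' = (\<lambda>x. f (SOME A. A \<in> P \<and> j A = x))"
  have f': "f' (j A) = f A" if A: "A \<in> P" for A
  proof -
    have "\<exists>B. B \<in> P \<and> j B = j A" using A by blast
    from someI_ex[OF this] show ?thesis unfolding f'_def by (intro eq A) auto
  qed
  have "linear_on (j ` P) f'"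
    unfolding linear_on_def
  proof (intro conjI ballI allI)
    fix x y assume "x \<in> j ` P" "y \<in> j ` P"
    then obtain A B where AB: "x = j A" "y = j B" "A \<in> P" "B \<in> P" by blast
    then have "f' (x + y) = f' (j (A + B))" using linear_onD(1)[OF j(1)] by simp
    also have "\<dots> = f' x + f' y" using AB f' linear_onD(1)[OF f(1)] subspace_add[OF P] by simp
    finally show "f' (x + y) = f' x + f' y" .
  next
    fix c x assume "x \<in> j ` P"
    then obtain A where A: "x = j A" "A \<in> P" by blast
    then have "f' (c *\<^sub>R x) = f' (j (c *\<^sub>R A))" using linear_onD(2)[OF j(1)] by simp
    also have "\<dots> = c *\<^sub>R f' x" using A f' linear_onD(2)[OF f(1)] subspace_scale[OF P] by simp
    finally show "f' (c *\<^sub>R x) = c *\<^sub>R f' x" .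
  qed
  moreover have "f' x \<le> q x" if "x \<in> j ` P" for x using that f f' by auto
  ultimately have "\<exists>g. linear_on V g \<and> (\<forall>x\<in>j ` P. g x = f' x) \<and> (\<forall>x\<in>V. g x \<le> q x) \<and> (\<forall>x. x \<notin> V \<longrightarrow> g x = 0)"
    using q by (intro hahn_banach[OF V W j(2)]) (auto simp: seminorm_on_def)
  then obtain g where g: "linear_on V g" "\<forall>x\<in>j ` P. g x = f' x" "\<forall>x\<in>V. g x \<le> q x" "\<forall>x. x \<notin> V \<longrightarrow> g x = 0"
    by blast
  then have "\<forall>x\<in>V. \<bar>g x\<bar> \<le> q x" using abs_le_of_le_seminorm[OF g(1) V q] by blast
  then show ?thesis using g f' by (intro exI[of _ g]) auto
qed

section \<open>Families of functions with locally bounded derivatives\<close>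

lemma frechet_derivative_cong:
  assumes "open S" "x \<in> S" "\<And>y. y \<in> S \<Longrightarrow> f y = g y"
  shows "frechet_derivative f (at x) = frechet_derivative g (at x)"
proof -
  have "(f has_derivative D) (at x) \<longleftrightarrow> (g has_derivative D) (at x)" for D
    using assms has_derivative_transform_within_open[of f D x UNIV S g]
      has_derivative_transform_within_open[of g D x UNIV S f] by auto
  then show ?thesis unfolding frechet_derivative_def by simp
qed

lemma differentiable_cong_open:
  assumes "open S" "x \<in> S" "\<And>y. y \<in> S \<Longrightarrow> f y = g y"
  shows "f differentiable (at x) \<longleftrightarrow> g differentiable (at x)"
proof -
  have "(f has_derivative D) (at x) \<longleftrightarrow> (g has_derivative D) (at x)" for D
    using assms has_derivative_transform_within_open[of f D x UNIV S g]
      has_derivative_transform_within_open[of g D x UNIV S f] by auto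
  then show ?thesis unfolding differentiable_def by simp
qed

lemma has_derivative_frechet:
  "f differentiable (at x) \<Longrightarrow> (f has_derivative frechet_derivative f (at x)) (at x)"
  using frechet_derivative_works by blast

lemma frechet_derivative_eqI:
  "(f has_derivative f') (at x) \<Longrightarrow> frechet_derivative f (at x) = f'"
  using frechet_derivative_at by metis

text \<open>Where \<open>F w\<close> depends linearly on \<open>w\<close> near \<open>x\<close>, a
  combination of derivatives is a derivative of the combination, and derivatives are unique. This
  makes derivatives of metric coefficients and of tensor components linear in every slot.\<close>

lemma linear_frechet_derivative_parameter:
  assumes S: "open S" "x \<in> S" and lin: "\<And>y. y \<in> S \<Longrightarrow> linear (\<lambda>w. F w y)"
    and F: "\<And>w. F w differentiable (at x)"
  shows "linear (\<lambda>w. frechet_derivative (F w) (at x) v)"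
proof -
  note D = has_derivative_frechet[OF F]
  note E = has_derivative_unique[OF has_derivative_transform_within_open[OF _ S] D]
  show ?thesis
  proof (rule linearI)
    show "frechet_derivative (F (u + w)) (at x) v = frechet_derivative (F u) (at x) v + frechet_derivative (F w) (at x) v" for u w
      using E[OF has_derivative_add[OF D[of u] D[of w]], of "u + w"] linear_add[OF lin] by (simp add: fun_eq_iff)
    show "frechet_derivative (F (a *\<^sub>R w)) (at x) v = a *\<^sub>R frechet_derivative (F w) (at x) v" for a w
      using E[OF has_derivative_scaleR_right[OF D[of w], of a], of "a *\<^sub>R w"] linear_scale[OF lin] by (simp add: fun_eq_iff)
  qed
qed

lemma C_on_cong:
  assumes "open S" "\<And>x. x \<in> S \<Longrightarrow> f x = g x"
  shows "C_on r S f \<longleftrightarrow> C_on r S g"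
  using assms(2)
proof (induction r arbitrary: f g)
  case 0
  then show ?case by (simp cong: continuous_on_cong_simp)
next
  case (Suc r)
  have "C_on r S (\<lambda>x. frechet_derivative f (at x) v) \<longleftrightarrow> C_on r S (\<lambda>x. frechet_derivative g (at x) v)" for v
    by (rule Suc.IH) (simp add: frechet_derivative_cong[OF assms(1) _ Suc.prems])
  then show ?case
    using differentiable_cong_open[OF assms(1) _ Suc.prems] by simp
qed

definition equi_bounded :: "'e::real_normed_vector set \<Rightarrow> 'i set \<Rightarrow> ('i \<Rightarrow> 'e \<Rightarrow> 'b::real_normed_vector) \<Rightarrow> bool"
  where "equi_bounded S I F \<longleftrightarrow> (\<forall>x\<in>S. \<exists>K. \<forall>\<^sub>F y in nhds x. \<forall>i\<in>I. norm (F i y) \<le> K)"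

text \<open>Parallels \<open>C_on\<close>, with one local bound for the whole family at each order.
  Derivatives are taken along fixed directions, which is enough in finite dimension; continuity of
  the top derivative is recovered by spending another order.\<close>

primrec equi_C :: "nat \<Rightarrow> 'e::real_normed_vector set \<Rightarrow> 'i set \<Rightarrow> ('i \<Rightarrow> 'e \<Rightarrow> 'b::real_normed_vector) \<Rightarrow> bool"
  where "equi_C 0 S I F \<longleftrightarrow> equi_bounded S I F"
  | "equi_C (Suc r) S I F \<longleftrightarrow> equi_bounded S I F \<and> (\<forall>i\<in>I. \<forall>x\<in>S. F i differentiable (at x)) \<and>
      (\<forall>v. equi_C r S I (\<lambda>i x. frechet_derivative (F i) (at x) v))"

lemma equi_C_bounded: "equi_C r S I F \<Longrightarrow> equi_bounded S I F"
  by (cases r) simp_all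

lemma equi_boundedI:
  assumes "\<And>x. x \<in> S \<Longrightarrow> \<exists>K. \<forall>\<^sub>F y in nhds x. \<forall>i\<in>I. norm (F i y) \<le> K"
  shows "equi_bounded S I F"
  using assms by (simp add: equi_bounded_def)

lemma equi_boundedE:
  assumes "equi_bounded S I F" "x \<in> S"
  obtains K where "\<forall>\<^sub>F y in nhds x. \<forall>i\<in>I. norm (F i y) \<le> K"
  using assms by (auto simp: equi_bounded_def)

lemma equi_bounded_dominated:
  assumes "equi_bounded S I F" "open S"
    and "\<And>j x. j \<in> J \<Longrightarrow> x \<in> S \<Longrightarrow> \<exists>i\<in>I. norm (G j x) \<le> norm (F i x)"
  shows "equi_bounded S J G"
proof (rule equi_boundedI)
  fix x assume x: "x \<in> S"
  obtain K where K: "\<forall>\<^sub>F y in nhds x. \<forall>i\<in>I. norm (F i y) \<le> K"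
    using equi_boundedE[OF assms(1) x] .
  have "\<forall>\<^sub>F y in nhds x. y \<in> S" using assms(2) x by (rule eventually_nhds_in_open)
  with K have "\<forall>\<^sub>F y in nhds x. \<forall>j\<in>J. norm (G j y) \<le> K"
    by eventually_elim (use assms(3) order_trans in blast)
  then show "\<exists>K. \<forall>\<^sub>F y in nhds x. \<forall>j\<in>J. norm (G j y) \<le> K" by blast
qed

text \<open>The bound on \<open>H\<close> is phrased through bounds on \<open>F\<close> and
  \<open>G\<close>, so that sums and products are covered by one argument.\<close>

lemma equi_bounded_combine:
  assumes F: "equi_bounded S I F" and G: "equi_bounded S I G"
    and H: "\<And>K L. \<exists>M. \<forall>i x. norm (F i x) \<le> K \<longrightarrow> norm (G i x) \<le> L \<longrightarrow> norm (H i x) \<le> M"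
  shows "equi_bounded S I H"
proof (rule equi_boundedI)
  fix x assume x: "x \<in> S"
  obtain K where K: "\<forall>\<^sub>F y in nhds x. \<forall>i\<in>I. norm (F i y) \<le> K"
    using equi_boundedE[OF F x] .
  obtain L where L: "\<forall>\<^sub>F y in nhds x. \<forall>i\<in>I. norm (G i y) \<le> L"
    using equi_boundedE[OF G x] .
  obtain M where M: "\<And>i x. norm (F i x) \<le> K \<Longrightarrow> norm (G i x) \<le> L \<Longrightarrow> norm (H i x) \<le> M"
    using H[of K L] by blast
  have "\<forall>\<^sub>F y in nhds x. \<forall>i\<in>I. norm (H i y) \<le> M"
    using K L by eventually_elim (use M in blast)
  then show "\<exists>K. \<forall>\<^sub>F y in nhds x. \<forall>i\<in>I. norm (H i y) \<le> K" by blast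
qed

lemma equi_C_Suc: "equi_C (Suc r) S I F \<Longrightarrow> equi_C r S I F"
proof (induction r arbitrary: F)
  case (Suc r)
  have "equi_C r S I (\<lambda>i x. frechet_derivative (F i) (at x) v)" for v
    by (rule Suc.IH) (use Suc.prems in simp)
  then show ?case using Suc.prems by simp
qed simp

lemma equi_C_mono: "equi_C r S I F \<Longrightarrow> s \<le> r \<Longrightarrow> equi_C s S I F"
  by (induction r) (auto simp: le_Suc_eq dest: equi_C_Suc simp del: equi_C.simps)

lemma equi_C_cong:
  assumes S: "open S"
  shows "equi_C r S I F \<Longrightarrow> (\<And>i x. i \<in> I \<Longrightarrow> x \<in> S \<Longrightarrow> F i x = G i x) \<Longrightarrow> equi_C r S I G"
proof (induction r arbitrary: F G)
  case 0
  show ?case unfolding equi_C.simps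
    by (rule equi_bounded_dominated[OF _ S, of I F]) (use 0 in auto)
next
  case (Suc r)
  have "equi_bounded S I G"
    by (rule equi_bounded_dominated[OF equi_C_bounded[OF Suc.prems(1)] S]) (use Suc.prems in auto)
  moreover have "equi_C r S I (\<lambda>i x. frechet_derivative (G i) (at x) v)" for v
  proof (rule Suc.IH)
    show "equi_C r S I (\<lambda>i x. frechet_derivative (F i) (at x) v)" using Suc.prems(1) by simp
    show "frechet_derivative (F i) (at x) v = frechet_derivative (G i) (at x) v" if "i \<in> I" "x \<in> S" for i x
      using frechet_derivative_cong[OF S that(2) Suc.prems(2)[OF that(1)]] by simp
  qed
  moreover have "\<forall>i\<in>I. \<forall>x\<in>S. G i differentiable (at x)"
  proof (intro ballI)
    fix i x assume "i \<in> I" "x \<in> S"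
    then show "G i differentiable (at x)"
      using differentiable_cong_open[OF S, of x "F i" "G i"] Suc.prems by simp
  qed
  ultimately show ?case by simp
qed

lemma equi_C_SucI:
  assumes "open S" "equi_bounded S I F"
    and F': "\<And>i x. i \<in> I \<Longrightarrow> x \<in> S \<Longrightarrow> (F i has_derivative F' i x) (at x)"
    and "\<And>v. equi_C r S I (\<lambda>i x. F' i x v)"
  shows "equi_C (Suc r) S I F"
proof -
  have "equi_C r S I (\<lambda>i x. frechet_derivative (F i) (at x) v)" for v
    using equi_C_cong[OF assms(1) assms(4)[of v]] frechet_derivative_eqI[OF F'] by simp
  then show ?thesis using assms(2,3) by (auto simp: differentiable_def)
qed

lemma continuous_imp_equi_bounded:
  assumes "\<And>x. x \<in> S \<Longrightarrow> continuous (at x) f"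
  shows "equi_bounded S I (\<lambda>_. f)"
proof (rule equi_boundedI)
  fix x assume x: "x \<in> S"
  have "(f \<longlongrightarrow> f x) (nhds x)"
    using assms[OF x] by (simp add: continuous_at tendsto_nhds_iff)
  then have "\<forall>\<^sub>F y in nhds x. dist (f y) (f x) < 1"
    by (rule tendstoD) simp
  then have "\<forall>\<^sub>F y in nhds x. \<forall>i\<in>I. norm (f y) \<le> norm (f x) + 1"
  proof eventually_elim
    case (elim y)
    then show ?case using norm_triangle_sub[of "f y" "f x"] by (simp add: dist_norm)
  qed
  then show "\<exists>K. \<forall>\<^sub>F y in nhds x. \<forall>i\<in>I. norm (f y) \<le> K" by blast
qed

text \<open>A single function counts as a constant family over any index set; this is how the metric
  coefficients are combined with varying families.\<close>

lemma C_on_imp_equi_C: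
  "C_on r S f \<Longrightarrow> open S \<Longrightarrow> equi_C r S I (\<lambda>_. f)"
proof (induction r arbitrary: f)
  case 0
  then show ?case by (simp add: continuous_imp_equi_bounded continuous_on_eq_continuous_at)
next
  case (Suc r)
  then have "equi_bounded S I (\<lambda>_. f)"
    by (intro continuous_imp_equi_bounded) (simp add: differentiable_imp_continuous_within)
  then show ?case using Suc by simp
qed

lemma smooth_on_imp_equi_C: "smooth_on S f \<Longrightarrow> open S \<Longrightarrow> equi_C r S I (\<lambda>_. f)"
  by (simp add: smooth_on_def C_on_imp_equi_C)

lemma equi_C_const: "open S \<Longrightarrow> equi_C r S I (\<lambda>_ _. c)"
proof (induction r arbitrary: c)
  case 0
  then show ?case by (simp add: continuous_imp_equi_bounded)
next
  case (Suc r)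
  show ?case
    by (rule equi_C_SucI[where F' = "\<lambda>_ _ _. 0"])
      (use Suc in \<open>auto intro!: continuous_imp_equi_bounded\<close>)
qed

lemma equi_C_add:
  assumes S: "open S"
  shows "equi_C r S I F \<Longrightarrow> equi_C r S I G \<Longrightarrow> equi_C r S I (\<lambda>i x. F i x + G i x)"
proof (induction r arbitrary: F G)
  have base: "equi_bounded S I (\<lambda>i x. F i x + G i x)" if "equi_bounded S I F" "equi_bounded S I G" for F G :: "'b \<Rightarrow> 'a \<Rightarrow> 'c"
    using that by (rule equi_bounded_combine) (meson norm_triangle_mono)
  {
    case 0
    then show ?case using base by simp
  next
    case (Suc r)
    then have "equi_bounded S I (\<lambda>i x. F i x + G i x)"
      by (intro base) (auto intro: equi_C_bounded)
    then show ?case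
      by (rule equi_C_SucI[where F' = "\<lambda>i x v. frechet_derivative (F i) (at x) v + frechet_derivative (G i) (at x) v", OF S])
        (use Suc in \<open>auto intro!: has_derivative_add has_derivative_frechet\<close>)
  }
qed

lemma equi_C_sum:
  assumes "open S"
  shows "(\<And>j. j \<in> J \<Longrightarrow> equi_C r S I (F j)) \<Longrightarrow> equi_C r S I (\<lambda>i x. \<Sum>j\<in>J. F j i x)"
  by (induction J rule: infinite_finite_induct) (simp_all add: assms equi_C_const equi_C_add)

lemma equi_C_bilinear:
  assumes S: "open S" and B: "bounded_bilinear B"
  shows "equi_C r S I F \<Longrightarrow> equi_C r S I G \<Longrightarrow> equi_C r S I (\<lambda>i x. B (F i x) (G i x))"
proof (induction r arbitrary: F G)
  have base: "equi_bounded S I (\<lambda>i x. B (F i x) (G i x))" if "equi_bounded S I F" "equi_bounded S I G" for F G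
  proof -
    obtain C where C: "C > 0" "\<And>a b. norm (B a b) \<le> norm a * norm b * C"
      using bounded_bilinear.pos_bounded[OF B] by blast
    have "norm (B a b) \<le> K * L * C" if "norm a \<le> K" "norm b \<le> L" for a b K L
    proof -
      have "norm a * norm b * C \<le> K * L * C"
        using that C norm_ge_zero[of a] by (intro mult_right_mono mult_mono) (auto intro: order_trans[OF norm_ge_zero])
      with C(2)[of a b] show ?thesis by simp
    qed
    then show ?thesis by (intro equi_bounded_combine[OF that]) blast
  qed
  {
    case 0
    then show ?case using base by simp
  next
    case (Suc r)
    show ?case
    proof (rule equi_C_SucI[OF S])
      show "equi_bounded S I (\<lambda>i x. B (F i x) (G i x))"
        using Suc.prems by (intro base) (auto intro: equi_C_bounded)
      show "((\<lambda>x. B (F i x) (G i x)) has_derivative (\<lambda>v. B (F i x) (frechet_derivative (G i) (at x) v) +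
          B (frechet_derivative (F i) (at x) v) (G i x))) (at x)" if "i \<in> I" "x \<in> S" for i x
        using Suc.prems that by (intro bounded_bilinear.FDERIV[OF B] has_derivative_frechet) auto
      show "equi_C r S I (\<lambda>i x. B (F i x) (frechet_derivative (G i) (at x) v) +
          B (frechet_derivative (F i) (at x) v) (G i x))" for v
        using Suc.prems equi_C_Suc[OF Suc.prems(1)] equi_C_Suc[OF Suc.prems(2)]
        by (intro equi_C_add[OF S] Suc.IH) simp_all
    qed
  }
qed

lemmas equi_C_mult = equi_C_bilinear[OF _ bounded_bilinear_mult]
lemmas equi_C_inner = equi_C_bilinear[OF _ bounded_bilinear_inner]

lemma equi_C_minus:
  fixes F :: "'i \<Rightarrow> 'e::real_normed_vector \<Rightarrow> real"
  assumes S: "open S" and "equi_C r S I F" "equi_C r S I G"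
  shows "equi_C r S I (\<lambda>i x. F i x - G i x)"
  using equi_C_add[OF S assms(2) equi_C_mult[OF S equi_C_const[OF S, of _ _ "-1"] assms(3)]] by simp

section \<open>Differentiation under a bounded functional\<close>

lemma has_derivative_of_quadratic_bound:
  fixes f :: "'a::real_normed_vector \<Rightarrow> 'b::real_normed_vector"
  assumes "bounded_linear D" "0 < \<delta>"
    and bound: "\<And>y. y \<in> ball x \<delta> \<Longrightarrow> norm (f y - f x - D (y - x)) \<le> M * (norm (y - x))\<^sup>2"
  shows "(f has_derivative D) (at x)"
  unfolding has_derivative_iff_norm
proof (intro conjI assms(1))
  show "((\<lambda>y. norm (f y - f x - D (y - x)) / norm (y - x)) \<longlongrightarrow> 0) (at x)"
  proof (rule tendsto_sandwich[where f = "\<lambda>_. 0" and h = "\<lambda>y. M * norm (y - x)"])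
    show "\<forall>\<^sub>F y in at x. norm (f y - f x - D (y - x)) / norm (y - x) \<le> M * norm (y - x)"
      unfolding eventually_at
    proof (intro exI[of _ \<delta>] conjI ballI impI assms(2))
      fix y assume "y \<noteq> x \<and> dist y x < \<delta>"
      then show "norm (f y - f x - D (y - x)) / norm (y - x) \<le> M * norm (y - x)"
        using bound[of y] by (simp add: divide_le_eq power2_eq_square dist_commute mult.assoc)
    qed
    show "((\<lambda>y. M * norm (y - x)) \<longlongrightarrow> 0) (at x)"
      by (auto intro!: tendsto_eq_intros)
  qed simp_all
qed

text \<open>The quadratic error is uniform in the index: local bounds on second derivatives along
  pairs of basis vectors add up to \<open>M\<close>, the mean value inequality bounds the variation
  of the first derivative by \<open>M\<close> times the distance, and a second application bounds
  the remainder.\<close>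

lemma equi_C_Taylor:
  fixes F :: "'i \<Rightarrow> 'e::{real_inner, heine_borel} \<Rightarrow> 'b::real_normed_vector"
  assumes S: "open S" "x \<in> S" and F: "equi_C (Suc (Suc 0)) S I F"
  obtains M \<delta> where "0 < \<delta>"
    "\<And>i y. i \<in> I \<Longrightarrow> y \<in> ball x \<delta> \<Longrightarrow>
      norm (F i y - F i x - frechet_derivative (F i) (at x) (y - x)) \<le> M * (norm (y - x))\<^sup>2"
proof -
  define D where "D = (\<lambda>i y v. frechet_derivative (F i) (at y) v)"
  define DD where "DD = (\<lambda>i b y v. frechet_derivative (\<lambda>z. D i z b) (at y) v)"
  have dF: "(F i has_derivative D i y) (at y)" if "i \<in> I" "y \<in> S" for i y
    unfolding D_def using F that by (auto intro!: has_derivative_frechet)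
  have dD: "((\<lambda>z. D i z b) has_derivative DD i b y) (at y)" if "i \<in> I" "y \<in> S" for i b y
    unfolding DD_def using F that by (auto intro!: has_derivative_frechet simp: D_def)
  have linD: "linear (D i y)" if "i \<in> I" "y \<in> S" for i y
    using dF[OF that] by (rule has_derivative_linear)
  have "\<exists>K. \<forall>\<^sub>F y in nhds x. \<forall>i\<in>I. norm (DD i b y c) \<le> K" for b c
  proof -
    have "equi_bounded S I (\<lambda>i y. DD i b y c)"
      using F unfolding DD_def D_def by auto
    then show ?thesis using S(2) by (auto elim: equi_boundedE)
  qed
  then have "\<forall>\<^sub>F y in nhds x. \<forall>i\<in>I. norm (DD i b y c) \<le> (SOME K. \<forall>\<^sub>F y in nhds x. \<forall>i\<in>I. norm (DD i b y c) \<le> K)" for b c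
    by (rule someI_ex)
  then obtain K where "\<And>b c. \<forall>\<^sub>F y in nhds x. \<forall>i\<in>I. norm (DD i b y c) \<le> K b c"
    by (rule that)
  then have "\<forall>\<^sub>F y in nhds x. \<forall>b\<in>onb. \<forall>c\<in>onb. \<forall>i\<in>I. norm (DD i b y c) \<le> K b c"
    by (intro eventually_ball_finite[OF finite_onb] ballI)
  moreover have "\<forall>\<^sub>F y in nhds x. y \<in> S" using S by (intro eventually_nhds_in_open)
  ultimately have "\<forall>\<^sub>F y in nhds x. y \<in> S \<and> (\<forall>b\<in>onb. \<forall>c\<in>onb. \<forall>i\<in>I. norm (DD i b y c) \<le> K b c)"
    by eventually_elim simp
  then obtain \<delta> where \<delta>: "\<delta> > 0" "\<And>y. y \<in> ball x \<delta> \<Longrightarrow> y \<in> S"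
      "\<And>i b c y. y \<in> ball x \<delta> \<Longrightarrow> b \<in> onb \<Longrightarrow> c \<in> onb \<Longrightarrow> i \<in> I \<Longrightarrow> norm (DD i b y c) \<le> K b c"
    unfolding eventually_nhds_metric by (auto simp: dist_commute)
  define M where "M = (\<Sum>b\<in>onb. \<Sum>c\<in>onb. K b c)"
  \<comment> \<open>Without an index nothing fixes the sign of the chosen bounds, hence the premise
    \<open>i \<in> I\<close>.\<close>
  have K0: "0 \<le> K b c" if "i \<in> I" "b \<in> onb" "c \<in> onb" for i b c
    using \<delta>(3)[of x b c i] \<delta>(1) that by (auto intro: order_trans[OF norm_ge_zero])
  have M0: "0 \<le> M" if "i \<in> I" for i
    unfolding M_def using K0[OF that] by (intro sum_nonneg)
  have 1: "norm (D i y b - D i x b) \<le> (\<Sum>c\<in>onb. K b c) * norm (y - x)"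
    if i: "i \<in> I" and y: "y \<in> ball x \<delta>" and b: "b \<in> onb" for i y b
  proof (rule differentiable_bound[of "ball x \<delta>"])
    show "((\<lambda>z. D i z b) has_derivative DD i b z) (at z within ball x \<delta>)" if "z \<in> ball x \<delta>" for z
      using dD[OF i \<delta>(2)[OF that]] by (rule has_derivative_at_withinI)
    show "onorm (DD i b z) \<le> (\<Sum>c\<in>onb. K b c)" if z: "z \<in> ball x \<delta>" for z
    proof (rule onorm_bound)
      show "0 \<le> (\<Sum>c\<in>onb. K b c)" using K0[OF i b] by (intro sum_nonneg)
      fix u
      have "norm (DD i b z u) \<le> (\<Sum>c\<in>onb. norm (DD i b z c)) * norm u"
        using has_derivative_linear[OF dD[OF i \<delta>(2)[OF z]]] by (rule norm_linear_onb_le)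
      also have "\<dots> \<le> (\<Sum>c\<in>onb. K b c) * norm u"
        using \<delta>(3) i z b by (intro mult_right_mono sum_mono) auto
      finally show "norm (DD i b z u) \<le> (\<Sum>c\<in>onb. K b c) * norm u" .
    qed
  qed (use \<delta> y in auto)
  have 2: "norm (D i y u - D i x u) \<le> M * norm (y - x) * norm u"
    if i: "i \<in> I" and y: "y \<in> ball x \<delta>" for i y u
  proof -
    have "linear (\<lambda>u. D i y u - D i x u)"
      using linD[OF i \<delta>(2)[OF y]] linD[OF i S(2)] by (rule linear_compose_sub)
    then have "norm (D i y u - D i x u) \<le> (\<Sum>b\<in>onb. norm (D i y b - D i x b)) * norm u"
      by (rule norm_linear_onb_le)
    also have "\<dots> \<le> (\<Sum>b\<in>onb. (\<Sum>c\<in>onb. K b c) * norm (y - x)) * norm u"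
      using 1[OF i y] by (intro mult_right_mono sum_mono) auto
    finally show ?thesis by (simp add: M_def sum_distrib_right)
  qed
  show ?thesis
  proof (rule that[OF \<delta>(1)])
    fix i y assume i: "i \<in> I" and y: "y \<in> ball x \<delta>"
    have sub: "z \<in> ball x \<delta>" if "z \<in> cball x (dist x y)" for z using that y by simp
    \<comment> \<open>On the closed ball through \<open>y\<close> the derivative varies by at most
      \<open>M * norm (y - x)\<close>, which supplies the second factor of the square.\<close>
    have "norm (F i y - F i x - D i x (y - x)) \<le> norm (y - x) * (M * norm (y - x))"
    proof (rule differentiable_bound_linearization[of x y "cball x (dist x y)" "F i" "D i"])
      show "x + t *\<^sub>R (y - x) \<in> cball x (dist x y)" if "t \<in> {0..1}" for t
        using that by (simp add: dist_norm norm_minus_commute mult_left_le_one_le)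
      show "(F i has_derivative D i z) (at z within cball x (dist x y))" if "z \<in> cball x (dist x y)" for z
        using dF[OF i \<delta>(2)[OF sub[OF that]]] by (rule has_derivative_at_withinI)
      show "onorm (D i z - D i x) \<le> M * norm (y - x)" if z: "z \<in> cball x (dist x y)" for z
        unfolding fun_diff_def
      proof (rule onorm_bound)
        show "0 \<le> M * norm (y - x)" using M0[OF i] by simp
        fix u
        have "M * norm (z - x) \<le> M * norm (y - x)"
          using z M0[OF i] by (intro mult_left_mono) (auto simp: dist_norm norm_minus_commute)
        then show "norm (D i z u - D i x u) \<le> M * norm (y - x) * norm u"
          using 2[OF i sub[OF z], of u] by (meson mult_right_mono norm_ge_zero order_trans)
      qed
    qed simp
    then show "norm (F i y - F i x - frechet_derivative (F i) (at x) (y - x)) \<le> M * (norm (y - x))\<^sup>2"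
      by (simp add: D_def power2_eq_square mult.commute mult.left_commute)
  qed
qed

definition bounded_fun :: "'i set \<Rightarrow> ('i \<Rightarrow> real) \<Rightarrow> bool"
  where "bounded_fun I \<phi> \<longleftrightarrow> (\<exists>B. \<forall>i\<in>I. \<bar>\<phi> i\<bar> \<le> B)"

lemma bounded_fun_add: "bounded_fun I \<phi> \<Longrightarrow> bounded_fun I \<psi> \<Longrightarrow> bounded_fun I (\<lambda>i. \<phi> i + \<psi> i)"
  unfolding bounded_fun_def by (meson abs_triangle_ineq add_mono order_trans)

lemma bounded_fun_scale: "bounded_fun I \<phi> \<Longrightarrow> bounded_fun I (\<lambda>i. c * \<phi> i)"
  unfolding bounded_fun_def by (metis abs_mult abs_ge_zero mult_left_mono)

lemma bounded_fun_const: "bounded_fun I (\<lambda>_. c)"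
  unfolding bounded_fun_def by blast

lemma bounded_fun_sum: "(\<And>j. j \<in> J \<Longrightarrow> bounded_fun I (\<phi> j)) \<Longrightarrow> bounded_fun I (\<lambda>i. \<Sum>j\<in>J. \<phi> j i)"
  by (induction J rule: infinite_finite_induct) (simp_all add: bounded_fun_add bounded_fun_const)

lemma equi_bounded_imp_bounded_fun:
  "equi_bounded S I F \<Longrightarrow> x \<in> S \<Longrightarrow> bounded_fun I (\<lambda>i. F i x)"
  unfolding bounded_fun_def by (metis (no_types, lifting) equi_boundedE eventually_nhds_x_imp_x real_norm_def)

text \<open>Behaves like integration against a finitely additive signed measure on \<open>I\<close>
  of total variation at most 1. Such a mean respects uniform limits, but in general not pointwise
  ones.\<close>

locale mean_functional =
  fixes I :: "'i set" and \<Lambda> :: "('i \<Rightarrow> real) \<Rightarrow> real"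
  assumes add: "bounded_fun I \<phi> \<Longrightarrow> bounded_fun I \<psi> \<Longrightarrow> \<Lambda> (\<lambda>i. \<phi> i + \<psi> i) = \<Lambda> \<phi> + \<Lambda> \<psi>"
    and scale: "bounded_fun I \<phi> \<Longrightarrow> \<Lambda> (\<lambda>i. c * \<phi> i) = c * \<Lambda> \<phi>"
    and bound: "0 \<le> B \<Longrightarrow> (\<And>i. i \<in> I \<Longrightarrow> \<bar>\<phi> i\<bar> \<le> B) \<Longrightarrow> \<bar>\<Lambda> \<phi>\<bar> \<le> B"
begin

lemma zero: "\<Lambda> (\<lambda>_. 0) = 0"
  using scale[of "\<lambda>_. 0" 0] by (simp add: bounded_fun_const)

lemma diff: "bounded_fun I \<phi> \<Longrightarrow> bounded_fun I \<psi> \<Longrightarrow> \<Lambda> (\<lambda>i. \<phi> i - \<psi> i) = \<Lambda> \<phi> - \<Lambda> \<psi>"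
  using add[of \<phi> "\<lambda>i. (-1) * \<psi> i"] scale[of \<psi> "-1"] bounded_fun_scale[of I \<psi> "-1"] by simp

text \<open>Applying \<open>bound\<close> with \<open>B = 0\<close> to the difference shows that
  values off \<open>I\<close> do not matter.\<close>

lemma cong: "bounded_fun I \<phi> \<Longrightarrow> (\<And>i. i \<in> I \<Longrightarrow> \<phi> i = \<psi> i) \<Longrightarrow> \<Lambda> \<phi> = \<Lambda> \<psi>"
  using diff[of \<phi> \<psi>] bound[of 0 "\<lambda>i. \<phi> i - \<psi> i"] by (auto simp: bounded_fun_def)

lemma sum: "(\<And>j. j \<in> J \<Longrightarrow> bounded_fun I (\<phi> j)) \<Longrightarrow> \<Lambda> (\<lambda>i. \<Sum>j\<in>J. \<phi> j i) = (\<Sum>j\<in>J. \<Lambda> (\<phi> j))"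
  by (induction J rule: infinite_finite_induct) (simp_all add: zero add bounded_fun_sum)

text \<open>Since \<open>\<Lambda>\<close> has norm at most 1, it turns the uniform quadratic Taylor
  bound of the family into the same bound for the mean. This is where two orders of
  \<open>equi_C\<close> are required for one derivative.\<close>

lemma has_derivative:
  fixes F :: "'i \<Rightarrow> 'e::{real_inner, heine_borel} \<Rightarrow> real"
  assumes S: "open S" "x \<in> S" and F: "equi_C (Suc (Suc 0)) S I F"
  shows "((\<lambda>y. \<Lambda> (\<lambda>i. F i y)) has_derivative (\<lambda>v. \<Lambda> (\<lambda>i. frechet_derivative (F i) (at x) v))) (at x)"
proof -
  obtain M \<delta> where M: "0 < \<delta>"
    "\<And>i y. i \<in> I \<Longrightarrow> y \<in> ball x \<delta> \<Longrightarrow>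
      norm (F i y - F i x - frechet_derivative (F i) (at x) (y - x)) \<le> M * (norm (y - x))\<^sup>2"
    using equi_C_Taylor[OF S F] by metis
  obtain e where e: "e > 0" "ball x e \<subseteq> S" using S openE by blast
  have bF: "bounded_fun I (\<lambda>i. F i y)" if "y \<in> S" for y
    using equi_bounded_imp_bounded_fun[OF equi_C_bounded[OF F] that] .
  have bD: "bounded_fun I (\<lambda>i. frechet_derivative (F i) (at x) v)" for v
    using equi_bounded_imp_bounded_fun[of S I "\<lambda>i x. frechet_derivative (F i) (at x) v" x] F S by simp
  have lin: "linear (frechet_derivative (F i) (at x))" if "i \<in> I" for i
    using F that S by (auto intro!: linear_frechet_derivative)
  have "linear (\<lambda>v. \<Lambda> (\<lambda>i. frechet_derivative (F i) (at x) v))"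
  proof (rule linearI)
    fix v w c
    have "\<Lambda> (\<lambda>i. frechet_derivative (F i) (at x) (v + w)) =
      \<Lambda> (\<lambda>i. frechet_derivative (F i) (at x) v + frechet_derivative (F i) (at x) w)"
      using lin bD by (intro cong) (auto simp: linear_add)
    then show "\<Lambda> (\<lambda>i. frechet_derivative (F i) (at x) (v + w)) =
      \<Lambda> (\<lambda>i. frechet_derivative (F i) (at x) v) + \<Lambda> (\<lambda>i. frechet_derivative (F i) (at x) w)"
      using bD by (simp add: add)
    have "\<Lambda> (\<lambda>i. frechet_derivative (F i) (at x) (c *\<^sub>R v)) = \<Lambda> (\<lambda>i. c * frechet_derivative (F i) (at x) v)"
      using lin bD by (intro cong) (auto simp: linear_scale)
    then show "\<Lambda> (\<lambda>i. frechet_derivative (F i) (at x) (c *\<^sub>R v)) = c *\<^sub>R \<Lambda> (\<lambda>i. frechet_derivative (F i) (at x) v)"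
      using bD by (simp add: scale)
  qed
  then have "bounded_linear (\<lambda>v. \<Lambda> (\<lambda>i. frechet_derivative (F i) (at x) v))"
    by (rule linear_imp_bounded_linear_onb)
  then show ?thesis
  proof (rule has_derivative_of_quadratic_bound)
    show "0 < min \<delta> e" using M e by simp
    fix y assume y: "y \<in> ball x (min \<delta> e)"
    then have yS: "y \<in> S" using e by auto
    have "\<Lambda> (\<lambda>i. F i y) - \<Lambda> (\<lambda>i. F i x) - \<Lambda> (\<lambda>i. frechet_derivative (F i) (at x) (y - x)) =
      \<Lambda> (\<lambda>i. F i y - F i x - frechet_derivative (F i) (at x) (y - x))"
      using bF[OF yS] bF[OF S(2)] bD[of "y - x"] bounded_fun_add[OF bF[OF yS] bounded_fun_scale[OF bF[OF S(2)], of "-1"]]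
      by (simp add: diff)
    \<comment> \<open>\<open>bound\<close> asks for a nonnegative bound, while the sign of
      \<open>M\<close> is unknown; hence the maximum with 0.\<close>
    moreover have "\<bar>\<Lambda> (\<lambda>i. F i y - F i x - frechet_derivative (F i) (at x) (y - x))\<bar> \<le> max 0 (M * (norm (y - x))\<^sup>2)"
      using M(2)[of _ y] y by (intro bound) (auto simp: le_max_iff_disj)
    ultimately show "norm (\<Lambda> (\<lambda>i. F i y) - \<Lambda> (\<lambda>i. F i x) - \<Lambda> (\<lambda>i. frechet_derivative (F i) (at x) (y - x)))
      \<le> max 0 M * (norm (y - x))\<^sup>2"
      by (simp add: max_mult_distrib_right)
  qed
qed

text \<open>The mean of derivatives is the derivative of the mean; at the last order continuity
  comes from differentiability, which accounts for the two additional orders.\<close>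

lemma C_on:
  fixes F :: "'i \<Rightarrow> 'e::{real_inner, heine_borel} \<Rightarrow> real"
  assumes S: "open S"
  shows "equi_C (Suc (Suc r)) S I F \<Longrightarrow> C_on r S (\<lambda>y. \<Lambda> (\<lambda>i. F i y))"
proof (induction r arbitrary: F)
  case 0
  show ?case
    using has_derivative_continuous[OF has_derivative[OF S _ 0]]
    by (auto intro!: continuous_at_imp_continuous_on)
next
  case (Suc r)
  have F2: "equi_C (Suc (Suc 0)) S I F"
    using Suc.prems by (rule equi_C_mono) simp
  have "C_on r S (\<lambda>x. \<Lambda> (\<lambda>i. frechet_derivative (F i) (at x) v))" for v
    by (rule Suc.IH) (use Suc.prems in simp)
  moreover have "C_on r S (\<lambda>x. frechet_derivative (\<lambda>y. \<Lambda> (\<lambda>i. F i y)) (at x) v) \<longleftrightarrow>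
      C_on r S (\<lambda>x. \<Lambda> (\<lambda>i. frechet_derivative (F i) (at x) v))" for v
    by (rule C_on_cong[OF S]) (simp add: frechet_derivative_eqI[OF has_derivative[OF S _ F2]])
  moreover have "(\<lambda>y. \<Lambda> (\<lambda>i. F i y)) differentiable at x" if "x \<in> S" for x
    using has_derivative[OF S that F2] by (auto simp: differentiable_def)
  ultimately show ?case by simp
qed

end

section \<open>Symmetry of second derivatives\<close>

text \<open>The second difference is symmetric in \<open>v\<close> and \<open>w\<close>, so its
  limit identifies both mixed derivatives. The mean value theorem along \<open>v\<close> uses
  \<open>f\<close> near \<open>x\<close>, but the derivative along \<open>v\<close> has to be
  differentiable at \<open>x\<close> only.\<close>

lemma second_difference_quotient:
  fixes f :: "'a::real_normed_vector \<Rightarrow> real"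
  assumes S: "open S" "x \<in> S" and f: "\<And>y. y \<in> S \<Longrightarrow> f differentiable (at y)"
    and G: "((\<lambda>y. frechet_derivative f (at y) v) has_derivative G) (at x)"
  shows "((\<lambda>t. (f (x + t *\<^sub>R v + t *\<^sub>R w) - f (x + t *\<^sub>R v) - f (x + t *\<^sub>R w) + f x) / t\<^sup>2) \<longlongrightarrow> G w) (at_right 0)"
proof (rule tendstoI)
  fix e :: real assume e: "0 < e"
  define g where "g = (\<lambda>y. frechet_derivative f (at y) v)"
  \<comment> \<open>After division by \<open>t\<close>, the two increments estimated below add up to
    at most \<open>m\<close>; the summand 1 keeps it positive when both vectors vanish.\<close>
  define m where "m = 2 * norm v + norm w + 1"
  have m: "m > 0" by (simp add: m_def add_nonneg_pos)
  obtain \<delta>1 where \<delta>1: "\<delta>1 > 0" "\<And>h. norm h < \<delta>1 \<Longrightarrow> norm (g (x + h) - g x - G h) \<le> e / (2 * m) * norm h"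
  proof -
    have "e / (2 * m) > 0" using e m by simp
    then obtain d where "d > 0" "\<And>y. norm (y - x) < d \<Longrightarrow> norm (g y - g x - G (y - x)) \<le> e / (2 * m) * norm (y - x)"
      using G unfolding has_derivative_at_alt g_def by blast
    then show ?thesis using that[of d] by (metis add_diff_cancel_left')
  qed
  obtain \<delta>2 where \<delta>2: "\<delta>2 > 0" "ball x \<delta>2 \<subseteq> S" using S openE by blast
  have inS: "x + h \<in> S" if "norm h < \<delta>2" for h
    using that \<delta>2(2) by (auto simp: dist_norm)
  define \<delta> where "\<delta> = min \<delta>1 \<delta>2 / m"
  have \<delta>: "\<delta> > 0" using \<delta>1 \<delta>2 m by (simp add: \<delta>_def)
  have linG: "linear G" using G by (rule has_derivative_linear)
  have "dist ((f (x + t *\<^sub>R v + t *\<^sub>R w) - f (x + t *\<^sub>R v) - f (x + t *\<^sub>R w) + f x) / t\<^sup>2) (G w) < e"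
    if t: "0 < t" "t < \<delta>" for t
  proof -
    have small: "norm (s *\<^sub>R v + r *\<^sub>R w) < min \<delta>1 \<delta>2" if "0 \<le> s" "s \<le> t" "0 \<le> r" "r \<le> t" for s r
    proof -
      have "norm (s *\<^sub>R v + r *\<^sub>R w) \<le> t * norm v + t * norm w"
        using that by (intro norm_triangle_mono) (auto intro: mult_right_mono)
      also have "\<dots> \<le> t * m" using t by (simp add: m_def algebra_simps)
      also have "\<dots> < min \<delta>1 \<delta>2" using t m by (simp add: \<delta>_def field_simps)
      finally show ?thesis .
    qed
    \<comment> \<open>The second difference equals \<open>h t - h 0\<close>, so one mean value point
      \<open>\<xi>\<close> reduces it to a difference of first derivatives along
      \<open>v\<close>.\<close>
    define h where "h = (\<lambda>s. f (x + s *\<^sub>R v + t *\<^sub>R w) - f (x + s *\<^sub>R v))"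
    have dh: "(h has_derivative (\<lambda>u. u * (g (x + s *\<^sub>R v + t *\<^sub>R w) - g (x + s *\<^sub>R v)))) (at s)"
      if s: "0 \<le> s" "s \<le> t" for s
    proof -
      have in_S: "x + s *\<^sub>R v + t *\<^sub>R w \<in> S" "x + s *\<^sub>R v \<in> S"
        using small[of s t] small[of s 0] s t inS[of "s *\<^sub>R v + t *\<^sub>R w"] inS[of "s *\<^sub>R v"]
        by (simp_all add: add.assoc)
      have c: "((\<lambda>s. f (x + s *\<^sub>R v + a)) has_derivative (\<lambda>u. u * g (x + s *\<^sub>R v + a))) (at s)"
        if "x + s *\<^sub>R v + a \<in> S" for a
      proof -
        have d: "(f has_derivative frechet_derivative f (at (x + s *\<^sub>R v + a))) (at (x + s *\<^sub>R v + a))"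
          using f[OF that] by (rule has_derivative_frechet)
        have "((\<lambda>s. x + s *\<^sub>R v + a) has_derivative (\<lambda>u. u *\<^sub>R v)) (at s)"
          by (auto intro!: derivative_eq_intros)
        from has_derivative_compose[OF this d] have "((\<lambda>s. f (x + s *\<^sub>R v + a)) has_derivative
            (\<lambda>u. frechet_derivative f (at (x + s *\<^sub>R v + a)) (u *\<^sub>R v))) (at s)" .
        then show ?thesis
          using linear_frechet_derivative[OF f[OF that]] by (simp add: g_def linear_scale)
      qed
      show ?thesis
        unfolding h_def using has_derivative_diff[OF c[of "t *\<^sub>R w"] c[of 0]] in_S
        by (simp add: right_diff_distrib)
    qed
    obtain \<xi> where \<xi>: "0 < \<xi>" "\<xi> < t"
      "h t - h 0 = (t - 0) * (g (x + \<xi> *\<^sub>R v + t *\<^sub>R w) - g (x + \<xi> *\<^sub>R v))"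
      using mvt_simple[OF t(1), of h "\<lambda>s u. u * (g (x + s *\<^sub>R v + t *\<^sub>R w) - g (x + s *\<^sub>R v))"]
        has_derivative_at_withinI[OF dh] by (auto simp: greaterThanLessThan_iff)
    define q where "q = g (x + \<xi> *\<^sub>R v + t *\<^sub>R w) - g (x + \<xi> *\<^sub>R v)"
    have 1: "norm (g (x + (\<xi> *\<^sub>R v + t *\<^sub>R w)) - g x - G (\<xi> *\<^sub>R v + t *\<^sub>R w)) \<le> e / (2 * m) * norm (\<xi> *\<^sub>R v + t *\<^sub>R w)"
      using small[of \<xi> t] \<xi> t by (intro \<delta>1) auto
    have 2: "norm (g (x + \<xi> *\<^sub>R v) - g x - G (\<xi> *\<^sub>R v)) \<le> e / (2 * m) * norm (\<xi> *\<^sub>R v)"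
      using small[of \<xi> 0] \<xi> t by (intro \<delta>1) auto
    have "G (t *\<^sub>R w) = G (\<xi> *\<^sub>R v + t *\<^sub>R w) - G (\<xi> *\<^sub>R v)"
      using linG by (simp add: linear_add)
    then have "\<bar>q - G (t *\<^sub>R w)\<bar> \<le> e / (2 * m) * norm (\<xi> *\<^sub>R v + t *\<^sub>R w) + e / (2 * m) * norm (\<xi> *\<^sub>R v)"
      using 1 2 by (simp add: q_def add.assoc)
    also have "\<dots> = e / (2 * m) * (norm (\<xi> *\<^sub>R v + t *\<^sub>R w) + norm (\<xi> *\<^sub>R v))"
      by (simp add: distrib_left)
    also have "\<dots> \<le> e / (2 * m) * (t * m)"
    proof (rule mult_left_mono)
      have "norm (\<xi> *\<^sub>R v + t *\<^sub>R w) \<le> t * norm v + t * norm w"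
        using \<xi> t by (intro norm_triangle_mono) (auto intro: mult_right_mono)
      moreover have "norm (\<xi> *\<^sub>R v) \<le> t * norm v" using \<xi> t by (auto intro: mult_right_mono)
      ultimately have "norm (\<xi> *\<^sub>R v + t *\<^sub>R w) + norm (\<xi> *\<^sub>R v) \<le> t * (2 * norm v + norm w)"
        by (simp add: algebra_simps)
      also have "\<dots> \<le> t * m" using t by (simp add: m_def)
      finally show "norm (\<xi> *\<^sub>R v + t *\<^sub>R w) + norm (\<xi> *\<^sub>R v) \<le> t * m" .
    qed (use e m in simp)
    also have "\<dots> = t * (e / 2)" using m by simp
    finally have "\<bar>q - t * G w\<bar> \<le> t * (e / 2)" using linG by (simp add: linear_scale)
    then have "\<bar>q / t - G w\<bar> \<le> e / 2"
      using t by (simp add: field_simps abs_le_iff)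
    moreover have "f (x + t *\<^sub>R v + t *\<^sub>R w) - f (x + t *\<^sub>R v) - f (x + t *\<^sub>R w) + f x = t * q"
      using \<xi>(3) by (simp add: h_def q_def)
    then have "(f (x + t *\<^sub>R v + t *\<^sub>R w) - f (x + t *\<^sub>R v) - f (x + t *\<^sub>R w) + f x) / t\<^sup>2 = q / t"
      using t by (simp add: power2_eq_square)
    ultimately show ?thesis using e by (simp add: dist_real_def)
  qed
  then show "\<forall>\<^sub>F t in at_right 0. dist ((f (x + t *\<^sub>R v + t *\<^sub>R w) - f (x + t *\<^sub>R v) - f (x + t *\<^sub>R w) + f x) / t\<^sup>2) (G w) < e"
    using \<delta> by (auto simp: eventually_at_right_field)
qed

text \<open>Pairing with a fixed vector \<open>a\<close> reduces to real values; then both orders of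
  differentiation are limits of the same second difference.\<close>

lemma second_derivative_symmetric:
  fixes f :: "'a::real_normed_vector \<Rightarrow> 'b::real_inner"
  assumes S: "open S" "x \<in> S" and f: "C_on (Suc (Suc 0)) S f"
  shows "frechet_derivative (\<lambda>y. frechet_derivative f (at y) v) (at x) w =
    frechet_derivative (\<lambda>y. frechet_derivative f (at y) w) (at x) v"
proof -
  define D where "D = (\<lambda>u. frechet_derivative (\<lambda>y. frechet_derivative f (at y) u) (at x))"
  have "inner (D v w) a = inner (D w v) a" for a
  proof -
    have df: "((\<lambda>y. inner (f y) a) has_derivative (\<lambda>u. inner (frechet_derivative f (at y) u) a)) (at y)" if "y \<in> S" for y
      using f that by (intro has_derivative_inner_left has_derivative_frechet) auto
    have dfe: "frechet_derivative (\<lambda>y. inner (f y) a) (at y) = (\<lambda>u. inner (frechet_derivative f (at y) u) a)" if "y \<in> S" for y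
      using frechet_derivative_eqI[OF df[OF that]] .
    have d2: "((\<lambda>y. frechet_derivative (\<lambda>y. inner (f y) a) (at y) u) has_derivative (\<lambda>z. inner (D u z) a)) (at x)" for u
    proof (rule has_derivative_transform_within_open[OF _ S])
      show "((\<lambda>y. inner (frechet_derivative f (at y) u) a) has_derivative (\<lambda>z. inner (D u z) a)) (at x)"
        unfolding D_def using f S by (intro has_derivative_inner_left has_derivative_frechet) auto
    qed (simp add: dfe)
    have dif: "(\<lambda>y. inner (f y) a) differentiable at y" if "y \<in> S" for y
      using df[OF that] by (auto simp: differentiable_def)
    note second_difference_quotient[OF S dif d2[of v], of w]
    moreover have "((\<lambda>t. (inner (f (x + t *\<^sub>R v + t *\<^sub>R w)) a - inner (f (x + t *\<^sub>R v)) a - inner (f (x + t *\<^sub>R w)) a + inner (f x) a) / t\<^sup>2)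
        \<longlongrightarrow> inner (D w v) a) (at_right 0)"
      using second_difference_quotient[OF S dif d2[of w], of v]
      by (simp add: add.assoc add.commute[of "_ *\<^sub>R w" "_ *\<^sub>R v"] algebra_simps)
    ultimately show ?thesis
      by (intro tendsto_unique[of "at_right (0::real)"]) auto
  qed
  then show ?thesis unfolding D_def using vector_eq_rdot by blast
qed

section \<open>Multilinear functions of lists\<close>

definition multilinear :: "nat \<Rightarrow> ('e::real_vector list \<Rightarrow> real) \<Rightarrow> bool"
  where "multilinear m \<tau> \<longleftrightarrow> (\<forall>vs i. length vs = m \<and> i < m \<longrightarrow> linear (\<lambda>v. \<tau> (vs[i := v])))"

lemma multilinearD: "multilinear m \<tau> \<Longrightarrow> length vs = m \<Longrightarrow> i < m \<Longrightarrow> linear (\<lambda>v. \<tau> (vs[i := v]))"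
  by (simp add: multilinear_def)

lemma multilinear_0 [simp]: "multilinear 0 \<tau>"
  by (simp add: multilinear_def)

lemma multilinear_Suc:
  "multilinear (Suc m) \<tau> \<longleftrightarrow> (\<forall>v. multilinear m (\<lambda>ws. \<tau> (v # ws))) \<and> (\<forall>ws. length ws = m \<longrightarrow> linear (\<lambda>v. \<tau> (v # ws)))"
proof (intro iffI conjI allI impI)
  fix v assume *: "multilinear (Suc m) \<tau>"
  show "multilinear m (\<lambda>ws. \<tau> (v # ws))"
    unfolding multilinear_def using multilinearD[OF *, of "v # _" "Suc _"] by simp
next
  fix ws :: "'a list" assume *: "multilinear (Suc m) \<tau>" "length ws = m"
  then show "linear (\<lambda>v. \<tau> (v # ws))"
    using multilinearD[OF *(1), of "0 # ws" 0] by simp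
next
  assume *: "(\<forall>v. multilinear m (\<lambda>ws. \<tau> (v # ws))) \<and> (\<forall>ws. length ws = m \<longrightarrow> linear (\<lambda>v. \<tau> (v # ws)))"
  show "multilinear (Suc m) \<tau>"
    unfolding multilinear_def
  proof (intro allI impI)
    fix vs :: "'a list" and i assume l: "length vs = Suc m \<and> i < Suc m"
    then obtain w ws where vs: "vs = w # ws" "length ws = m" by (cases vs) auto
    show "linear (\<lambda>v. \<tau> (vs[i := v]))"
      using * vs l by (cases i) (auto simp: multilinear_def)
  qed
qed

lemma multilinear_compose:
  assumes "multilinear m \<tau>" "linear A"
  shows "multilinear m (\<lambda>vs. \<tau> (map A vs))"
  unfolding multilinear_def
proof (intro allI impI)
  fix vs :: "'b list" and i assume "length vs = m \<and> i < m"
  then have "linear ((\<lambda>v. \<tau> ((map A vs)[i := v])) \<circ> A)"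
    using assms by (intro linear_compose multilinearD) auto
  then show "linear (\<lambda>v. \<tau> (map A (vs[i := v])))"
    by (simp add: comp_def map_update)
qed

lemma multilinear_scale_all:
  "multilinear m \<tau> \<Longrightarrow> length vs = m \<Longrightarrow> \<tau> (map (\<lambda>v. s *\<^sub>R v) vs) = s ^ m * \<tau> vs"
proof (induction m arbitrary: \<tau> vs)
  case (Suc m)
  then obtain w ws where vs: "vs = w # ws" "length ws = m" by (cases vs) auto
  have "\<tau> (map (\<lambda>v. s *\<^sub>R v) vs) = s * \<tau> (w # map (\<lambda>v. s *\<^sub>R v) ws)"
    using Suc.prems(1) vs linear_scale[of "\<lambda>v. \<tau> (v # map (\<lambda>v. s *\<^sub>R v) ws)" s w] by (simp add: multilinear_Suc)
  also have "\<tau> (w # map (\<lambda>v. s *\<^sub>R v) ws) = s ^ m * \<tau> (w # ws)"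
    using Suc.IH[of "\<lambda>ws. \<tau> (w # ws)" ws] Suc.prems vs by (simp add: multilinear_Suc)
  finally show ?case using vs by simp
qed simp

lemma multilinear_bounded:
  fixes \<tau> :: "'e::{real_inner, heine_borel} list \<Rightarrow> real"
  shows "multilinear m \<tau> \<Longrightarrow> \<exists>K. \<forall>vs. length vs = m \<longrightarrow> (\<forall>v\<in>set vs. norm v \<le> R) \<longrightarrow> \<bar>\<tau> vs\<bar> \<le> K"
proof (induction m arbitrary: \<tau>)
  case 0
  then show ?case by auto
next
  case (Suc m)
  have "\<forall>b. \<exists>K. \<forall>vs. length vs = m \<longrightarrow> (\<forall>v\<in>set vs. norm v \<le> R) \<longrightarrow> \<bar>\<tau> (b # vs)\<bar> \<le> K"
    using Suc by (auto simp: multilinear_Suc)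
  then obtain K where K: "\<And>b vs. length vs = m \<Longrightarrow> (\<forall>v\<in>set vs. norm v \<le> R) \<Longrightarrow> \<bar>\<tau> (b # vs)\<bar> \<le> K b"
    by (auto dest!: choice)
  have "\<bar>\<tau> vs\<bar> \<le> (\<Sum>b\<in>onb. K b) * R" if "length vs = Suc m" "\<forall>v\<in>set vs. norm v \<le> R" for vs
  proof -
    obtain w ws where vs: "vs = w # ws" "length ws = m" using \<open>length vs = Suc m\<close> by (cases vs) auto
    have "linear (\<lambda>v. \<tau> (v # ws))" using Suc.prems vs by (simp add: multilinear_Suc)
    then have "\<bar>\<tau> vs\<bar> \<le> (\<Sum>b\<in>onb. \<bar>\<tau> (b # ws)\<bar>) * norm w"
      using norm_linear_onb_le[of "\<lambda>v. \<tau> (v # ws)" w] vs by simp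
    also have "\<dots> \<le> (\<Sum>b\<in>onb. K b) * R"
      using K[of ws] that vs
      by (intro mult_mono sum_mono sum_nonneg order_trans[OF abs_ge_zero K[of ws]]) auto
    finally show ?thesis .
  qed
  then show ?case by blast
qed

text \<open>Expanding the first moving argument in \<open>onb\<close> replaces it by real
  coefficients in front of fields with one argument less, so the ordinary product rule and induction
  apply. Thus derivatives of \<open>G\<close> enter at fixed argument lists only.\<close>

lemma has_derivative_multilinear:
  fixes G :: "'e::{real_inner, heine_borel} \<Rightarrow> 'e list \<Rightarrow> real"
  assumes S: "open S" "x \<in> S"
  shows "(\<And>y. y \<in> S \<Longrightarrow> multilinear m (G y)) \<Longrightarrow>
    (\<And>us. length us = m \<Longrightarrow> ((\<lambda>y. G y us) has_derivative G' us) (at x)) \<Longrightarrow>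
    length Us = m \<Longrightarrow> length Us' = m \<Longrightarrow>
    (\<And>i. i < m \<Longrightarrow> ((Us ! i) has_derivative (Us' ! i)) (at x)) \<Longrightarrow>
    ((\<lambda>y. G y (map (\<lambda>U. U y) Us)) has_derivative
      (\<lambda>h. G' (map (\<lambda>U. U x) Us) h + (\<Sum>i<m. G x ((map (\<lambda>U. U x) Us)[i := (Us' ! i) h])))) (at x)"
proof (induction m arbitrary: G G' Us Us')
  case 0
  then show ?case by simp
next
  case (Suc m)
  obtain U Vs where Us: "Us = U # Vs" "length Vs = m" using Suc.prems(3) by (cases Us) auto
  obtain U' Vs' where Us': "Us' = U' # Vs'" "length Vs' = m" using Suc.prems(4) by (cases Us') auto
  have dU: "(U has_derivative U') (at x)" using Suc.prems(5)[of 0] Us Us' by simp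
  have dV: "((Vs ! i) has_derivative (Vs' ! i)) (at x)" if "i < m" for i
    using Suc.prems(5)[of "Suc i"] that Us Us' by simp
  have lin: "linear (\<lambda>v. G y (v # ws))" if "y \<in> S" "length ws = m" for y ws
    using Suc.prems(1)[OF that(1)] that(2) by (simp add: multilinear_Suc)
  define ev where "ev = (\<lambda>y. map (\<lambda>U. U y) Vs)"
  have ev_eq: "map (\<lambda>U. U y) Vs = ev y" for y by (simp add: ev_def)
  have len: "length (ev y) = m" for y by (simp add: ev_def Us)
  have IH: "((\<lambda>y. G y (b # ev y)) has_derivative
      (\<lambda>h. G' (b # ev x) h + (\<Sum>i<m. G x (b # (ev x)[i := (Vs' ! i) h])))) (at x)" for b
    unfolding ev_def
    by (rule Suc.IH[of "\<lambda>y ws. G y (b # ws)" "\<lambda>ws. G' (b # ws)"])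
      (use Suc.prems(1,2) Us Us' dV in \<open>auto simp: multilinear_Suc\<close>)
  \<comment> \<open>\<open>G'\<close> is known only as the derivative for each fixed list; its
    linearity in the first entry follows from that of \<open>G\<close> by uniqueness of
    derivatives.\<close>
  have G'lin: "G' (u # ws) h = (\<Sum>b\<in>onb. inner u b * G' (b # ws) h)" if "length ws = m" for u ws h
  proof -
    have "((\<lambda>y. \<Sum>b\<in>onb. inner u b * G y (b # ws)) has_derivative (\<lambda>h. \<Sum>b\<in>onb. inner u b * G' (b # ws) h)) (at x)"
      using Suc.prems(2) that by (intro has_derivative_sum has_derivative_mult_right) auto
    then have "((\<lambda>y. G y (u # ws)) has_derivative (\<lambda>h. \<Sum>b\<in>onb. inner u b * G' (b # ws) h)) (at x)"
      by (rule has_derivative_transform_within_open[OF _ S])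
        (use linear_onb_expansion[OF lin[OF _ that], of _ u] in simp)
    moreover have "((\<lambda>y. G y (u # ws)) has_derivative G' (u # ws)) (at x)"
      using Suc.prems(2) that by simp
    ultimately have "G' (u # ws) = (\<lambda>h. \<Sum>b\<in>onb. inner u b * G' (b # ws) h)"
      using has_derivative_unique by blast
    then show ?thesis by simp
  qed
  have expand: "G x (u # ws) = (\<Sum>b\<in>onb. inner u b * G x (b # ws))" if "length ws = m" for u ws
    using linear_onb_expansion[OF lin[OF S(2) that], of u] by simp
  have "((\<lambda>y. \<Sum>b\<in>onb. inner (U y) b * G y (b # ev y)) has_derivative
      (\<lambda>h. \<Sum>b\<in>onb. inner (U x) b * (G' (b # ev x) h + (\<Sum>i<m. G x (b # (ev x)[i := (Vs' ! i) h])))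
        + inner (U' h) b * G x (b # ev x))) (at x)"
    using dU IH by (intro has_derivative_sum has_derivative_mult has_derivative_inner_left)
  then have "((\<lambda>y. G y (map (\<lambda>U. U y) Us)) has_derivative
      (\<lambda>h. \<Sum>b\<in>onb. inner (U x) b * (G' (b # ev x) h + (\<Sum>i<m. G x (b # (ev x)[i := (Vs' ! i) h])))
        + inner (U' h) b * G x (b # ev x))) (at x)"
  proof (rule has_derivative_transform_within_open[OF _ S])
    fix y assume "y \<in> S"
    then show "(\<Sum>b\<in>onb. inner (U y) b * G y (b # ev y)) = G y (map (\<lambda>U. U y) Us)"
      using linear_onb_expansion[OF lin[OF _ len], of y "U y"] by (simp add: Us ev_def)
  qed
  moreover have "(\<Sum>b\<in>onb. inner (U x) b * (G' (b # ev x) h + (\<Sum>i<m. G x (b # (ev x)[i := (Vs' ! i) h])))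
        + inner (U' h) b * G x (b # ev x)) =
      G' (map (\<lambda>U. U x) Us) h + (\<Sum>i<Suc m. G x ((map (\<lambda>U. U x) Us)[i := (Us' ! i) h]))" for h
  proof -
    have "(\<Sum>i<m. G x (U x # (ev x)[i := (Vs' ! i) h])) =
        (\<Sum>b\<in>onb. inner (U x) b * (\<Sum>i<m. G x (b # (ev x)[i := (Vs' ! i) h])))"
      unfolding sum_distrib_left by (subst sum.swap) (simp add: expand len)
    moreover have "(\<Sum>i<Suc m. G x ((map (\<lambda>U. U x) Us)[i := (Us' ! i) h])) =
        G x (U' h # ev x) + (\<Sum>i<m. G x (U x # (ev x)[i := (Vs' ! i) h]))"
      by (simp add: sum.lessThan_Suc_shift Us Us' ev_def del: sum.lessThan_Suc)
    ultimately show ?thesis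
      using G'lin[OF len, of "U x" x h] expand[OF len, of "U' h" x]
      by (simp add: Us ev_eq sum.distrib distrib_left del: sum.lessThan_Suc)
  qed
  ultimately show ?case by simp
qed

text \<open>The map from \<open>z\<close> to the coefficients of \<open>g z\<close> on
  \<open>onb\<close> is linear, and injective because they determine \<open>g z z\<close>; in finite
  dimension it is then onto. This justifies the \<open>THE\<close> in the definition of the
  connection.\<close>

lemma Riesz_representation_bilinear:
  fixes g :: "'e::{real_inner, heine_borel} \<Rightarrow> 'e \<Rightarrow> real"
  assumes g: "bilinear g" "\<And>v. v \<noteq> 0 \<Longrightarrow> 0 < g v v" and l: "linear l"
  shows "\<exists>!z. \<forall>y. g z y = l y"
proof -
  have uniq: "z = z'" if "\<forall>y. g z y = l y" "\<forall>y. g z' y = l y" for z z'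
  proof (rule ccontr)
    assume "z \<noteq> z'"
    then have "0 < g (z - z') (z - z')" by (intro g) simp
    moreover have "g (z - z') (z - z') = 0" using g(1) that by (simp add: bilinear_lsub)
    ultimately show False by simp
  qed
  define A where "A = (\<lambda>z. \<Sum>b\<in>onb. g z b *\<^sub>R b)"
  have coord: "inner (\<Sum>c\<in>onb. f c *\<^sub>R c) b = f b" if "b \<in> onb" for f and b :: 'e
  proof -
    have "inner (\<Sum>c\<in>onb. f c *\<^sub>R c) b = (\<Sum>c\<in>onb. f c * inner c b)" by (simp add: inner_sum_left)
    also have "\<dots> = (\<Sum>c\<in>onb. if c = b then f b else 0)"
      using that by (intro sum.cong refl) (simp add: dot_square_norm orthogonal_onb)
    finally show ?thesis using that by simp
  qed
  have linA: "linear A"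
    unfolding A_def using g(1)
    by (intro linear_compose_sum ballI linearI) (simp_all add: bilinear_ladd bilinear_lmul scaleR_add_left)
  have ext: "g z y = l y" if "linear l" "\<And>b. b \<in> onb \<Longrightarrow> g z b = l b" for z y l
    using linear_onb_expansion[of "g z" y] linear_onb_expansion[OF that(1), of y] g(1) that(2)
    by (simp add: bilinear_def)
  have "inj A"
    unfolding linear_injective_0[OF linA]
  proof (intro allI impI)
    fix z assume "A z = 0"
    then have "g z b = 0" if "b \<in> onb" for b using coord[OF that, of "g z"] by (simp add: A_def)
    then have "g z z = 0" using ext[of "\<lambda>_. 0" z z] by (simp add: linear_zero)
    then show "z = 0" using g(2)[of z] by force
  qed
  then have "surj A" by (rule linear_inj_imp_surj_onb[OF linA])
  then obtain z where z: "A z = (\<Sum>b\<in>onb. l b *\<^sub>R b)" by (metis surjD)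
  have "g z b = l b" if "b \<in> onb" for b
    using coord[OF that, of "g z"] coord[OF that, of l] z by (simp add: A_def)
  then have "\<forall>y. g z y = l y" using ext[OF l] by blast
  then show ?thesis using uniq by blast
qed

section \<open>Charts and the Levi-Civita connection\<close>

definition transition :: "('m, 'e) chart \<Rightarrow> ('m, 'e) chart \<Rightarrow> 'e \<Rightarrow> 'e"
  where "transition c d = snd d \<circ> chart_inv c"

definition transition_deriv :: "('m, 'e::real_normed_vector) chart \<Rightarrow> ('m, 'e) chart \<Rightarrow> 'e \<Rightarrow> 'e \<Rightarrow> 'e"
  where "transition_deriv c d x = frechet_derivative (transition c d) (at x)"

definition transition_deriv2 :: "('m, 'e::real_normed_vector) chart \<Rightarrow> ('m, 'e) chart \<Rightarrow> 'e \<Rightarrow> 'e \<Rightarrow> 'e \<Rightarrow> 'e"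
  where "transition_deriv2 c d x v w = frechet_derivative (\<lambda>y. transition_deriv c d y w) (at x) v"

definition metric_deriv :: "('m, 'e::real_normed_vector) rmanifold \<Rightarrow> ('m, 'e) chart \<Rightarrow> 'e \<Rightarrow> 'e \<Rightarrow> 'e \<Rightarrow> 'e \<Rightarrow> real"
  where "metric_deriv M c x a b d = frechet_derivative (\<lambda>y. metric_in_chart M c y b d) (at x) a"

text \<open>Right-hand side of the Koszul formula for coordinate fields with constant components,
  whose brackets vanish.\<close>

definition koszul :: "('m, 'e::real_normed_vector) rmanifold \<Rightarrow> ('m, 'e) chart \<Rightarrow> 'e \<Rightarrow> 'e \<Rightarrow> 'e \<Rightarrow> 'e \<Rightarrow> real"
  where "koszul M c x v w y = metric_deriv M c x v w y + metric_deriv M c x w v y - metric_deriv M c x y v w"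

text \<open>The same connection as \<open>christoffel\<close>, but in a prescribed chart on its
  whole range, where it can be differentiated; \<open>christoffel\<close> refers to the chart chosen
  at the point.\<close>

definition christoffel_in_chart :: "('m, 'e::real_normed_vector) rmanifold \<Rightarrow> ('m, 'e) chart \<Rightarrow> 'e \<Rightarrow> 'e \<Rightarrow> 'e \<Rightarrow> 'e"
  where "christoffel_in_chart M c x v w = (THE z. \<forall>y. 2 * metric_in_chart M c x z y = koszul M c x v w y)"

locale riemannian =
  fixes M :: "('m::topological_space, 'e::{real_inner, heine_borel}) rmanifold"
  assumes riemannian_manifold: "riemannian_manifold M"
begin

lemma smooth_atlas: "smooth_atlas (charts M)"
  using riemannian_manifold by (simp add: riemannian_manifold_def)

lemma chart_at: "chart_at M p \<in> charts M" "p \<in> fst (chart_at M p)"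
proof -
  have "p \<in> (\<Union>c\<in>charts M. fst c)" using smooth_atlas by (auto simp: smooth_atlas_def)
  then have "\<exists>c. c \<in> charts M \<and> p \<in> fst c" by blast
  from someI_ex[OF this] show "chart_at M p \<in> charts M" "p \<in> fst (chart_at M p)"
    by (simp_all add: chart_at_def)
qed

lemma chart_homeomorphism:
  "c \<in> charts M \<Longrightarrow> homeomorphism (fst c) (snd c ` fst c) (snd c) (chart_inv c)"
  using smooth_atlas by (simp add: smooth_atlas_def)

lemma chart_inv_left [simp]: "c \<in> charts M \<Longrightarrow> p \<in> fst c \<Longrightarrow> chart_inv c (snd c p) = p"
  using homeomorphism_apply1[OF chart_homeomorphism] .

lemma chart_inv_right [simp]: "c \<in> charts M \<Longrightarrow> x \<in> snd c ` fst c \<Longrightarrow> snd c (chart_inv c x) = x"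
  using homeomorphism_apply2[OF chart_homeomorphism] .

lemma mem_chart_image:
  "c \<in> charts M \<Longrightarrow> x \<in> snd c ` (fst c \<inter> U) \<longleftrightarrow> x \<in> snd c ` fst c \<and> chart_inv c x \<in> U"
  by (auto simp: image_iff)

lemma open_chart_image:
  assumes "c \<in> charts M" "open U"
  shows "open (snd c ` (fst c \<inter> U))"
proof -
  have "open (fst c)" "open (snd c ` fst c)"
    using smooth_atlas assms by (auto simp: smooth_atlas_def)
  moreover have "openin (top_of_set (fst c)) (fst c \<inter> U)"
    using assms(2) by (simp add: openin_open_Int)
  then have "openin (top_of_set (snd c ` fst c)) (snd c ` (fst c \<inter> U))"
    by (rule homeomorphism_imp_open_map[OF chart_homeomorphism[OF assms(1)]])
  ultimately show ?thesis by (simp add: openin_open_trans)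
qed

lemma open_chart_domain: "c \<in> charts M \<Longrightarrow> open (fst c)"
  using smooth_atlas by (simp add: smooth_atlas_def)

lemma open_overlap: "c \<in> charts M \<Longrightarrow> d \<in> charts M \<Longrightarrow> open (snd c ` (fst c \<inter> fst d))"
  using open_chart_image open_chart_domain by blast

lemma C_on_transition:
  "c \<in> charts M \<Longrightarrow> d \<in> charts M \<Longrightarrow> C_on r (snd c ` (fst c \<inter> fst d)) (transition c d)"
  using smooth_atlas by (simp add: smooth_atlas_def smooth_on_def transition_def)

lemma has_derivative_transition:
  assumes "c \<in> charts M" "d \<in> charts M" "x \<in> snd c ` (fst c \<inter> fst d)"
  shows "(transition c d has_derivative transition_deriv c d x) (at x)"
  unfolding transition_deriv_def
  using C_on_transition[OF assms(1,2), of 1] assms(3) by (intro has_derivative_frechet) auto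

lemma has_derivative_transition_deriv:
  assumes "c \<in> charts M" "d \<in> charts M" "x \<in> snd c ` (fst c \<inter> fst d)"
  shows "((\<lambda>y. transition_deriv c d y w) has_derivative (\<lambda>v. transition_deriv2 c d x v w)) (at x)"
  unfolding transition_deriv_def transition_deriv2_def
  using C_on_transition[OF assms(1,2), of "Suc (Suc 0)"] assms(3) by (intro has_derivative_frechet) auto

lemma linear_transition_deriv:
  assumes "c \<in> charts M" "d \<in> charts M" "x \<in> snd c ` (fst c \<inter> fst d)"
  shows "linear (transition_deriv c d x)"
  using has_derivative_transition[OF assms] by (rule has_derivative_linear)

lemma transition_deriv2_commute:
  assumes "c \<in> charts M" "d \<in> charts M" "x \<in> snd c ` (fst c \<inter> fst d)"
  shows "transition_deriv2 c d x v w = transition_deriv2 c d x w v"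
  unfolding transition_deriv_def transition_deriv2_def
  using second_derivative_symmetric[OF open_overlap[OF assms(1,2)] assms(3) C_on_transition[OF assms(1,2)]] .

lemma transition_mem:
  assumes "c \<in> charts M" "d \<in> charts M" "x \<in> snd c ` (fst c \<inter> fst d)"
  shows "transition c d x \<in> snd d ` (fst d \<inter> fst c)" "chart_inv d (transition c d x) = chart_inv c x"
    "transition d c (transition c d x) = x"
  using assms by (auto simp: transition_def)

lemma transition_deriv_compose:
  assumes c: "c \<in> charts M" and d: "d \<in> charts M" and e: "e \<in> charts M"
    and x: "x \<in> snd c ` (fst c \<inter> fst d)" "chart_inv c x \<in> fst e"
  shows "transition_deriv c e x v = transition_deriv d e (transition c d x) (transition_deriv c d x v)"
proof -
  let ?S = "snd c ` (fst c \<inter> (fst d \<inter> fst e))"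
  have S: "open ?S" by (intro open_chart_image open_Int open_chart_domain c d e)
  have xS: "x \<in> ?S" using x c by auto
  have x1: "x \<in> snd c ` (fst c \<inter> fst e)" "transition c d x \<in> snd d ` (fst d \<inter> fst e)"
    using x c by (auto simp: transition_def)
  have "((\<lambda>y. transition d e (transition c d y)) has_derivative
      (\<lambda>v. transition_deriv d e (transition c d x) (transition_deriv c d x v))) (at x)"
    using has_derivative_compose[OF has_derivative_transition[OF c d x(1)] has_derivative_transition[OF d e x1(2)]] .
  then have "(transition c e has_derivative
      (\<lambda>v. transition_deriv d e (transition c d x) (transition_deriv c d x v))) (at x)"
    by (rule has_derivative_transform_within_open[OF _ S xS]) (use c d in \<open>auto simp: transition_def\<close>)
  from has_derivative_unique[OF this has_derivative_transition[OF c e x1(1)]] show ?thesis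
    by (simp add: fun_eq_iff)
qed

lemma transition_deriv_self:
  assumes c: "c \<in> charts M" and x: "x \<in> snd c ` fst c"
  shows "transition_deriv c c x v = v"
proof -
  have S: "open (snd c ` fst c)" using open_chart_image[OF c, of UNIV] by simp
  have "((\<lambda>y. y) has_derivative (\<lambda>v. v)) (at x)" by simp
  then have "(transition c c has_derivative (\<lambda>v. v)) (at x)"
    by (rule has_derivative_transform_within_open[OF _ S x]) (use c in \<open>auto simp: transition_def\<close>)
  from has_derivative_unique[OF this has_derivative_transition[OF c c]] x show ?thesis
    by (simp add: fun_eq_iff)
qed

section \<open>Tangent vectors and tensors in charts\<close>

lemma to_tangent_eq: "to_tangent M c x = transition_deriv c (chart_at M (chart_inv c x)) x"
  by (simp add: to_tangent_def transition_deriv_def transition_def)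

lemma to_tangent_transition:
  assumes "c \<in> charts M" "d \<in> charts M" "x \<in> snd c ` (fst c \<inter> fst d)"
  shows "to_tangent M c x v = to_tangent M d (transition c d x) (transition_deriv c d x v)"
  unfolding to_tangent_eq transition_mem(2)[OF assms]
  by (rule transition_deriv_compose[OF assms(1,2) chart_at(1) assms(3) chart_at(2)])

lemma to_tangent_chart_at: "to_tangent M (chart_at M p) (snd (chart_at M p) p) v = v"
  unfolding to_tangent_eq using chart_at by (simp add: transition_deriv_self)

lemma linear_to_tangent:
  assumes "c \<in> charts M" "x \<in> snd c ` fst c"
  shows "linear (to_tangent M c x)"
  unfolding to_tangent_eq
  using assms chart_at by (intro linear_transition_deriv) (auto simp: mem_chart_image)

lemma transition_deriv_inverse:
  assumes "c \<in> charts M" "d \<in> charts M" "x \<in> snd c ` (fst c \<inter> fst d)"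
  shows "transition_deriv d c (transition c d x) (transition_deriv c d x v) = v"
    "transition_deriv c d x (transition_deriv d c (transition c d x) v) = v"
proof -
  show "transition_deriv d c (transition c d x) (transition_deriv c d x v) = v"
    using transition_deriv_compose[OF assms(1,2,1,3), of v] assms transition_deriv_self[of c x v] by auto
  have y: "transition c d x \<in> snd d ` (fst d \<inter> fst c)" using transition_mem(1)[OF assms] .
  show "transition_deriv c d x (transition_deriv d c (transition c d x) v) = v"
    using transition_deriv_compose[OF assms(2,1,2) y, of v] transition_mem[OF assms] assms y
      transition_deriv_self[OF assms(2), of "transition c d x" v] by auto
qed

lemma to_tangent_inj:
  assumes "c \<in> charts M" "x \<in> snd c ` fst c" "to_tangent M c x v = 0"
  shows "v = 0"
proof -
  let ?d = "chart_at M (chart_inv c x)"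
  have x: "x \<in> snd c ` (fst c \<inter> fst ?d)" using assms chart_at by (auto simp: mem_chart_image)
  have "v = transition_deriv ?d c (transition c ?d x) 0"
    using transition_deriv_inverse(1)[OF assms(1) chart_at(1) x, of v] assms(3) by (simp add: to_tangent_eq)
  also have "\<dots> = 0"
    using linear_transition_deriv[OF chart_at(1) assms(1) transition_mem(1)[OF assms(1) chart_at(1) x]] by (rule linear_0)
  finally show ?thesis .
qed

lemma tensor_in_chart_transition:
  assumes "c \<in> charts M" "d \<in> charts M" "x \<in> snd c ` (fst c \<inter> fst d)"
  shows "tensor_in_chart M c T x ws = tensor_in_chart M d T (transition c d x) (map (transition_deriv c d x) ws)"
proof -
  have "to_tangent M c x = to_tangent M d (transition c d x) \<circ> transition_deriv c d x"
    using to_tangent_transition[OF assms] by (simp add: fun_eq_iff)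
  then show ?thesis unfolding tensor_in_chart_def using transition_mem(2)[OF assms] by simp
qed

lemma tensor_in_chart_chart_at:
  "tensor_in_chart M (chart_at M p) T (snd (chart_at M p) p) ws = T p ws"
proof -
  have "map (to_tangent M (chart_at M p) (snd (chart_at M p) p)) ws = ws"
    by (simp add: to_tangent_chart_at map_idI)
  then show ?thesis unfolding tensor_in_chart_def using chart_at by simp
qed

lemma multilinear_tensor_in_chart:
  assumes "c \<in> charts M" "x \<in> snd c ` (fst c \<inter> U)" "\<And>p. p \<in> U \<Longrightarrow> multilinear m (T p)"
  shows "multilinear m (tensor_in_chart M c T x)"
  unfolding tensor_in_chart_def
  using assms by (intro multilinear_compose linear_to_tangent) (auto simp: mem_chart_image)

text \<open>Components in chart \<open>c\<close> are components in chart \<open>d\<close> at the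
  moved point, with arguments transported by the derivative of the transition map. Differentiating
  those arguments produces the sum with \<open>transition_deriv2\<close>, the part that is not
  tensorial.\<close>

lemma has_derivative_tensor_transition:
  assumes U: "open U" and c: "c \<in> charts M" and d: "d \<in> charts M"
    and x: "x \<in> snd c ` (fst c \<inter> fst d)" "chart_inv c x \<in> U"
    and T: "\<And>p. p \<in> U \<Longrightarrow> multilinear m (T p)"
    and dT: "\<And>us. length us = m \<Longrightarrow> (\<lambda>y. tensor_in_chart M d T y us) differentiable (at (transition c d x))"
    and ws: "length ws = m"
  shows "((\<lambda>y. tensor_in_chart M c T y ws) has_derivative
    (\<lambda>h. frechet_derivative (\<lambda>y. tensor_in_chart M d T y (map (transition_deriv c d x) ws)) (at (transition c d x)) (transition_deriv c d x h)
      + (\<Sum>i<m. tensor_in_chart M d T (transition c d x) ((map (transition_deriv c d x) ws)[i := transition_deriv2 c d x h (ws ! i)])))) (at x)"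
proof -
  let ?S = "snd c ` (fst c \<inter> (fst d \<inter> U))"
  have S: "open ?S" by (intro open_chart_image open_Int open_chart_domain c d U)
  have xS: "x \<in> ?S" using x c by auto
  define Us where "Us = map (\<lambda>w y. transition_deriv c d y w) ws"
  define Us' where "Us' = map (\<lambda>w h. transition_deriv2 c d x h w) ws"
  define G' where "G' = (\<lambda>us h. frechet_derivative (\<lambda>y. tensor_in_chart M d T y us) (at (transition c d x)) (transition_deriv c d x h))"
  have ev: "map (\<lambda>U. U y) Us = map (transition_deriv c d y) ws" for y by (simp add: Us_def comp_def)
  have "((\<lambda>y. tensor_in_chart M d T (transition c d y) (map (\<lambda>U. U y) Us)) has_derivative
      (\<lambda>h. G' (map (\<lambda>U. U x) Us) h + (\<Sum>i<m. tensor_in_chart M d T (transition c d x) ((map (\<lambda>U. U x) Us)[i := (Us' ! i) h])))) (at x)"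
  proof (rule has_derivative_multilinear[OF S xS])
    show "multilinear m (tensor_in_chart M d T (transition c d y))" if "y \<in> ?S" for y
      using that c d by (intro multilinear_tensor_in_chart[OF d _ T]) (auto simp: transition_def)
    show "((\<lambda>y. tensor_in_chart M d T (transition c d y) us) has_derivative G' us) (at x)" if "length us = m" for us
      unfolding G'_def
      using has_derivative_compose[OF has_derivative_transition[OF c d x(1)] has_derivative_frechet[OF dT[OF that]]] .
    show "((Us ! i) has_derivative (Us' ! i)) (at x)" if "i < m" for i
      using has_derivative_transition_deriv[OF c d x(1)] that ws by (simp add: Us_def Us'_def)
  qed (simp_all add: Us_def Us'_def ws)
  then have "((\<lambda>y. tensor_in_chart M c T y ws) has_derivative
      (\<lambda>h. G' (map (\<lambda>U. U x) Us) h + (\<Sum>i<m. tensor_in_chart M d T (transition c d x) ((map (\<lambda>U. U x) Us)[i := (Us' ! i) h])))) (at x)"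
  proof (rule has_derivative_transform_within_open[OF _ S xS])
    fix y assume "y \<in> ?S"
    then have "y \<in> snd c ` (fst c \<inter> fst d)" by auto
    from tensor_in_chart_transition[OF c d this]
    show "tensor_in_chart M d T (transition c d y) (map (\<lambda>U. U y) Us) = tensor_in_chart M c T y ws"
      by (simp add: ev)
  qed
  then show ?thesis
    by (rule has_derivative_eq_rhs) (simp add: ev G'_def Us'_def ws)
qed

section \<open>The metric and its Christoffel symbols in a chart\<close>

lemma rmetric: "bilinear (rmetric M p)" "rmetric M p v w = rmetric M p w v" "v \<noteq> 0 \<Longrightarrow> 0 < rmetric M p v v"
  using riemannian_manifold by (auto simp: riemannian_manifold_def)

lemma bilinear_metric_in_chart:
  assumes "c \<in> charts M" "x \<in> snd c ` fst c"
  shows "bilinear (metric_in_chart M c x)"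
  using linear_compose[OF linear_to_tangent[OF assms]] rmetric(1)[of "chart_inv c x"]
  unfolding bilinear_def metric_in_chart_def comp_def by blast

lemma metric_in_chart_pos:
  assumes "c \<in> charts M" "x \<in> snd c ` fst c" "v \<noteq> 0"
  shows "0 < metric_in_chart M c x v v"
  using rmetric(3) to_tangent_inj[OF assms(1,2)] assms(3) by (auto simp: metric_in_chart_def)

lemma metric_in_chart_commute: "metric_in_chart M c x v w = metric_in_chart M c x w v"
  by (simp add: metric_in_chart_def rmetric(2))

lemma metric_in_chart_chart_at:
  "metric_in_chart M (chart_at M p) (snd (chart_at M p) p) v w = rmetric M p v w"
  unfolding metric_in_chart_def using chart_at to_tangent_chart_at by simp

lemma metric_in_chart_transition:
  assumes "c \<in> charts M" "d \<in> charts M" "x \<in> snd c ` (fst c \<inter> fst d)"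
  shows "metric_in_chart M c x v w = metric_in_chart M d (transition c d x) (transition_deriv c d x v) (transition_deriv c d x w)"
  unfolding metric_in_chart_def using transition_mem(2)[OF assms] to_tangent_transition[OF assms] by simp

lemma smooth_metric_in_chart:
  "c \<in> charts M \<Longrightarrow> smooth_on (snd c ` fst c) (\<lambda>x. metric_in_chart M c x v w)"
  using riemannian_manifold by (simp add: riemannian_manifold_def)

lemma differentiable_metric_in_chart:
  "c \<in> charts M \<Longrightarrow> x \<in> snd c ` fst c \<Longrightarrow> (\<lambda>x. metric_in_chart M c x v w) differentiable (at x)"
  using smooth_metric_in_chart[of c v w] unfolding smooth_on_def by (metis C_on.simps(2))

lemma has_derivative_metric_in_chart:
  "c \<in> charts M \<Longrightarrow> x \<in> snd c ` fst c \<Longrightarrow>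
    ((\<lambda>x. metric_in_chart M c x v w) has_derivative (\<lambda>a. metric_deriv M c x a v w)) (at x)"
  unfolding metric_deriv_def using has_derivative_frechet[OF differentiable_metric_in_chart] .

lemma open_chart_range: "c \<in> charts M \<Longrightarrow> open (snd c ` fst c)"
  using open_chart_image[of c UNIV] by simp

lemma linear_metric_deriv:
  assumes c: "c \<in> charts M" and x: "x \<in> snd c ` fst c"
  shows "linear (\<lambda>a. metric_deriv M c x a v w)" "linear (\<lambda>v. metric_deriv M c x a v w)" "linear (\<lambda>w. metric_deriv M c x a v w)"
proof -
  note S = open_chart_range[OF c]
  note D = differentiable_metric_in_chart[OF c x]
  show "linear (\<lambda>a. metric_deriv M c x a v w)"
    using has_derivative_metric_in_chart[OF c x] by (rule has_derivative_linear)
  show "linear (\<lambda>v. metric_deriv M c x a v w)" "linear (\<lambda>w. metric_deriv M c x a v w)"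
    unfolding metric_deriv_def
    by (rule linear_frechet_derivative_parameter[OF S x _ D];
      use bilinear_metric_in_chart[OF c] in \<open>simp add: bilinear_def\<close>)+
qed

lemma linear_koszul:
  assumes c: "c \<in> charts M" and x: "x \<in> snd c ` fst c"
  shows "linear (\<lambda>v. koszul M c x v w y)" "linear (\<lambda>w. koszul M c x v w y)" "linear (\<lambda>y. koszul M c x v w y)"
proof -
  note L = linear_metric_deriv[OF assms]
  show "linear (\<lambda>v. koszul M c x v w y)" unfolding koszul_def
    by (intro linear_compose_sub linear_compose_add L)
  show "linear (\<lambda>w. koszul M c x v w y)" unfolding koszul_def
    by (intro linear_compose_sub linear_compose_add L)
  show "linear (\<lambda>y. koszul M c x v w y)" unfolding koszul_def
    by (intro linear_compose_sub linear_compose_add L)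
qed

lemma christoffel_in_chart_unique:
  assumes c: "c \<in> charts M" and x: "x \<in> snd c ` fst c"
  shows "(\<forall>y. 2 * metric_in_chart M c x z y = koszul M c x v w y) \<longleftrightarrow> z = christoffel_in_chart M c x v w"
proof -
  have "bilinear (\<lambda>z y. 2 * metric_in_chart M c x z y)"
    using bilinear_metric_in_chart[OF assms] unfolding bilinear_def
    by (auto simp: linear_iff distrib_left)
  then have ex: "\<exists>!z. \<forall>y. 2 * metric_in_chart M c x z y = koszul M c x v w y"
    using metric_in_chart_pos[OF assms] linear_koszul(3)[OF assms]
    by (intro Riesz_representation_bilinear) auto
  show ?thesis unfolding christoffel_in_chart_def using ex theI'[OF ex] by auto
qed

lemma christoffel_in_chart:
  assumes c: "c \<in> charts M" and x: "x \<in> snd c ` fst c"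
  shows "2 * metric_in_chart M c x (christoffel_in_chart M c x v w) y = koszul M c x v w y"
  using christoffel_in_chart_unique[OF assms, of "christoffel_in_chart M c x v w" v w] by simp

lemma linear_christoffel_in_chart:
  assumes c: "c \<in> charts M" and x: "x \<in> snd c ` fst c"
  shows "linear (\<lambda>v. christoffel_in_chart M c x v w)" "linear (\<lambda>w. christoffel_in_chart M c x v w)"
proof -
  note K = linear_koszul[OF assms] and C = christoffel_in_chart[OF assms]
    and U = christoffel_in_chart_unique[OF assms, THEN iffD1, symmetric]
    and B = bilinear_metric_in_chart[OF assms]
  show "linear (\<lambda>v. christoffel_in_chart M c x v w)"
    by (rule linearI; rule U)
      (simp_all add: bilinear_ladd[OF B] bilinear_lmul[OF B] distrib_left C mult.left_commute[of 2] linear_add[OF K(1)] linear_scale[OF K(1)])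
  show "linear (\<lambda>w. christoffel_in_chart M c x v w)"
    by (rule linearI; rule U)
      (simp_all add: bilinear_ladd[OF B] bilinear_lmul[OF B] distrib_left C mult.left_commute[of 2] linear_add[OF K(2)] linear_scale[OF K(2)])
qed

lemma christoffel_eq: "christoffel M p v w = christoffel_in_chart M (chart_at M p) (snd (chart_at M p) p) v w"
  unfolding christoffel_def christoffel_in_chart_def koszul_def metric_deriv_def Let_def metric_in_chart_chart_at ..

section \<open>Transformation laws under a change of chart\<close>

lemma metric_deriv_transition:
  assumes c: "c \<in> charts M" and d: "d \<in> charts M" and x: "x \<in> snd c ` (fst c \<inter> fst d)"
  defines "z \<equiv> transition c d x" and "D \<equiv> transition_deriv c d x" and "DD \<equiv> transition_deriv2 c d x"
  shows "metric_deriv M c x a v w = metric_deriv M d z (D a) (D v) (D w) +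
    metric_in_chart M d z (DD a v) (D w) + metric_in_chart M d z (D v) (DD a w)"
proof -
  \<comment> \<open>The metric is treated as a tensor field on lists of length 2, so that the
    general transformation law applies to it.\<close>
  define T where "T = (\<lambda>p (vs :: 'e list). rmetric M p (vs ! 0) (vs ! 1))"
  have T: "tensor_in_chart M b T y us = metric_in_chart M b y (us ! 0) (us ! 1)" if "length us = 2" for us y b
    using that by (simp add: tensor_in_chart_def T_def metric_in_chart_def)
  have mT: "multilinear 2 (T p)" for p
    using rmetric(1)[of p] by (auto simp: numeral_2_eq_2 multilinear_Suc T_def bilinear_def length_Suc_conv)
  have zS: "z \<in> snd d ` fst d" using transition_mem(1)[OF c d x] by (auto simp: z_def)
  have dT: "((\<lambda>y. tensor_in_chart M d T y us) has_derivative (\<lambda>a. metric_deriv M d z a (us ! 0) (us ! 1))) (at z)"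
    if "length us = 2" for us
    unfolding T[OF that] by (rule has_derivative_metric_in_chart[OF d zS])
  have "((\<lambda>y. tensor_in_chart M c T y [v, w]) has_derivative
    (\<lambda>h. frechet_derivative (\<lambda>y. tensor_in_chart M d T y (map D [v, w])) (at z) (D h)
      + (\<Sum>i<2. tensor_in_chart M d T z ((map D [v, w])[i := DD h ([v, w] ! i)])))) (at x)"
    unfolding z_def D_def DD_def
    by (rule has_derivative_tensor_transition[OF open_UNIV c d x UNIV_I mT])
      (use dT in \<open>auto simp: z_def differentiable_def\<close>)
  also have "(\<lambda>h. frechet_derivative (\<lambda>y. tensor_in_chart M d T y (map D [v, w])) (at z) (D h)
      + (\<Sum>i<2. tensor_in_chart M d T z ((map D [v, w])[i := DD h ([v, w] ! i)]))) =
    (\<lambda>a. metric_deriv M d z (D a) (D v) (D w) +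
    metric_in_chart M d z (DD a v) (D w) + metric_in_chart M d z (D v) (DD a w))"
    using frechet_derivative_eqI[OF dT, of "map D [v, w]"] by (simp add: T numeral_2_eq_2 add.assoc)
  finally have "((\<lambda>y. metric_in_chart M c y v w) has_derivative (\<lambda>a. metric_deriv M d z (D a) (D v) (D w) +
    metric_in_chart M d z (DD a v) (D w) + metric_in_chart M d z (D v) (DD a w))) (at x)"
    by (simp add: T)
  from has_derivative_unique[OF this has_derivative_metric_in_chart[OF c]] x show ?thesis
    by (auto simp: fun_eq_iff)
qed

text \<open>The vector \<open>u\<close>, obtained by transporting the right-hand side back to chart
  \<open>c\<close>, satisfies the Koszul equation there, so uniqueness identifies it with the
  Christoffel vector.\<close>

lemma christoffel_transition:
  assumes c: "c \<in> charts M" and d: "d \<in> charts M" and x: "x \<in> snd c ` (fst c \<inter> fst d)"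
  defines "z \<equiv> transition c d x" and "D \<equiv> transition_deriv c d x" and "DD \<equiv> transition_deriv2 c d x"
  shows "D (christoffel_in_chart M c x v w) = christoffel_in_chart M d z (D v) (D w) + DD v w"
proof -
  define u where "u = transition_deriv d c z (christoffel_in_chart M d z (D v) (D w) + DD v w)"
  have Du: "D u = christoffel_in_chart M d z (D v) (D w) + DD v w"
    unfolding u_def D_def z_def by (rule transition_deriv_inverse(2)[OF c d x])
  have zS: "z \<in> snd d ` fst d" using transition_mem(1)[OF c d x] by (auto simp: z_def)
  have xS: "x \<in> snd c ` fst c" using x by auto
  note B = bilinear_metric_in_chart[OF d zS]
  have "2 * metric_in_chart M c x u y = koszul M c x v w y" for y
  proof -
    have DDc: "DD a b = DD b a" for a b unfolding DD_def by (rule transition_deriv2_commute[OF c d x])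
    have "2 * metric_in_chart M c x u y = 2 * metric_in_chart M d z (D u) (D y)"
      unfolding z_def D_def by (simp add: metric_in_chart_transition[OF c d x])
    also have "\<dots> = koszul M d z (D v) (D w) (D y) + 2 * metric_in_chart M d z (DD v w) (D y)"
      by (simp add: Du bilinear_ladd[OF B] distrib_left christoffel_in_chart[OF d zS])
    \<comment> \<open>Of the six second-derivative terms produced by the three metric derivatives,
      four cancel by symmetry of \<open>DD\<close> and of the metric, and the remaining two are
      equal.\<close>
    also have "\<dots> = koszul M c x v w y"
      unfolding koszul_def metric_deriv_transition[OF c d x] z_def[symmetric] D_def[symmetric] DD_def[symmetric]
      using DDc[of w v] DDc[of y v] DDc[of y w]
        metric_in_chart_commute[of d z "D w" "DD v y"] metric_in_chart_commute[of d z "D v" "DD w y"]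
      by simp
    finally show ?thesis .
  qed
  then have "u = christoffel_in_chart M c x v w"
    using christoffel_in_chart_unique[OF c xS] by blast
  then show ?thesis using Du by simp
qed

text \<open>The definition of \<open>cov_deriv\<close> changes charts from point to point; this
  formula holds throughout one chart and can therefore be differentiated again. The second
  derivatives of the transition map occurring in the partial derivative and in the Christoffel
  symbols cancel.\<close>

lemma cov_deriv_in_chart:
  assumes U: "open U" and c: "c \<in> charts M" and x: "x \<in> snd c ` (fst c \<inter> U)"
    and T: "\<And>p. p \<in> U \<Longrightarrow> multilinear m (T p)"
    and dT: "\<And>d us y. d \<in> charts M \<Longrightarrow> length us = m \<Longrightarrow> y \<in> snd d ` (fst d \<inter> U) \<Longrightarrow>
      (\<lambda>y. tensor_in_chart M d T y us) differentiable (at y)"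
    and ws: "length ws = m"
  shows "tensor_in_chart M c (cov_deriv M T) x (v # ws) =
    frechet_derivative (\<lambda>y. tensor_in_chart M c T y ws) (at x) v
      - (\<Sum>i<m. tensor_in_chart M c T x (ws[i := christoffel_in_chart M c x v (ws ! i)]))"
proof -
  define p where "p = chart_inv c x"
  define d where "d = chart_at M p"
  define z where "z = transition c d x"
  define D where "D = transition_deriv c d x"
  define DD where "DD = transition_deriv2 c d x"
  have d: "d \<in> charts M" "p \<in> fst d" using chart_at by (simp_all add: d_def)
  have xS: "x \<in> snd c ` fst c" and pU: "p \<in> U" using x c by (auto simp: p_def)
  have xd: "x \<in> snd c ` (fst c \<inter> fst d)" using mem_chart_image[OF c] xS d by (simp add: p_def)
  have z: "z = snd d p" by (simp add: z_def transition_def p_def)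
  have D: "to_tangent M c x = D" by (simp add: to_tangent_eq D_def d_def p_def)
  have Td: "tensor_in_chart M d T z us = T p us" for us
    unfolding z d_def by (rule tensor_in_chart_chart_at)
  have Tc: "tensor_in_chart M c T x us = T p (map D us)" for us
    by (simp add: tensor_in_chart_def D p_def)
  have "frechet_derivative (\<lambda>y. tensor_in_chart M c T y ws) (at x) v =
    frechet_derivative (\<lambda>y. tensor_in_chart M d T y (map D ws)) (at z) (D v)
      + (\<Sum>i<m. T p ((map D ws)[i := DD v (ws ! i)]))"
    unfolding Td[symmetric] unfolding z_def D_def DD_def
    by (subst frechet_derivative_eqI[OF has_derivative_tensor_transition[OF U c d(1) xd _ T _ ws]])
      (use pU p_def dT[OF d(1)] z d in \<open>auto simp: z_def\<close>)
  moreover have "T p (map D (ws[i := christoffel_in_chart M c x v (ws ! i)])) =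
      T p ((map D ws)[i := christoffel M p (D v) (D (ws ! i))]) + T p ((map D ws)[i := DD v (ws ! i)])" if "i < m" for i
  proof -
    have "D (christoffel_in_chart M c x v (ws ! i)) = christoffel M p (D v) (D (ws ! i)) + DD v (ws ! i)"
      unfolding christoffel_eq d_def[symmetric] z[symmetric] unfolding D_def z_def DD_def
      by (rule christoffel_transition[OF c d(1) xd])
    then show ?thesis
      using linear_add[OF multilinearD[OF T[OF pU], of "map D ws" i]] that ws by (simp add: map_update)
  qed
  moreover have "tensor_in_chart M c (cov_deriv M T) x (v # ws) =
    frechet_derivative (\<lambda>y. tensor_in_chart M d T y (map D ws)) (at z) (D v)
      - (\<Sum>i<m. T p ((map D ws)[i := christoffel M p (D v) (D (ws ! i))]))"
    using ws by (simp add: tensor_in_chart_def[of M c "cov_deriv M T"] D cov_deriv_def Let_def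
        p_def[symmetric] d_def[symmetric] z)
  ultimately show ?thesis by (simp add: Tc sum.distrib)
qed

end

section \<open>Smoothness of the Christoffel symbols\<close>

lemma bilinear_onb_expansion:
  fixes g :: "'e::{real_inner, heine_borel} \<Rightarrow> 'e \<Rightarrow> real"
  assumes "bilinear g"
  shows "g v w = (\<Sum>a\<in>onb. \<Sum>b\<in>onb. inner v a * inner w b * g a b)"
proof -
  have 1: "linear (\<lambda>v. g v w)" "\<And>v. linear (g v)" for w using assms by (auto simp: bilinear_def)
  have "g v w = (\<Sum>a\<in>onb. inner v a * g a w)" using linear_onb_expansion[OF 1(1), of v] by simp
  also have "\<dots> = (\<Sum>a\<in>onb. \<Sum>b\<in>onb. inner v a * inner w b * g a b)"
    using linear_onb_expansion[OF 1(2), of _ w] by (simp add: sum_distrib_left mult.assoc)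
  finally show ?thesis .
qed

lemma abs_inner_onb_le: "b \<in> onb \<Longrightarrow> \<bar>inner v b\<bar> \<le> norm v"
  using Cauchy_Schwarz_ineq2[of v b] by simp

lemma bilinear_small:
  fixes g :: "'e::{real_inner, heine_borel} \<Rightarrow> 'e \<Rightarrow> real"
  assumes g: "bilinear g" and e: "\<And>a b. a \<in> onb \<Longrightarrow> b \<in> onb \<Longrightarrow> \<bar>g a b\<bar> \<le> e"
  shows "\<bar>g v v\<bar> \<le> real (card (onb :: 'e set)) * (real (card (onb :: 'e set)) * e) * (norm v)\<^sup>2"
proof -
  have "\<bar>g v v\<bar> \<le> (\<Sum>a\<in>onb. \<Sum>b\<in>onb. \<bar>inner v a * inner v b * g a b\<bar>)"
    unfolding bilinear_onb_expansion[OF g, of v v] by (intro order_trans[OF sum_abs] sum_mono sum_abs)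
  also have "\<dots> \<le> (\<Sum>a\<in>(onb :: 'e set). \<Sum>b\<in>(onb :: 'e set). (norm v)\<^sup>2 * e)"
  proof (intro sum_mono)
    fix a b :: 'e assume ab: "a \<in> onb" "b \<in> onb"
    have "\<bar>inner v a\<bar> * \<bar>inner v b\<bar> \<le> norm v * norm v"
      using ab by (intro mult_mono abs_inner_onb_le) auto
    then show "\<bar>inner v a * inner v b * g a b\<bar> \<le> (norm v)\<^sup>2 * e"
      using e[OF ab] unfolding abs_mult power2_eq_square by (rule mult_mono) auto
  qed
  finally show ?thesis by (simp add: mult.commute mult.left_commute)
qed

text \<open>The constant is the minimum of \<open>g v v\<close> on the unit sphere, which is compact
  by Heine-Borel; homogeneity does the rest. In dimension 0 the sphere is empty and any positive
  constant serves.\<close>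

lemma coercive:
  fixes g :: "'e::{real_inner, heine_borel} \<Rightarrow> 'e \<Rightarrow> real"
  assumes g: "bilinear g" "\<And>v. v \<noteq> 0 \<Longrightarrow> 0 < g v v"
  obtains c where "0 < c" "\<And>v. c * (norm v)\<^sup>2 \<le> g v v"
proof -
  have "\<exists>c>0. \<forall>v\<in>sphere 0 1. c \<le> g v v"
  proof (cases "sphere 0 1 = ({} :: 'e set)")
    case True
    then show ?thesis by (intro exI[of _ 1]) simp
  next
    case False
    have "continuous_on (sphere 0 1) (\<lambda>v. \<Sum>a\<in>onb. \<Sum>b\<in>onb. inner v a * inner v b * g a b)"
      by (intro continuous_intros)
    then have "continuous_on (sphere 0 1) (\<lambda>v. g v v)"
      by (simp add: bilinear_onb_expansion[OF g(1), symmetric])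
    moreover have "compact (sphere 0 (1::real) :: 'e set)"
      unfolding compact_eq_bounded_closed
    proof
      show "bounded (sphere 0 (1::real) :: 'e set)" by (rule boundedI[of _ 1]) simp
      have "closed {v :: 'e. norm v = 1}" by (intro closed_Collect_eq continuous_intros)
      then show "closed (sphere 0 (1::real) :: 'e set)" by (simp add: sphere_def)
    qed
    ultimately obtain v where v: "v \<in> sphere 0 1" "\<And>w. w \<in> sphere 0 1 \<Longrightarrow> g v v \<le> g w w"
      using continuous_attains_inf[OF _ False, of "\<lambda>v. g v v"] by blast
    moreover have "v \<noteq> 0" using v(1) by auto
    ultimately show ?thesis using g(2)[of v] by (intro exI[of _ "g v v"]) auto
  qed
  then obtain c where c: "0 < c" "\<And>v. norm v = 1 \<Longrightarrow> c \<le> g v v" by auto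
  show ?thesis
  proof (rule that[OF c(1)])
    fix v :: 'e
    show "c * (norm v)\<^sup>2 \<le> g v v"
    proof (cases "v = 0")
      case True
      then show ?thesis using bilinear_lzero[OF g(1)] by simp
    next
      case False
      then have "c \<le> g (v /\<^sub>R norm v) (v /\<^sub>R norm v)" by (intro c) simp
      also have "\<dots> = g v v / (norm v)\<^sup>2"
        by (simp add: bilinear_lmul[OF g(1)] bilinear_rmul[OF g(1)] power2_eq_square field_simps)
      finally show ?thesis using False by (simp add: field_simps)
    qed
  qed
qed

text \<open>Test \<open>g z\<close> against \<open>z\<close> itself and expand in
  \<open>onb\<close>; one factor \<open>norm z\<close> cancels. This a priori bound takes the place
  of inverting the matrix of \<open>g\<close>.\<close>

lemma coercive_norm_le:
  fixes g :: "'e::{real_inner, heine_borel} \<Rightarrow> 'e \<Rightarrow> real"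
  assumes g: "bilinear g" and c: "c * (norm z)\<^sup>2 \<le> g z z"
  shows "c * norm z \<le> (\<Sum>b\<in>onb. \<bar>g z b\<bar>)"
proof (cases "z = 0")
  case True
  then show ?thesis by (simp add: sum_nonneg)
next
  case False
  have "linear (g z)" using g by (simp add: bilinear_def)
  from norm_linear_onb_le[OF this, of z] c
  have "(c * norm z) * norm z \<le> (\<Sum>b\<in>onb. \<bar>g z b\<bar>) * norm z" by (simp add: power2_eq_square)
  then show ?thesis using False by simp
qed

lemma locally_coercive:
  fixes g :: "'e::{real_inner, heine_borel} \<Rightarrow> 'e \<Rightarrow> 'e \<Rightarrow> real"
  assumes S: "open S" "x \<in> S"
    and g: "\<And>y. y \<in> S \<Longrightarrow> bilinear (g y)" "\<And>v. v \<noteq> 0 \<Longrightarrow> 0 < g x v v"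
    and cont: "\<And>a b. continuous (at x) (\<lambda>y. g y a b)"
  obtains c where "0 < c" "\<forall>\<^sub>F y in nhds x. \<forall>v. c * (norm v)\<^sup>2 \<le> g y v v"
proof -
  obtain c where c: "0 < c" "\<And>v. c * (norm v)\<^sup>2 \<le> g x v v"
    using coercive[OF g(1)[OF S(2)] g(2)] by blast
  define n where "n = real (card (onb :: 'e set))"
  \<comment> \<open>With \<open>n\<close> the number of basis vectors, an error \<open>e\<close> in
    each coefficient changes the quadratic form by at most \<open>n * n * e\<close> times the
    squared norm, which costs at most half of \<open>c\<close>; the summand 1 covers
    \<open>n = 0\<close>.\<close>
  define e where "e = c / (2 * (n * n + 1))"
  have n: "n * n + 1 > 0" by (simp add: add_nonneg_pos)
  have e: "e > 0" using c n by (simp add: e_def)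
  have "\<forall>\<^sub>F y in nhds x. \<bar>g y a b - g x a b\<bar> < e" for a b
  proof -
    have "((\<lambda>y. g y a b) \<longlongrightarrow> g x a b) (nhds x)"
      using cont[of a b] by (simp add: continuous_at tendsto_nhds_iff)
    from tendstoD[OF this e] show ?thesis by (simp add: dist_real_def)
  qed
  then have "\<forall>\<^sub>F y in nhds x. \<forall>a\<in>onb. \<forall>b\<in>onb. \<bar>g y a b - g x a b\<bar> < e"
    by (intro eventually_ball_finite[OF finite_onb] ballI)
  moreover have "\<forall>\<^sub>F y in nhds x. y \<in> S" using S by (rule eventually_nhds_in_open)
  ultimately have "\<forall>\<^sub>F y in nhds x. \<forall>v. c / 2 * (norm v)\<^sup>2 \<le> g y v v"
  proof eventually_elim
    case (elim y)
    show ?case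
    proof
      fix v
      have "bilinear (\<lambda>v w. g y v w - g x v w)"
        using g(1)[OF elim(2)] g(1)[OF S(2)] unfolding bilinear_def by (auto intro: linear_compose_sub)
      from bilinear_small[OF this, of e v] elim(1)
      have "\<bar>g y v v - g x v v\<bar> \<le> n * (n * e) * (norm v)\<^sup>2" by (simp add: n_def less_imp_le)
      also have "n * (n * e) * (norm v)\<^sup>2 \<le> c / 2 * (norm v)\<^sup>2"
      proof (rule mult_right_mono)
        have "n * (n * e) \<le> (n * n + 1) * e" using e by (simp add: algebra_simps)
        also have "\<dots> = c / 2" using n unfolding e_def by (simp add: divide_simps)
        finally show "n * (n * e) \<le> c / 2" .
      qed simp
      finally show "c / 2 * (norm v)\<^sup>2 \<le> g y v v" using c(2)[of v] unfolding abs_le_iff by linarith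
    qed
  qed
  then show ?thesis using that[of "c / 2"] c by simp
qed

lemma equi_C_subset: "equi_C r S I F \<Longrightarrow> T \<subseteq> S \<Longrightarrow> equi_C r T I F"
proof (induction r arbitrary: F)
  case (Suc r)
  have "equi_C r T I (\<lambda>i x. frechet_derivative (F i) (at x) v)" for v
    by (rule Suc.IH) (use Suc.prems in simp_all)
  then show ?case using Suc.prems by (auto simp: equi_bounded_def)
qed (auto simp: equi_bounded_def)

text \<open>A linear map is determined by its values on \<open>onb\<close>, so regularity in
  \<open>x\<close> at fixed basis vectors passes to a moving argument \<open>Z\<close>.\<close>

lemma equi_C_onb:
  fixes f :: "'i \<Rightarrow> 'e::{real_inner, heine_borel} \<Rightarrow> 'e \<Rightarrow> real"
  assumes S: "open S" and lin: "\<And>i x. i \<in> I \<Longrightarrow> x \<in> S \<Longrightarrow> linear (f i x)"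
    and f: "\<And>b. b \<in> onb \<Longrightarrow> equi_C r S I (\<lambda>i x. f i x b)" and Z: "equi_C r S I Z"
  shows "equi_C r S I (\<lambda>i x. f i x (Z i x))"
proof (rule equi_C_cong[OF S])
  show "equi_C r S I (\<lambda>i x. \<Sum>b\<in>onb. inner (Z i x) b * f i x b)"
    by (intro equi_C_sum[OF S] equi_C_mult[OF S] equi_C_inner[OF S] equi_C_const[OF S] f Z)
  show "(\<Sum>b\<in>onb. inner (Z i x) b * f i x b) = f i x (Z i x)" if "i \<in> I" "x \<in> S" for i x
    using linear_onb_expansion[OF lin[OF that], of "Z i x"] by simp
qed

text \<open>The derivative of a solution solves a system with the same \<open>g\<close> and
  right-hand side \<open>\<kappa>'\<close>, so regularity follows by induction on the order.
  Coercivity of \<open>g\<close> bounds the solutions and also proves that they are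
  differentiable.\<close>

lemma equi_C_linear_system:
  fixes g :: "'e::{real_inner, heine_borel} \<Rightarrow> 'e \<Rightarrow> 'e \<Rightarrow> real" and Z :: "'i \<Rightarrow> 'e \<Rightarrow> 'e"
  assumes S: "open S"
    and bil: "\<And>x. x \<in> S \<Longrightarrow> bilinear (g x)"
    and pos: "\<And>x v. x \<in> S \<Longrightarrow> v \<noteq> 0 \<Longrightarrow> 0 < g x v v"
    and smooth: "\<And>v w. smooth_on S (\<lambda>x. g x v w)"
  shows "(\<And>y. equi_C r S I (\<lambda>i x. \<kappa> i x y)) \<Longrightarrow> (\<And>i x y. i \<in> I \<Longrightarrow> x \<in> S \<Longrightarrow> g x (Z i x) y = \<kappa> i x y) \<Longrightarrow>
    equi_C r S I Z"
proof (induction r arbitrary: \<kappa> Z)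
  have dg: "(\<lambda>x. g x v w) differentiable (at x)" if "x \<in> S" for v w x
    using smooth[of v w] that unfolding smooth_on_def by (metis C_on.simps(2))
  define g' where "g' = (\<lambda>x a v w. frechet_derivative (\<lambda>x. g x v w) (at x) a)"
  have g': "((\<lambda>x. g x v w) has_derivative (\<lambda>a. g' x a v w)) (at x)" if "x \<in> S" for v w x
    unfolding g'_def using has_derivative_frechet[OF dg[OF that]] .
  have eg: "equi_C r S I (\<lambda>_ x. g x v w)" for r v w
    using smooth S by (rule smooth_on_imp_equi_C)
  have eg': "equi_C r S I (\<lambda>_ x. g' x a v w)" for r a v w
    using eg[of "Suc r" v w] by (simp add: g'_def)
  have ling': "linear (\<lambda>w. g' x a v w)" if x: "x \<in> S" for x a v
    unfolding g'_def by (rule linear_frechet_derivative_parameter[OF S x _ dg[OF x]])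
      (use bil in \<open>simp add: bilinear_def\<close>)
  have ling'': "linear (\<lambda>v. g' x a v w)" if x: "x \<in> S" for x a w
    unfolding g'_def by (rule linear_frechet_derivative_parameter[OF S x _ dg[OF x]])
      (use bil in \<open>simp add: bilinear_def\<close>)
  have coer: "\<exists>c>0. \<forall>\<^sub>F y in nhds x. \<forall>v. c * (norm v)\<^sup>2 \<le> g y v v" if x: "x \<in> S" for x
  proof (rule locally_coercive[OF S x, of g])
    show "continuous (at x) (\<lambda>y. g y a b)" for a b
      by (rule differentiable_imp_continuous_within[OF dg[OF x]])
    show "\<exists>c>0. \<forall>\<^sub>F y in nhds x. \<forall>v. c * (norm v)\<^sup>2 \<le> g y v v"
      if "0 < c" "\<forall>\<^sub>F y in nhds x. \<forall>v. c * (norm v)\<^sup>2 \<le> g y v v" for c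
      using that by blast
  qed (use bil pos[OF x] in simp_all)
  have base: "equi_bounded S I Z" if \<kappa>: "\<And>y. equi_bounded S I (\<lambda>i x. \<kappa> i x y)"
    and Z: "\<And>i x y. i \<in> I \<Longrightarrow> x \<in> S \<Longrightarrow> g x (Z i x) y = \<kappa> i x y" for \<kappa> and Z :: "'i \<Rightarrow> 'e \<Rightarrow> 'e"
  proof (rule equi_boundedI)
    fix x assume x: "x \<in> S"
    obtain c where c: "c > 0" "\<forall>\<^sub>F y in nhds x. \<forall>v. c * (norm v)\<^sup>2 \<le> g y v v"
      using coer[OF x] by blast
    have "\<forall>b. \<exists>K. \<forall>\<^sub>F y in nhds x. \<forall>i\<in>I. norm (\<kappa> i y b) \<le> K"
      using \<kappa> x by (auto simp: equi_bounded_def)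
    then obtain K where "\<And>b. \<forall>\<^sub>F y in nhds x. \<forall>i\<in>I. norm (\<kappa> i y b) \<le> K b" by (auto dest!: choice)
    then have "\<forall>\<^sub>F y in nhds x. \<forall>b\<in>onb. \<forall>i\<in>I. norm (\<kappa> i y b) \<le> K b"
      by (intro eventually_ball_finite[OF finite_onb] ballI)
    moreover have "\<forall>\<^sub>F y in nhds x. y \<in> S" using S x by (rule eventually_nhds_in_open)
    ultimately have "\<forall>\<^sub>F y in nhds x. \<forall>i\<in>I. norm (Z i y) \<le> (\<Sum>b\<in>onb. K b) / c"
      using c(2)
    proof eventually_elim
      case (elim y)
      show ?case
      proof
        fix i assume i: "i \<in> I"
        have "c * norm (Z i y) \<le> (\<Sum>b\<in>onb. \<bar>g y (Z i y) b\<bar>)"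
          using elim(3) by (intro coercive_norm_le bil elim(2)) auto
        also have "\<dots> \<le> (\<Sum>b\<in>onb. K b)" using elim i Z by (intro sum_mono) auto
        finally show "norm (Z i y) \<le> (\<Sum>b\<in>onb. K b) / c" using c by (simp add: field_simps)
      qed
    qed
    then show "\<exists>K. \<forall>\<^sub>F y in nhds x. \<forall>i\<in>I. norm (Z i y) \<le> K" by blast
  qed
  {
    case 0
    show ?case using base[of \<kappa> Z] 0 by simp
  next
    case (Suc r)
    note Z = Suc.prems(2)
    \<comment> \<open>Differentiating \<open>g x (Z i x) y = \<kappa> i x y\<close> along
      \<open>a\<close> gives this right-hand side for the derivative of \<open>Z\<close>; the
      undifferentiated \<open>Z\<close> reappears in it.\<close>
    define \<kappa>' where "\<kappa>' = (\<lambda>i x a y. frechet_derivative (\<lambda>x. \<kappa> i x y) (at x) a - g' x a (Z i x) y)"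
    define Z' where "Z' = (\<lambda>i x a. THE z. \<forall>y. g x z y = \<kappa>' i x a y)"
    have d\<kappa>: "((\<lambda>x. \<kappa> i x y) has_derivative (\<lambda>a. frechet_derivative (\<lambda>x. \<kappa> i x y) (at x) a)) (at x)"
      if "i \<in> I" "x \<in> S" for i x y
      using Suc.prems(1)[of y] that by (intro has_derivative_frechet) simp
    have lin\<kappa>: "linear (\<lambda>y. frechet_derivative (\<lambda>x. \<kappa> i x y) (at x) a)" if i: "i \<in> I" and x: "x \<in> S" for i x a
    proof (rule linear_frechet_derivative_parameter[OF S x])
      show "linear (\<lambda>w. \<kappa> i y w)" if "y \<in> S" for y
        using bil[OF that] unfolding Z[OF i that, symmetric] bilinear_def by simp
      show "(\<lambda>x. \<kappa> i x w) differentiable (at x)" for w using Suc.prems(1)[of w] i x by simp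
    qed
    have ex: "\<exists>!z. \<forall>y. g x z y = \<kappa>' i x a y" if i: "i \<in> I" and x: "x \<in> S" for i x a
      unfolding \<kappa>'_def
      by (intro Riesz_representation_bilinear bil pos linear_compose_sub lin\<kappa> ling' i x)
    have Z': "g x (Z' i x a) y = \<kappa>' i x a y" if i: "i \<in> I" and x: "x \<in> S" for i x a y
      using theI'[OF ex[OF i x, of a]] unfolding Z'_def by blast
    have Z'_eq: "Z' i x a = z" if "i \<in> I" "x \<in> S" "\<And>y. g x z y = \<kappa>' i x a y" for i x a z
      using ex[OF that(1,2), of a] Z'[OF that(1,2), of a] that(3) by blast
    have linZ': "linear (Z' i x)" if i: "i \<in> I" and x: "x \<in> S" for i x
    proof (rule linearI)
      have L: "linear (\<lambda>a. frechet_derivative (\<lambda>x. \<kappa> i x y) (at x) a)" "linear (\<lambda>a. g' x a v y)" for v y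
        using d\<kappa>[OF i x] g'[OF x] has_derivative_linear by blast+
      have L': "linear (\<lambda>a. \<kappa>' i x a y)" for y unfolding \<kappa>'_def by (intro linear_compose_sub L)
      show "Z' i x (a + b) = Z' i x a + Z' i x b" for a b
        by (rule Z'_eq[OF i x]) (simp add: bilinear_ladd[OF bil[OF x]] Z'[OF i x] linear_add[OF L'])
      show "Z' i x (c *\<^sub>R a) = c *\<^sub>R Z' i x a" for a c
        by (rule Z'_eq[OF i x]) (use linear_scale[OF L', of c a] in \<open>simp add: bilinear_lmul[OF bil[OF x]] Z'[OF i x]\<close>)
    qed
    have dZ: "(Z i has_derivative Z' i x) (at x)" if i: "i \<in> I" and x: "x \<in> S" for i x
    proof -
      have blZ': "bounded_linear (Z' i x)" by (rule linear_imp_bounded_linear_onb[OF linZ'[OF i x]])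
      \<comment> \<open>\<open>R\<close> is the Taylor remainder of \<open>Z i\<close> with the
        candidate derivative, and \<open>Q b\<close> is its pairing with \<open>b\<close>. Each
        \<open>Q b\<close> has derivative 0 at \<open>x\<close> by the differentiated equation, and
        coercivity bounds \<open>c * norm (R y)\<close> by the sum of the absolute values of the
        \<open>Q b y\<close>.\<close>
      define R where "R = (\<lambda>y. Z i y - Z i x - Z' i x (y - x))"
      define Q where "Q = (\<lambda>b y. g y (R y) b)"
      have lg: "linear (\<lambda>v. g y v b)" if "y \<in> S" for y b using bil[OF that] by (simp add: bilinear_def)
      have Q0: "Q b x = 0" for b
        using linear_0[OF linZ'[OF i x]] bilinear_lzero[OF bil[OF x]] by (simp add: Q_def R_def)
      have dQ: "(Q b has_derivative (\<lambda>_. 0)) (at x)" for b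
      proof -
        have dA: "((\<lambda>y. inner (Z' i x (y - x)) a) has_derivative (\<lambda>h. inner (Z' i x h) a)) (at x)" for a
          by (rule has_derivative_inner_left, rule bounded_linear.has_derivative[OF blZ'])
            (auto intro!: derivative_eq_intros)
        have "((\<lambda>y. \<kappa> i y b - g y (Z i x) b - (\<Sum>a\<in>onb. inner (Z' i x (y - x)) a * g y a b)) has_derivative
          (\<lambda>h. frechet_derivative (\<lambda>x. \<kappa> i x b) (at x) h - g' x h (Z i x) b -
            (\<Sum>a\<in>onb. inner (Z' i x (x - x)) a * g' x h a b + inner (Z' i x h) a * g x a b))) (at x)"
          by (intro has_derivative_diff has_derivative_sum has_derivative_mult d\<kappa>[OF i x] g'[OF x] dA)
        also have "(\<lambda>h. frechet_derivative (\<lambda>x. \<kappa> i x b) (at x) h - g' x h (Z i x) b -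
            (\<Sum>a\<in>onb. inner (Z' i x (x - x)) a * g' x h a b + inner (Z' i x h) a * g x a b)) = (\<lambda>_. 0)"
        proof
          fix h
          have "(\<Sum>a\<in>onb. inner (Z' i x h) a * g x a b) = \<kappa>' i x h b"
            using linear_onb_expansion[OF lg[OF x], of "Z' i x h" b] Z'[OF i x] by simp
          then show "frechet_derivative (\<lambda>x. \<kappa> i x b) (at x) h - g' x h (Z i x) b -
            (\<Sum>a\<in>onb. inner (Z' i x (x - x)) a * g' x h a b + inner (Z' i x h) a * g x a b) = 0"
            using linear_0[OF linZ'[OF i x]] by (simp add: \<kappa>'_def)
        qed
        finally show ?thesis
        proof (rule has_derivative_transform_within_open[OF _ S x])
          fix y assume y: "y \<in> S"
          show "\<kappa> i y b - g y (Z i x) b - (\<Sum>a\<in>onb. inner (Z' i x (y - x)) a * g y a b) = Q b y"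
            using linear_onb_expansion[OF lg[OF y], of "Z' i x (y - x)" b]
            by (simp add: Q_def R_def bilinear_lsub[OF bil[OF y]] Z[OF i y])
        qed
      qed
      obtain c where c: "c > 0" "\<forall>\<^sub>F y in nhds x. \<forall>v. c * (norm v)\<^sup>2 \<le> g y v v"
        using coer[OF x] by blast
      have "(R has_derivative (\<lambda>_. 0)) (at x)"
        unfolding has_derivative_iff_norm
      proof (intro conjI bounded_linear_zero)
        have R0: "R x = 0" using linear_0[OF linZ'[OF i x]] by (simp add: R_def)
        have "((\<lambda>y. \<Sum>b\<in>onb. norm (Q b y - Q b x - 0) / norm (y - x)) \<longlongrightarrow> (\<Sum>b\<in>(onb :: 'e set). 0)) (at x)"
          using dQ unfolding has_derivative_iff_norm by (intro tendsto_sum) auto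
        then have lim: "((\<lambda>y. (\<Sum>b\<in>onb. norm (Q b y - Q b x - 0) / norm (y - x)) / c) \<longlongrightarrow> 0) (at x)"
          using tendsto_divide[OF _ tendsto_const[of c]] c(1) by fastforce
        show "((\<lambda>y. norm (R y - R x - 0) / norm (y - x)) \<longlongrightarrow> 0) (at x)"
        proof (rule tendsto_sandwich[OF _ _ tendsto_const lim])
          have "\<forall>\<^sub>F y in nhds x. y \<in> S" using S x by (rule eventually_nhds_in_open)
          then have "\<forall>\<^sub>F y in nhds x. norm (R y - R x - 0) / norm (y - x) \<le> (\<Sum>b\<in>onb. norm (Q b y - Q b x - 0) / norm (y - x)) / c"
            using c(2)
          proof eventually_elim
            case (elim y)
            have "c * norm (R y) \<le> (\<Sum>b\<in>onb. \<bar>Q b y\<bar>)"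
              unfolding Q_def using elim by (intro coercive_norm_le bil) auto
            then have "norm (R y) \<le> (\<Sum>b\<in>onb. \<bar>Q b y\<bar>) / c" using c(1) by (simp add: field_simps)
            then have "norm (R y) / norm (y - x) \<le> (\<Sum>b\<in>onb. \<bar>Q b y\<bar>) / c / norm (y - x)"
              by (rule divide_right_mono) simp
            then show ?case by (simp add: R0 Q0 sum_divide_distrib[symmetric] mult.commute)
          qed
          then show "\<forall>\<^sub>F y in at x. norm (R y - R x - 0) / norm (y - x) \<le> (\<Sum>b\<in>onb. norm (Q b y - Q b x - 0) / norm (y - x)) / c"
            by (simp add: eventually_at_filter eventually_mono)
        qed simp
      qed
      then have "((\<lambda>y. R y + (Z i x + Z' i x (y - x))) has_derivative (\<lambda>h. 0 + (0 + Z' i x h))) (at x)"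
        by (intro has_derivative_add has_derivative_const bounded_linear.has_derivative[OF blZ'])
          (auto intro!: derivative_eq_intros)
      moreover have "(\<lambda>y. R y + (Z i x + Z' i x (y - x))) = Z i" by (simp add: R_def fun_eq_iff)
      ultimately show ?thesis by simp
    qed
    \<comment> \<open>Since \<open>\<kappa>'\<close> contains \<open>Z\<close>, its regularity of
      order \<open>r\<close> requires that of \<open>Z\<close> first, by the induction
      hypothesis.\<close>
    have eZ: "equi_C r S I Z"
      by (rule Suc.IH[of \<kappa>]) (use Suc.prems in \<open>auto intro: equi_C_Suc simp del: equi_C.simps\<close>)
    show ?case
    proof (rule equi_C_SucI[OF S _ dZ])
      show "equi_bounded S I Z"
        by (rule base[of \<kappa>]) (use Suc.prems in \<open>auto\<close>)
      show "equi_C r S I (\<lambda>i x. Z' i x v)" for v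
      proof (rule Suc.IH[of "\<lambda>i x y. \<kappa>' i x v y"])
        show "equi_C r S I (\<lambda>i x. \<kappa>' i x v y)" for y
          unfolding \<kappa>'_def
        proof (intro equi_C_minus[OF S])
          show "equi_C r S I (\<lambda>i x. frechet_derivative (\<lambda>x. \<kappa> i x y) (at x) v)"
            using Suc.prems(1)[of y] by simp
          show "equi_C r S I (\<lambda>i x. g' x v (Z i x) y)"
            by (rule equi_C_onb[OF S _ eg' eZ]) (use ling'' in blast)
        qed
      qed (use Z' in auto)
    qed
  }
qed

context riemannian
begin

lemma equi_C_christoffel_in_chart:
  assumes c: "c \<in> charts M"
  shows "equi_C r (snd c ` fst c) I (\<lambda>_ x. christoffel_in_chart M c x v w)"
proof (rule equi_C_linear_system[where g = "\<lambda>x z y. metric_in_chart M c x z y" and \<kappa> = "\<lambda>_ x y. 1/2 * koszul M c x v w y"])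
  note S = open_chart_range[OF c]
  have D: "equi_C r (snd c ` fst c) I (\<lambda>_ x. metric_deriv M c x a u y)" for a u y
    using smooth_on_imp_equi_C[OF smooth_metric_in_chart[OF c] S, of "Suc r" I u y] by (simp add: metric_deriv_def)
  show "equi_C r (snd c ` fst c) I (\<lambda>_ x. 1/2 * koszul M c x v w y)" for y
    unfolding koszul_def by (intro equi_C_mult[OF S] equi_C_const[OF S] equi_C_minus[OF S] equi_C_add[OF S] D)
  show "metric_in_chart M c x (christoffel_in_chart M c x v w) y = 1/2 * koszul M c x v w y"
    if "x \<in> snd c ` fst c" for x y
    using christoffel_in_chart[OF c that, of v w y] by simp
qed (use c open_chart_range bilinear_metric_in_chart metric_in_chart_pos smooth_metric_in_chart in auto)

end

section \<open>Families of tensor fields\<close>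

lemma C_on_lincomb:
  fixes f g :: "'a::real_normed_vector \<Rightarrow> real"
  assumes "open S"
  shows "C_on r S f \<Longrightarrow> C_on r S g \<Longrightarrow> C_on r S (\<lambda>x. a * f x + b * g x)"
proof (induction r arbitrary: f g)
  case 0
  then show ?case by (auto intro!: continuous_intros)
next
  case (Suc r)
  have D: "((\<lambda>x. a * f x + b * g x) has_derivative
      (\<lambda>v. a * frechet_derivative f (at x) v + b * frechet_derivative g (at x) v)) (at x)" if "x \<in> S" for x
    using Suc.prems that
    by (intro has_derivative_add has_derivative_mult_right has_derivative_frechet) auto
  have "C_on r S (\<lambda>x. frechet_derivative (\<lambda>x. a * f x + b * g x) (at x) v) \<longleftrightarrow>
      C_on r S (\<lambda>x. a * frechet_derivative f (at x) v + b * frechet_derivative g (at x) v)" for v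
    by (rule C_on_cong[OF assms]) (simp add: frechet_derivative_eqI[OF D])
  then show ?case using Suc differentiableI[OF D] by simp
qed

lemma C_on_zero: "C_on r S (\<lambda>_. 0 :: real)"
proof (induction r)
  case (Suc r)
  have "frechet_derivative (\<lambda>_. 0 :: real) (at x) = (\<lambda>_. 0)" for x :: 'a
    by (rule frechet_derivative_eqI) simp
  then show ?case using Suc by simp
qed simp

context riemannian
begin

text \<open>Covers a single field and a whole ball of forms alike; the index set is what makes the
  chart bounds uniform over the ball.\<close>

definition tensor_family :: "'m set \<Rightarrow> nat \<Rightarrow> nat \<Rightarrow> 'i set \<Rightarrow> ('i \<Rightarrow> 'm \<Rightarrow> 'e list \<Rightarrow> real) \<Rightarrow> bool"
  where "tensor_family U m r I H \<longleftrightarrow> (\<forall>i\<in>I. \<forall>p\<in>U. multilinear m (H i p)) \<and>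
    (\<forall>c\<in>charts M. \<forall>vs. length vs = m \<longrightarrow>
      equi_C r (snd c ` (fst c \<inter> U)) I (\<lambda>i x. tensor_in_chart M c (H i) x vs))"

lemma tensor_familyD:
  assumes "tensor_family U m r I H"
  shows "i \<in> I \<Longrightarrow> p \<in> U \<Longrightarrow> multilinear m (H i p)"
    "c \<in> charts M \<Longrightarrow> length vs = m \<Longrightarrow> equi_C r (snd c ` (fst c \<inter> U)) I (\<lambda>i x. tensor_in_chart M c (H i) x vs)"
  using assms by (auto simp: tensor_family_def)

lemma tensor_family_mono: "tensor_family U m r I H \<Longrightarrow> s \<le> r \<Longrightarrow> tensor_family U m s I H"
  unfolding tensor_family_def by (meson equi_C_mono)

lemma tensor_family_differentiable:
  assumes "tensor_family U m (Suc r) I H" "i \<in> I" "c \<in> charts M" "length vs = m" "x \<in> snd c ` (fst c \<inter> U)"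
  shows "(\<lambda>y. tensor_in_chart M c (H i) y vs) differentiable (at x)"
  using tensor_familyD(2)[OF assms(1,3,4)] assms(2,5) by auto

lemma cov_deriv_family_in_chart:
  assumes "open U" "tensor_family U m (Suc r) I H" "i \<in> I" "c \<in> charts M" "length ws = m" "x \<in> snd c ` (fst c \<inter> U)"
  shows "tensor_in_chart M c (cov_deriv M (H i)) x (v # ws) =
    frechet_derivative (\<lambda>y. tensor_in_chart M c (H i) y ws) (at x) v
      - (\<Sum>j<m. tensor_in_chart M c (H i) x (ws[j := christoffel_in_chart M c x v (ws ! j)]))"
  by (rule cov_deriv_in_chart[OF assms(1,4,6)])
    (use assms tensor_familyD(1)[OF assms(2)] tensor_family_differentiable[OF assms(2)] in auto)

lemma linear_tensor_derivative:
  assumes U: "open U" and H: "tensor_family U m (Suc r) I H" and i: "i \<in> I" and c: "c \<in> charts M"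
    and ws: "length ws = m" and j: "j < m" and x: "x \<in> snd c ` (fst c \<inter> U)"
  shows "linear (\<lambda>w. frechet_derivative (\<lambda>y. tensor_in_chart M c (H i) y (ws[j := w])) (at x) v)"
proof (rule linear_frechet_derivative_parameter[OF open_chart_image[OF c U] x])
  show "(\<lambda>y. tensor_in_chart M c (H i) y (ws[j := w])) differentiable (at x)" for w
    using tensor_family_differentiable[OF H i c _ x] ws by simp
  show "linear (\<lambda>w. tensor_in_chart M c (H i) y (ws[j := w]))" if "y \<in> snd c ` (fst c \<inter> U)" for y
    using multilinear_tensor_in_chart[OF c that tensor_familyD(1)[OF H i]] ws j by (rule multilinearD)
qed

lemma multilinear_cov_deriv:
  assumes U: "open U" and H: "tensor_family U m (Suc r) I H" and i: "i \<in> I" and p: "p \<in> U"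
  shows "multilinear (Suc m) (cov_deriv M (H i) p)"
proof -
  define c where "c = chart_at M p"
  define x where "x = snd c p"
  have c: "c \<in> charts M" and x: "x \<in> snd c ` (fst c \<inter> U)" using chart_at p by (auto simp: c_def x_def)
  have xS: "x \<in> snd c ` fst c" using x by auto
  define T where "T = tensor_in_chart M c (H i) x"
  have mT: "multilinear m T"
    unfolding T_def by (rule multilinear_tensor_in_chart[OF c x tensor_familyD(1)[OF H i]])
  have eq: "cov_deriv M (H i) p (v # ws) =
    frechet_derivative (\<lambda>y. tensor_in_chart M c (H i) y ws) (at x) v
      - (\<Sum>j<m. T (ws[j := christoffel_in_chart M c x v (ws ! j)]))" if "length ws = m" for v ws
    using cov_deriv_family_in_chart[OF U H i c that x, of v] tensor_in_chart_chart_at[of p "cov_deriv M (H i)" "v # ws"]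
    by (simp add: T_def c_def x_def)
  show ?thesis
    unfolding multilinear_Suc
  proof (intro conjI allI impI)
    fix ws :: "'e list" assume ws: "length ws = m"
    have "linear (\<lambda>v. frechet_derivative (\<lambda>y. tensor_in_chart M c (H i) y ws) (at x) v
      - (\<Sum>j<m. T (ws[j := christoffel_in_chart M c x v (ws ! j)])))"
    proof (intro linear_compose_sub linear_compose_sum ballI)
      show "linear (frechet_derivative (\<lambda>y. tensor_in_chart M c (H i) y ws) (at x))"
        using tensor_family_differentiable[OF H i c ws x] by (rule linear_frechet_derivative)
      show "linear (\<lambda>v. T (ws[j := christoffel_in_chart M c x v (ws ! j)]))" if "j \<in> {..<m}" for j
        using linear_compose[OF linear_christoffel_in_chart(1)[OF c xS] multilinearD[OF mT ws, of j]] that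
        by (simp add: comp_def)
    qed
    then show "linear (\<lambda>v. cov_deriv M (H i) p (v # ws))" by (simp add: eq[OF ws])
  next
    fix v
    show "multilinear m (\<lambda>ws. cov_deriv M (H i) p (v # ws))"
      unfolding multilinear_def
    proof (intro allI impI)
      fix ws :: "'e list" and j assume wj: "length ws = m \<and> j < m"
      have "linear (\<lambda>w. frechet_derivative (\<lambda>y. tensor_in_chart M c (H i) y (ws[j := w])) (at x) v
        - (\<Sum>l<m. T ((ws[j := w])[l := christoffel_in_chart M c x v ((ws[j := w]) ! l)])))"
      proof (intro linear_compose_sub linear_compose_sum ballI)
        show "linear (\<lambda>w. frechet_derivative (\<lambda>y. tensor_in_chart M c (H i) y (ws[j := w])) (at x) v)"
          using linear_tensor_derivative[OF U H i c _ _ x] wj by simp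
        show "linear (\<lambda>w. T ((ws[j := w])[l := christoffel_in_chart M c x v ((ws[j := w]) ! l)]))" if l: "l \<in> {..<m}" for l
        \<comment> \<open>If \<open>l = j\<close> the varying entry passes through the Christoffel
          map; otherwise the two list updates commute.\<close>
        proof (cases "l = j")
          case True
          then show ?thesis
            using linear_compose[OF linear_christoffel_in_chart(2)[OF c xS] multilinearD[OF mT, of ws j]] wj
            by (simp add: comp_def)
        next
          case False
          then show ?thesis
            using multilinearD[OF mT, of "ws[l := christoffel_in_chart M c x v (ws ! l)]" j] wj
            by (simp add: list_update_swap[of j l])
        qed
      qed
      then show "linear (\<lambda>w. cov_deriv M (H i) p (v # ws[j := w]))" using wj by (simp add: eq)
    qed
  qed
qed

lemma equi_C_christoffel_term:
  assumes U: "open U" and H: "tensor_family U m r I H" and c: "c \<in> charts M" and ws: "length ws = m"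
  shows "equi_C r (snd c ` (fst c \<inter> U)) I
    (\<lambda>i x. \<Sum>j<m. tensor_in_chart M c (H i) x (ws[j := christoffel_in_chart M c x v (ws ! j)]))"
proof (intro equi_C_sum open_chart_image[OF c U])
  fix j assume j: "j \<in> {..<m}"
  show "equi_C r (snd c ` (fst c \<inter> U)) I (\<lambda>i x. tensor_in_chart M c (H i) x (ws[j := christoffel_in_chart M c x v (ws ! j)]))"
  proof (rule equi_C_onb[OF open_chart_image[OF c U]])
    show "linear (\<lambda>w. tensor_in_chart M c (H i) x (ws[j := w]))" if "i \<in> I" "x \<in> snd c ` (fst c \<inter> U)" for i x
      using multilinear_tensor_in_chart[OF c that(2) tensor_familyD(1)[OF H that(1)]] ws j by (intro multilinearD) auto
    show "equi_C r (snd c ` (fst c \<inter> U)) I (\<lambda>i x. tensor_in_chart M c (H i) x (ws[j := b]))" for b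
      using tensor_familyD(2)[OF H c] ws by simp
    show "equi_C r (snd c ` (fst c \<inter> U)) I (\<lambda>i x. christoffel_in_chart M c x v (ws ! j))"
      by (rule equi_C_subset[OF equi_C_christoffel_in_chart[OF c]]) auto
  qed
qed

lemma tensor_family_cov_deriv:
  assumes U: "open U" and H: "tensor_family U m (Suc r) I H"
  shows "tensor_family U (Suc m) r I (\<lambda>i. cov_deriv M (H i))"
  unfolding tensor_family_def
proof (intro conjI ballI allI impI)
  show "multilinear (Suc m) (cov_deriv M (H i) p)" if "i \<in> I" "p \<in> U" for i p
    using multilinear_cov_deriv[OF U H that] .
next
  fix c and vs :: "'e list" assume c: "c \<in> charts M" and vs: "length vs = Suc m"
  obtain v ws where vs: "vs = v # ws" "length ws = m" using vs by (cases vs) auto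
  note S = open_chart_image[OF c U]
  have "equi_C r (snd c ` (fst c \<inter> U)) I (\<lambda>i x. frechet_derivative (\<lambda>y. tensor_in_chart M c (H i) y ws) (at x) v
      - (\<Sum>j<m. tensor_in_chart M c (H i) x (ws[j := christoffel_in_chart M c x v (ws ! j)])))"
    using tensor_familyD(2)[OF H c vs(2)] tensor_family_mono[OF H, of r]
    by (intro equi_C_minus[OF S] equi_C_christoffel_term[OF U _ c vs(2)]) simp_all
  then show "equi_C r (snd c ` (fst c \<inter> U)) I (\<lambda>i x. tensor_in_chart M c (cov_deriv M (H i)) x vs)"
    by (rule equi_C_cong[OF S]) (simp add: vs cov_deriv_family_in_chart[OF U H _ c])
qed

lemma tensor_family_cov_deriv_iterate:
  assumes U: "open U"
  shows "tensor_family U k r I H \<Longrightarrow> j \<le> r \<Longrightarrow> tensor_family U (j + k) (r - j) I (\<lambda>i. (cov_deriv M ^^ j) (H i))"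
proof (induction j)
  case (Suc j)
  then have "tensor_family U (j + k) (Suc (r - Suc j)) I (\<lambda>i. (cov_deriv M ^^ j) (H i))"
    by (simp add: Suc_diff_Suc)
  from tensor_family_cov_deriv[OF U this] show ?case by simp
qed simp

text \<open>In a chart, a partial derivative of \<open>\<nabla>\<^sup>j H\<close> differs from a component of \<open>\<nabla>\<^sup>j\<^sup>+\<^sup>1 H\<close> by terms of lower
  order, so that bounds on the iterated covariant derivatives control all partial derivatives.\<close>

lemma tensor_family_of_bounds:
  assumes U: "open U" and ind: "\<And>i. i \<in> I \<Longrightarrow> tensor_family U k r {i} H"
    and zero: "\<And>j. j \<le> r \<Longrightarrow> tensor_family U (j + k) 0 I (\<lambda>i. (cov_deriv M ^^ j) (H i))"
  shows "j + m \<le> r \<Longrightarrow> tensor_family U (j + k) m I (\<lambda>i. (cov_deriv M ^^ j) (H i))"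
proof (induction m arbitrary: j)
  case 0
  then show ?case using zero by simp
next
  case (Suc m)
  define T where "T = (\<lambda>i. (cov_deriv M ^^ j) (H i))"
  \<comment> \<open>Differentiability of each single field is known from \<open>ind\<close>; the
    induction only has to supply bounds that are uniform over \<open>I\<close>.\<close>
  have T1: "tensor_family U (j + k) (Suc 0) {i} T" if "i \<in> I" for i
    unfolding T_def using Suc.prems
    by (intro tensor_family_mono[OF tensor_family_cov_deriv_iterate[OF U ind[OF that]]]) auto
  have Tm: "tensor_family U (j + k) m I T" "tensor_family U (Suc (j + k)) m I (\<lambda>i. cov_deriv M (T i))"
    using Suc.IH[of j] Suc.IH[of "Suc j"] Suc.prems by (simp_all add: T_def)
  show ?case
    unfolding tensor_family_def T_def[symmetric] T_def[symmetric, THEN fun_cong]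
  proof (intro conjI ballI allI impI)
    show "multilinear (j + k) (T i p)" if "i \<in> I" "p \<in> U" for i p
      using tensor_familyD(1)[OF Tm(1)] that .
  next
    fix c and ws :: "'e list" assume c: "c \<in> charts M" and ws: "length ws = j + k"
    note S = open_chart_image[OF c U]
    show "equi_C (Suc m) (snd c ` (fst c \<inter> U)) I (\<lambda>i x. tensor_in_chart M c (T i) x ws)"
    proof (rule equi_C_SucI[OF S])
      show "equi_bounded (snd c ` (fst c \<inter> U)) I (\<lambda>i x. tensor_in_chart M c (T i) x ws)"
        using tensor_familyD(2)[OF Tm(1) c ws] by (rule equi_C_bounded)
      show "((\<lambda>x. tensor_in_chart M c (T i) x ws) has_derivative
          (\<lambda>v. frechet_derivative (\<lambda>x. tensor_in_chart M c (T i) x ws) (at x) v)) (at x)"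
        if "i \<in> I" "x \<in> snd c ` (fst c \<inter> U)" for i x
        using tensor_family_differentiable[OF T1[OF that(1)] _ c ws that(2)] by (intro has_derivative_frechet) simp
      fix v
      have "equi_C m (snd c ` (fst c \<inter> U)) I (\<lambda>i x. tensor_in_chart M c (cov_deriv M (T i)) x (v # ws) +
          (\<Sum>l<j + k. tensor_in_chart M c (T i) x (ws[l := christoffel_in_chart M c x v (ws ! l)])))"
        using tensor_familyD(2)[OF Tm(2) c] ws
        by (intro equi_C_add[OF S] equi_C_christoffel_term[OF U Tm(1) c]) simp_all
      then show "equi_C m (snd c ` (fst c \<inter> U)) I (\<lambda>i x. frechet_derivative (\<lambda>x. tensor_in_chart M c (T i) x ws) (at x) v)"
        by (rule equi_C_cong[OF S]) (simp add: cov_deriv_family_in_chart[OF U T1 _ c ws])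
    qed
  qed
qed

section \<open>Norms of tensors and forms\<close>

text \<open>A supremum dominates its members only if the set is bounded above: coercivity places the
  unit ball of the metric inside a norm ball, on which a multilinear function is bounded.\<close>

lemma tensor_norm_upper:
  assumes "multilinear m \<tau>" "length vs = m" "\<forall>v\<in>set vs. rmetric M p v v \<le> 1"
  shows "\<bar>\<tau> vs\<bar> \<le> tensor_norm M p m \<tau>"
proof -
  obtain c where c: "0 < c" "\<And>v. c * (norm v)\<^sup>2 \<le> rmetric M p v v"
    using coercive[of "rmetric M p"] rmetric by metis
  \<comment> \<open>The radius \<open>1 + 1 / c\<close> exceeds the exact one, the square root of
    \<open>1 / c\<close>, and keeps the argument free of roots.\<close>
  have R: "norm v \<le> 1 + 1 / c" if "rmetric M p v v \<le> 1" for v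
  proof (rule ccontr)
    assume "\<not> ?thesis"
    then have v: "norm v > 1 + 1 / c" by simp
    moreover have "0 < 1 / c" using c(1) by simp
    ultimately have "1 \<le> norm v" by linarith
    then have "norm v * 1 \<le> norm v * norm v" by (intro mult_left_mono) auto
    then have "c * norm v \<le> c * (norm v)\<^sup>2" using c(1) by (simp add: power2_eq_square)
    then have "c * norm v \<le> 1" using c(2)[of v] that by linarith
    then have "norm v \<le> 1 / c" using c(1) by (simp add: field_simps)
    then show False using v by simp
  qed
  obtain K where K: "\<And>vs. length vs = m \<Longrightarrow> (\<forall>v\<in>set vs. norm v \<le> 1 + 1 / c) \<Longrightarrow> \<bar>\<tau> vs\<bar> \<le> K"
    using multilinear_bounded[OF assms(1), of "1 + 1 / c"] by blast
  have "bdd_above ((\<lambda>vs. \<bar>\<tau> vs\<bar>) ` {vs. length vs = m \<and> (\<forall>v\<in>set vs. rmetric M p v v \<le> 1)})"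
    by (rule bdd_aboveI2[of _ _ K]) (use K R in blast)
  then show ?thesis unfolding tensor_norm_def using assms by (intro cSUP_upper) auto
qed

lemma tensor_norm_le:
  assumes "\<And>vs. length vs = m \<Longrightarrow> (\<forall>v\<in>set vs. rmetric M p v v \<le> 1) \<Longrightarrow> \<bar>\<tau> vs\<bar> \<le> B"
  shows "tensor_norm M p m \<tau> \<le> B"
  unfolding tensor_norm_def
proof (rule cSUP_least)
  have "replicate m 0 \<in> {vs. length vs = m \<and> (\<forall>v\<in>set vs. rmetric M p v v \<le> 1)}"
    using bilinear_lzero[OF rmetric(1)] by simp
  then show "{vs. length vs = m \<and> (\<forall>v\<in>set vs. rmetric M p v v \<le> 1)} \<noteq> {}" by blast
qed (use assms in auto)

text \<open>Brings arbitrary vectors into the unit ball of the metric, where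
  \<open>tensor_norm\<close> controls values; multilinearity then restores the scale.\<close>

lemma ex_unit_scale:
  shows "\<exists>s>0. \<forall>v\<in>set vs. rmetric M p (s *\<^sub>R v) (s *\<^sub>R v) \<le> 1"
proof -
  define L where "L = (\<Sum>v\<in>set vs. rmetric M p v v)"
  have nn: "0 \<le> rmetric M p v v" for v
    using rmetric(3)[of v p] bilinear_lzero[OF rmetric(1)[of p], of 0] by (cases "v = 0") auto
  have L: "rmetric M p v v \<le> L" if "v \<in> set vs" for v
    unfolding L_def using that nn by (intro member_le_sum) auto
  have L0: "0 \<le> L" unfolding L_def using nn by (intro sum_nonneg)
  show ?thesis
  proof (intro exI[of _ "1 / (1 + L)"] conjI ballI)
    fix v assume "v \<in> set vs"
    then have "rmetric M p v v \<le> (1 + L) * (1 + L)" using L L0 by (intro order_trans[OF L]) (auto simp: algebra_simps)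
    then show "rmetric M p ((1 / (1 + L)) *\<^sub>R v) ((1 / (1 + L)) *\<^sub>R v) \<le> 1"
      using L0 bilinear_lmul[OF rmetric(1)] bilinear_rmul[OF rmetric(1)] by (simp add: divide_simps)
  qed (use L0 in simp)
qed

text \<open>Metric coefficients are locally bounded, so near \<open>x\<close> the fixed coordinate
  vectors, shrunk by one factor \<open>s\<close>, lie in the metric unit ball at every point. The
  intrinsic bound \<open>B\<close> thus becomes the local chart bound \<open>B / s ^ m\<close>, for
  all indices at once.\<close>

lemma tensor_family_0_of_bounds:
  assumes U: "open U" and mult: "\<And>i p. i \<in> I \<Longrightarrow> p \<in> U \<Longrightarrow> multilinear m (T i p)"
    and bound: "\<And>i p. i \<in> I \<Longrightarrow> p \<in> U \<Longrightarrow> tensor_norm M p m (T i p) \<le> B"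
  shows "tensor_family U m 0 I T"
  unfolding tensor_family_def equi_C.simps
proof (intro conjI ballI allI impI mult)
  fix c and vs :: "'e list" assume c: "c \<in> charts M" and vs: "length vs = m"
  note S = open_chart_image[OF c U]
  show "equi_bounded (snd c ` (fst c \<inter> U)) I (\<lambda>i x. tensor_in_chart M c (T i) x vs)"
  proof (rule equi_boundedI)
    fix x assume x: "x \<in> snd c ` (fst c \<inter> U)"
    have "\<forall>v. \<exists>K. \<forall>\<^sub>F y in nhds x. \<forall>i\<in>{()}. norm (metric_in_chart M c y v v) \<le> K"
      using smooth_on_imp_equi_C[OF smooth_metric_in_chart[OF c] open_chart_range[OF c], of 0 "{()}"] x
      by (auto simp: equi_bounded_def)
    then obtain K where "\<And>v. \<forall>\<^sub>F y in nhds x. \<forall>i\<in>{()}. norm (metric_in_chart M c y v v) \<le> K v"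
      by (auto dest!: choice)
    then have ev: "\<forall>\<^sub>F y in nhds x. \<forall>v\<in>set vs. \<bar>metric_in_chart M c y v v\<bar> \<le> K v"
      by (intro eventually_ball_finite) auto
    define L where "L = (\<Sum>v\<in>set vs. \<bar>K v\<bar>)"
    define s where "s = 1 / (1 + L)"
    have L0: "0 \<le> L" unfolding L_def by (simp add: sum_nonneg)
    have L: "K v \<le> L" if "v \<in> set vs" for v
      using member_le_sum[OF that, of "\<lambda>v. \<bar>K v\<bar>"] by (simp add: L_def)
    have s: "s > 0" using L0 by (simp add: s_def)
    have "\<forall>\<^sub>F y in nhds x. y \<in> snd c ` (fst c \<inter> U)" using S x by (rule eventually_nhds_in_open)
    with ev have "\<forall>\<^sub>F y in nhds x. \<forall>i\<in>I. norm (tensor_in_chart M c (T i) y vs) \<le> B / s ^ m"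
    proof eventually_elim
      case (elim y)
      then have yS: "y \<in> snd c ` fst c" and p: "chart_inv c y \<in> U" using c by auto
      show ?case
      proof
        fix i assume i: "i \<in> I"
        have "\<bar>tensor_in_chart M c (T i) y (map (\<lambda>v. s *\<^sub>R v) vs)\<bar> \<le> tensor_norm M (chart_inv c y) m (T i (chart_inv c y))"
          unfolding tensor_in_chart_def
        proof (rule tensor_norm_upper[OF mult[OF i p]])
          have "rmetric M (chart_inv c y) (to_tangent M c y (s *\<^sub>R v)) (to_tangent M c y (s *\<^sub>R v)) \<le> 1"
            if v: "v \<in> set vs" for v
          proof -
            have "metric_in_chart M c y v v \<le> (1 + L) * (1 + L)"
            proof -
              have "metric_in_chart M c y v v \<le> K v" using elim(1) v by (auto simp: abs_le_iff)
              also have "\<dots> \<le> 1 * L" using L[OF v] by simp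
              also have "\<dots> \<le> (1 + L) * (1 + L)" using L0 by (intro mult_mono) auto
              finally show ?thesis .
            qed
            then have "metric_in_chart M c y (s *\<^sub>R v) (s *\<^sub>R v) \<le> 1"
              using L0 bilinear_lmul[OF bilinear_metric_in_chart[OF c yS]] bilinear_rmul[OF bilinear_metric_in_chart[OF c yS]]
              by (simp add: divide_simps s_def)
            then show ?thesis by (simp add: metric_in_chart_def)
          qed
          then show "\<forall>v\<in>set (map (to_tangent M c y) (map ((*\<^sub>R) s) vs)). rmetric M (chart_inv c y) v v \<le> 1" by auto
        qed (simp add: vs)
        also have "\<dots> \<le> B" using bound[OF i p] .
        finally show "norm (tensor_in_chart M c (T i) y vs) \<le> B / s ^ m"
          using multilinear_scale_all[OF multilinear_tensor_in_chart[OF c elim(2) mult[OF i]] vs, where s = s] s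
          by (simp add: abs_mult field_simps)
      qed
    qed
    then show "\<exists>K. \<forall>\<^sub>F y in nhds x. \<forall>i\<in>I. norm (tensor_in_chart M c (T i) y vs) \<le> K" by blast
  qed
qed

end

section \<open>The spaces of forms\<close>

context riemannian
begin

lemma k_covectors_multilinear: "\<eta> \<in> k_covectors k \<Longrightarrow> multilinear k \<eta>"
  by (simp add: k_covectors_def multilinear_def)

lemma C_forms_tensor_family:
  assumes "open U" "\<omega> \<in> C_forms M U k r"
  shows "tensor_family U k r I (\<lambda>_. \<omega>)"
  using assms unfolding tensor_family_def C_forms_def
  by (auto intro!: k_covectors_multilinear C_on_imp_equi_C open_chart_image)

lemma multilinear_cov_deriv_iterate:
  assumes "open U" "\<omega> \<in> C_forms M U k r" "j \<le> r" "p \<in> U"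
  shows "multilinear (j + k) ((cov_deriv M ^^ j) \<omega> p)"
  using tensor_familyD(1)[OF tensor_family_cov_deriv_iterate[OF assms(1) C_forms_tensor_family[OF assms(1,2), of "{()}"] assms(3)]]
    assms(4) by simp

text \<open>The equation for \<open>T''\<close> is asked for only on \<open>U\<close> and on lists
  of the right length, which is all that an induction over iterated derivatives can provide;
  openness of \<open>U\<close> makes it enough for a derivative.\<close>

lemma cov_deriv_lincomb:
  assumes U: "open U" and H: "tensor_family U m (Suc r) {()} (\<lambda>_. T)" "tensor_family U m (Suc r) {()} (\<lambda>_. T')"
    and eq: "\<And>p vs. p \<in> U \<Longrightarrow> length vs = m \<Longrightarrow> T'' p vs = a * T p vs + b * T' p vs"
    and p: "p \<in> U" and ws: "length ws = Suc m"
  shows "cov_deriv M T'' p ws = a * cov_deriv M T p ws + b * cov_deriv M T' p ws"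
proof -
  obtain v vs where vs: "ws = v # vs" "length vs = m" using ws by (cases ws) auto
  define c where "c = chart_at M p"
  define x where "x = snd c p"
  have c: "c \<in> charts M" and x: "x \<in> snd c ` (fst c \<inter> U)" using chart_at p by (auto simp: c_def x_def)
  note S = open_chart_image[OF c U]
  have D: "((\<lambda>y. tensor_in_chart M c Q y vs) has_derivative frechet_derivative (\<lambda>y. tensor_in_chart M c Q y vs) (at x)) (at x)"
    if "tensor_family U m (Suc r) {()} (\<lambda>_. Q)" for Q
    using tensor_family_differentiable[OF that _ c vs(2) x] by (intro has_derivative_frechet) auto
  have "((\<lambda>y. a * tensor_in_chart M c T y vs + b * tensor_in_chart M c T' y vs) has_derivative
      (\<lambda>v. a * frechet_derivative (\<lambda>y. tensor_in_chart M c T y vs) (at x) v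
        + b * frechet_derivative (\<lambda>y. tensor_in_chart M c T' y vs) (at x) v)) (at x)"
    by (intro has_derivative_add has_derivative_mult_right D H)
  then have "((\<lambda>y. tensor_in_chart M c T'' y vs) has_derivative
      (\<lambda>v. a * frechet_derivative (\<lambda>y. tensor_in_chart M c T y vs) (at x) v
        + b * frechet_derivative (\<lambda>y. tensor_in_chart M c T' y vs) (at x) v)) (at x)"
    by (rule has_derivative_transform_within_open[OF _ S x]) (use c vs in \<open>auto simp: tensor_in_chart_def eq\<close>)
  note E = frechet_derivative_eqI[OF this]
  show ?thesis
    unfolding cov_deriv_def vs(1) list.case Let_def c_def[symmetric] x_def[symmetric] E
    by (simp add: vs eq[OF p] sum.distrib sum_distrib_left right_diff_distrib)
qed

lemma cov_deriv_iterate_lincomb: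
  assumes U: "open U" and w: "\<omega> \<in> C_forms M U k r" "\<eta> \<in> C_forms M U k r"
    and eq: "\<And>p vs. p \<in> U \<Longrightarrow> length vs = k \<Longrightarrow> \<theta> p vs = a * \<omega> p vs + b * \<eta> p vs"
  shows "j \<le> r \<Longrightarrow> p \<in> U \<Longrightarrow> length vs = j + k \<Longrightarrow>
    (cov_deriv M ^^ j) \<theta> p vs = a * (cov_deriv M ^^ j) \<omega> p vs + b * (cov_deriv M ^^ j) \<eta> p vs"
proof (induction j arbitrary: p vs)
  case 0
  then show ?case using eq by simp
next
  case (Suc j)
  have F: "tensor_family U (j + k) (Suc 0) {()} (\<lambda>_. (cov_deriv M ^^ j) \<zeta>)" if "\<zeta> \<in> C_forms M U k r" for \<zeta>
    using Suc.prems
    by (intro tensor_family_mono[OF tensor_family_cov_deriv_iterate[OF U C_forms_tensor_family[OF U that]]]) auto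
  show ?case
    unfolding funpow.simps comp_def
    by (rule cov_deriv_lincomb[OF U F[OF w(1)] F[OF w(2)] Suc.IH]) (use Suc.prems in auto)
qed

lemma k_covectors_lincomb:
  assumes "\<eta> \<in> k_covectors k" "\<theta> \<in> k_covectors k"
  shows "(\<lambda>vs. a * \<eta> vs + b * \<theta> vs) \<in> k_covectors k"
  using assms unfolding k_covectors_def
  by (auto simp: linear_iff algebra_simps)

lemma C_forms_lincomb:
  assumes U: "open U" and w: "\<omega> \<in> C_forms M U k r" "\<eta> \<in> C_forms M U k r"
  shows "(\<lambda>p vs. a * \<omega> p vs + b * \<eta> p vs) \<in> C_forms M U k r"
  using assms unfolding C_forms_def
  by (auto intro!: k_covectors_lincomb C_on_lincomb open_chart_image simp: tensor_in_chart_def fun_eq_iff)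

lemma C_forms_zero: "0 \<in> C_forms M U k r"
proof -
  have "(0 :: 'e list \<Rightarrow> real) \<in> k_covectors k" by (simp add: k_covectors_def linear_iff)
  then show ?thesis by (simp add: C_forms_def tensor_in_chart_def C_on_zero)
qed

lemma tensor_norm_le_C_norm:
  assumes "\<omega> \<in> B_forms M U k r" "p \<in> U" "j \<le> r"
  shows "tensor_norm M p (j + k) ((cov_deriv M ^^ j) \<omega> p) \<le> C_norm M U k r \<omega>"
  unfolding C_norm_def using assms
  by (intro cSup_upper) (auto simp: B_forms_def deriv_norms_def)

lemma C_norm_le:
  assumes "0 \<le> B" "\<And>p j. p \<in> U \<Longrightarrow> j \<le> r \<Longrightarrow> tensor_norm M p (j + k) ((cov_deriv M ^^ j) \<omega> p) \<le> B"
  shows "C_norm M U k r \<omega> \<le> B"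
  unfolding C_norm_def using assms by (intro cSup_least) (auto simp: deriv_norms_def)

lemma C_norm_nonneg:
  assumes "\<omega> \<in> B_forms M U k r"
  shows "0 \<le> C_norm M U k r \<omega>"
  unfolding C_norm_def using assms by (intro cSup_upper) (auto simp: B_forms_def)

lemma form_value_le_C_norm:
  assumes U: "open U" and w: "\<omega> \<in> B_forms M U k r" and p: "p \<in> U" and j: "j \<le> r"
    and vs: "length vs = j + k" "\<forall>v\<in>set vs. rmetric M p v v \<le> 1"
  shows "\<bar>(cov_deriv M ^^ j) \<omega> p vs\<bar> \<le> C_norm M U k r \<omega>"
proof -
  have "multilinear (j + k) ((cov_deriv M ^^ j) \<omega> p)"
    using w j p by (intro multilinear_cov_deriv_iterate[OF U, of _ k r]) (auto simp: B_forms_def)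
  from tensor_norm_upper[OF this vs] tensor_norm_le_C_norm[OF w p j] show ?thesis by simp
qed

lemma B_forms_lincomb:
  fixes a b :: real
  assumes U: "open U" and w: "\<omega> \<in> B_forms M U k r" "\<eta> \<in> B_forms M U k r"
  defines "\<theta> \<equiv> (\<lambda>p vs. a * \<omega> p vs + b * \<eta> p vs)"
  shows "\<theta> \<in> B_forms M U k r"
    "C_norm M U k r \<theta> \<le> \<bar>a\<bar> * C_norm M U k r \<omega> + \<bar>b\<bar> * C_norm M U k r \<eta>"
proof -
  have wC: "\<omega> \<in> C_forms M U k r" "\<eta> \<in> C_forms M U k r" using w by (auto simp: B_forms_def)
  have bound: "tensor_norm M p (j + k) ((cov_deriv M ^^ j) \<theta> p) \<le> \<bar>a\<bar> * C_norm M U k r \<omega> + \<bar>b\<bar> * C_norm M U k r \<eta>"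
    if p: "p \<in> U" and j: "j \<le> r" for p j
  proof (rule tensor_norm_le)
    fix vs :: "'e list" assume vs: "length vs = j + k" "\<forall>v\<in>set vs. rmetric M p v v \<le> 1"
    have "(cov_deriv M ^^ j) \<theta> p vs = a * (cov_deriv M ^^ j) \<omega> p vs + b * (cov_deriv M ^^ j) \<eta> p vs"
      by (rule cov_deriv_iterate_lincomb[OF U wC _ j p vs(1)]) (simp add: \<theta>_def)
    also have "\<bar>\<dots>\<bar> \<le> \<bar>a\<bar> * \<bar>(cov_deriv M ^^ j) \<omega> p vs\<bar> + \<bar>b\<bar> * \<bar>(cov_deriv M ^^ j) \<eta> p vs\<bar>"
      by (simp add: abs_mult[symmetric] abs_triangle_ineq)
    also have "\<dots> \<le> \<bar>a\<bar> * C_norm M U k r \<omega> + \<bar>b\<bar> * C_norm M U k r \<eta>"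
      by (intro add_mono mult_left_mono form_value_le_C_norm[OF U _ p j vs] w) auto
    finally show "\<bar>(cov_deriv M ^^ j) \<theta> p vs\<bar> \<le> \<bar>a\<bar> * C_norm M U k r \<omega> + \<bar>b\<bar> * C_norm M U k r \<eta>" .
  qed
  show "\<theta> \<in> B_forms M U k r"
    unfolding B_forms_def using C_forms_lincomb[OF U wC] bound
    by (auto simp: \<theta>_def deriv_norms_def intro!: bdd_aboveI[of _ "\<bar>a\<bar> * C_norm M U k r \<omega> + \<bar>b\<bar> * C_norm M U k r \<eta>"])
  show "C_norm M U k r \<theta> \<le> \<bar>a\<bar> * C_norm M U k r \<omega> + \<bar>b\<bar> * C_norm M U k r \<eta>"
    using bound w by (intro C_norm_le add_nonneg_nonneg mult_nonneg_nonneg C_norm_nonneg) auto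
qed

lemma B_forms_zero:
  assumes U: "open U"
  shows "0 \<in> B_forms M U k r" "C_norm M U k r 0 = 0"
proof -
  have bound: "tensor_norm M p (j + k) ((cov_deriv M ^^ j) 0 p) \<le> 0" if p: "p \<in> U" and j: "j \<le> r" for p j
  proof (rule tensor_norm_le)
    fix vs :: "'e list" assume vs: "length vs = j + k"
    \<comment> \<open>The zero form is written as a combination with zero coefficients, so that
      linearity of the iterates applies to it.\<close>
    have "(cov_deriv M ^^ j) 0 p vs = 0 * (cov_deriv M ^^ j) 0 p vs + 0 * (cov_deriv M ^^ j) 0 p vs"
      by (rule cov_deriv_iterate_lincomb[OF U C_forms_zero C_forms_zero _ j p vs]) simp
    then show "\<bar>(cov_deriv M ^^ j) 0 p vs\<bar> \<le> 0" by simp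
  qed
  show Z: "0 \<in> B_forms M U k r"
    using C_forms_zero bound by (auto simp: B_forms_def deriv_norms_def intro!: bdd_aboveI[of _ 0])
  show "C_norm M U k r 0 = 0"
    using bound C_norm_nonneg[OF Z] by (intro antisym C_norm_le) auto
qed

lemma subspace_B_forms:
  assumes U: "open U"
  shows "subspace (B_forms M U k r)"
proof (rule subspaceI)
  show "0 \<in> B_forms M U k r" by (rule B_forms_zero[OF U])
  show "\<omega> + \<eta> \<in> B_forms M U k r" if "\<omega> \<in> B_forms M U k r" "\<eta> \<in> B_forms M U k r" for \<omega> \<eta>
    using B_forms_lincomb(1)[OF U that, of 1 1] by (simp add: plus_fun_def)
  show "c *\<^sub>R \<omega> \<in> B_forms M U k r" if "\<omega> \<in> B_forms M U k r" for c \<omega>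
    using B_forms_lincomb(1)[OF U that that, of c 0] by (simp add: scaleR_fun_def)
qed

lemma seminorm_on_C_norm:
  assumes U: "open U"
  shows "seminorm_on (B_forms M U k r) (C_norm M U k r)"
proof (rule seminorm_onI)
  show "subspace (B_forms M U k r)" by (rule subspace_B_forms[OF U])
  show "C_norm M U k r 0 = 0" by (rule B_forms_zero(2)[OF U])
  show "C_norm M U k r (\<omega> + \<eta>) \<le> C_norm M U k r \<omega> + C_norm M U k r \<eta>"
    if "\<omega> \<in> B_forms M U k r" "\<eta> \<in> B_forms M U k r" for \<omega> \<eta>
    using B_forms_lincomb(2)[OF U that, of 1 1] by (simp add: plus_fun_def)
  show "C_norm M U k r (c *\<^sub>R \<omega>) \<le> \<bar>c\<bar> * C_norm M U k r \<omega>" if "\<omega> \<in> B_forms M U k r" for c \<omega>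
    using B_forms_lincomb(2)[OF U that that, of c 0] by (simp add: scaleR_fun_def)
qed

lemmas C_norm_scaleR = seminorm_onD(3)[OF seminorm_on_C_norm]

lemma C_norm_mono:
  assumes "\<omega> \<in> B_forms M U k s" "r \<le> s"
  shows "C_norm M U k r \<omega> \<le> C_norm M U k s \<omega>"
  using assms tensor_norm_le_C_norm[OF assms(1)] by (intro C_norm_le C_norm_nonneg) auto

lemma B_formsD: "\<omega> \<in> B_forms M U k r \<Longrightarrow> p \<in> U \<Longrightarrow> \<omega> p \<in> k_covectors k"
  "\<omega> \<in> B_forms M U k r \<Longrightarrow> p \<notin> U \<Longrightarrow> \<omega> p = 0"
  by (auto simp: B_forms_def C_forms_def)

end

section \<open>Pointed chains\<close>

text \<open>The pointed chain concentrated at \<open>p\<close> whose k-vector is the wedge product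
  of the list. Integrating a form over it evaluates the form, so the values of a functional on these
  chains determine the candidate form.\<close>

definition point_chain :: "'m \<Rightarrow> 'e::real_vector list \<Rightarrow> 'm \<Rightarrow> ('e list \<Rightarrow> real) \<Rightarrow> real"
  where "point_chain p vs = (\<lambda>q. if q = p then wedge vs else 0)"

lemma subspace_pointed_chains: "subspace (pointed_chains U k)"
proof (rule subspaceI)
  show "0 \<in> pointed_chains U k" by (simp add: pointed_chains_def exterior_power_def span_zero)
next
  fix A B :: "'a \<Rightarrow> ('b list \<Rightarrow> real) \<Rightarrow> real"
  assume AB: "A \<in> pointed_chains U k" "B \<in> pointed_chains U k"
  have "{p. (A + B) p \<noteq> 0} \<subseteq> {p. A p \<noteq> 0} \<union> {p. B p \<noteq> 0}" by auto
  moreover have "finite ({p. A p \<noteq> 0} \<union> {p. B p \<noteq> 0})" "{p. A p \<noteq> 0} \<union> {p. B p \<noteq> 0} \<subseteq> U"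
    using AB by (simp_all add: pointed_chains_def)
  moreover have "(A + B) p \<in> exterior_power k" for p
    using AB by (simp add: pointed_chains_def exterior_power_def span_add)
  ultimately show "A + B \<in> pointed_chains U k"
    unfolding pointed_chains_def by (blast intro: finite_subset)
next
  fix A :: "'a \<Rightarrow> ('b list \<Rightarrow> real) \<Rightarrow> real" and c
  assume A: "A \<in> pointed_chains U k"
  have sc: "(c *\<^sub>R A) p = c *\<^sub>R A p" for p by (simp add: scaleR_fun_def)
  have "{p. (c *\<^sub>R A) p \<noteq> 0} \<subseteq> {p. A p \<noteq> 0}" by (auto simp: sc)
  moreover have "finite {p. A p \<noteq> 0}" "{p. A p \<noteq> 0} \<subseteq> U"
    using A by (simp_all add: pointed_chains_def)
  moreover have "(c *\<^sub>R A) p \<in> exterior_power k" for p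
    using A by (simp add: pointed_chains_def exterior_power_def span_scale sc)
  ultimately show "c *\<^sub>R A \<in> pointed_chains U k"
    unfolding pointed_chains_def by (blast intro: finite_subset)
qed

lemma chain_integral_superset:
  assumes "finite S" "{p. A p \<noteq> 0} \<subseteq> S"
  shows "chain_integral A \<omega> = (\<Sum>p\<in>S. A p (\<omega> p))"
  unfolding chain_integral_def using assms by (intro sum.mono_neutral_left) auto

lemma chain_integral_add:
  assumes "A \<in> pointed_chains U k" "B \<in> pointed_chains U k"
  shows "chain_integral (A + B) \<omega> = chain_integral A \<omega> + chain_integral B \<omega>"
proof -
  let ?S = "{p. A p \<noteq> 0} \<union> {p. B p \<noteq> 0}"
  have S: "finite ?S" using assms by (simp add: pointed_chains_def)
  show ?thesis
    by (subst (1 2 3) chain_integral_superset[OF S]) (auto simp: sum.distrib)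
qed

lemma chain_integral_scaleR:
  assumes "A \<in> pointed_chains U k"
  shows "chain_integral (c *\<^sub>R A) \<omega> = c * chain_integral A \<omega>"
proof -
  let ?S = "{p. A p \<noteq> 0}"
  have S: "finite ?S" using assms by (simp add: pointed_chains_def)
  show ?thesis
    by (subst (1 2) chain_integral_superset[OF S]) (auto simp: sum_distrib_left scaleR_fun_def)
qed

lemma point_chain_mem: "p \<in> U \<Longrightarrow> length vs = k \<Longrightarrow> point_chain p vs \<in> pointed_chains U k"
  by (auto simp: pointed_chains_def point_chain_def exterior_power_def span_zero intro!: span_base
    intro: finite_subset[of _ "{p}"])

lemma chain_integral_point_chain:
  assumes "\<omega> p \<in> k_covectors (length vs)"
  shows "chain_integral (point_chain p vs) \<omega> = \<omega> p vs"
  by (subst chain_integral_superset[of "{p}"]) (auto simp: point_chain_def wedge_def assms)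

text \<open>\<open>ev\<close> maps \<open>P\<close> into the bounded functions on \<open>I\<close>,
  and \<open>dom\<close> says that \<open>f\<close> is dominated by the sup norm of the image.
  Hahn-Banach then extends it to all bounded functions with norm at most 1, even when
  \<open>ev\<close> has a kernel.\<close>

lemma mean_functional_representation:
  fixes ev :: "'a::real_vector \<Rightarrow> 'i \<Rightarrow> real"
  assumes P: "subspace P" and f: "linear_on P f" and I: "I \<noteq> {}"
    and add: "\<And>A B i. A \<in> P \<Longrightarrow> B \<in> P \<Longrightarrow> i \<in> I \<Longrightarrow> ev (A + B) i = ev A i + ev B i"
    and scale: "\<And>A c i. A \<in> P \<Longrightarrow> i \<in> I \<Longrightarrow> ev (c *\<^sub>R A) i = c * ev A i"
    and bdd: "\<And>A. A \<in> P \<Longrightarrow> bounded_fun I (ev A)"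
    and dom: "\<And>A B. A \<in> P \<Longrightarrow> 0 \<le> B \<Longrightarrow> (\<And>i. i \<in> I \<Longrightarrow> \<bar>ev A i\<bar> \<le> B) \<Longrightarrow> f A \<le> B"
  obtains \<Lambda> where "mean_functional I \<Lambda>" "\<And>A. A \<in> P \<Longrightarrow> \<Lambda> (ev A) = f A"
proof -
  define V where "V = {\<phi>. bounded_fun I \<phi>}"
  define q where "q = (\<lambda>\<phi>. SUP i\<in>I. \<bar>\<phi> i :: real\<bar>)"
  \<comment> \<open>Additivity of \<open>ev\<close> is known on \<open>I\<close> only; setting the
    values off \<open>I\<close> to 0 makes \<open>j\<close> linear as a map into functions.\<close>
  define j where "j = (\<lambda>A i. if i \<in> I then ev A i else 0)"
  have q_ge: "\<bar>\<phi> i\<bar> \<le> q \<phi>" if "bounded_fun I \<phi>" "i \<in> I" for \<phi> i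
    unfolding q_def using that by (intro cSUP_upper) (auto simp: bounded_fun_def bdd_above_def)
  have V: "subspace V"
  proof (rule subspaceI)
    show "0 \<in> V" by (simp add: V_def zero_fun_def bounded_fun_const)
    show "\<phi> + \<psi> \<in> V" if "\<phi> \<in> V" "\<psi> \<in> V" for \<phi> \<psi>
      using that bounded_fun_add by (simp add: V_def plus_fun_def)
    show "c *\<^sub>R \<phi> \<in> V" if "\<phi> \<in> V" for c \<phi>
      using that bounded_fun_scale by (simp add: V_def scaleR_fun_def)
  qed
  have jV: "j A \<in> V" if "A \<in> P" for A
    using bdd[OF that] by (auto simp: V_def j_def bounded_fun_def)
  have "\<exists>\<Lambda>. linear_on V \<Lambda> \<and> (\<forall>A\<in>P. \<Lambda> (j A) = f A) \<and> (\<forall>\<phi>\<in>V. \<bar>\<Lambda> \<phi>\<bar> \<le> q \<phi>) \<and> (\<forall>\<phi>. \<phi> \<notin> V \<longrightarrow> \<Lambda> \<phi> = 0)"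
  proof (rule dominated_extension[OF V P _ _ _ f])
    show "linear_on P j" by (auto simp: linear_on_def j_def fun_eq_iff add scale scaleR_fun_def)
    show "seminorm_on V q" unfolding q_def
      by (rule seminorm_on_SUP[OF V I]) (auto simp: linear_on_def scaleR_fun_def V_def bounded_fun_def bdd_above_def)
    show "f A \<le> q (j A)" if A: "A \<in> P" for A
    proof (rule dom[OF A])
      obtain i where "i \<in> I" using I by blast
      then show "0 \<le> q (j A)" using q_ge[of "j A" i] jV[OF A] by (simp add: V_def)
      show "\<bar>ev A i\<bar> \<le> q (j A)" if "i \<in> I" for i
        using q_ge[of "j A" i] jV[OF A] that by (simp add: V_def j_def)
    qed
  qed (use jV in blast)
  then obtain \<Lambda> where \<Lambda>: "linear_on V \<Lambda>" "\<And>A. A \<in> P \<Longrightarrow> \<Lambda> (j A) = f A" "\<And>\<phi>. \<phi> \<in> V \<Longrightarrow> \<bar>\<Lambda> \<phi>\<bar> \<le> q \<phi>"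
    by blast
  interpret mean_functional I \<Lambda>
  proof
    show "\<Lambda> (\<lambda>i. \<phi> i + \<psi> i) = \<Lambda> \<phi> + \<Lambda> \<psi>" if "bounded_fun I \<phi>" "bounded_fun I \<psi>" for \<phi> \<psi>
      using \<Lambda>(1) that by (simp add: linear_on_def V_def plus_fun_def)
    show "\<Lambda> (\<lambda>i. c * \<phi> i) = c * \<Lambda> \<phi>" if "bounded_fun I \<phi>" for c \<phi>
      using \<Lambda>(1) that by (simp add: linear_on_def V_def scaleR_fun_def)
    show "\<bar>\<Lambda> \<phi>\<bar> \<le> B" if "\<And>i. i \<in> I \<Longrightarrow> \<bar>\<phi> i\<bar> \<le> B" for B \<phi>
    proof -
      have "\<phi> \<in> V" using that by (auto simp: V_def bounded_fun_def)
      moreover have "q \<phi> \<le> B" unfolding q_def using I that by (rule cSUP_least)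
      ultimately show ?thesis using \<Lambda>(3)[of \<phi>] by simp
    qed
  qed
  have "\<Lambda> (ev A) = f A" if "A \<in> P" for A
    using cong[OF bdd[OF that], of "j A"] \<Lambda>(2)[OF that] by (simp add: j_def)
  then show ?thesis by (rule that[OF mean_functional_axioms])
qed

section \<open>Functionals on pointed chains given by smooth forms\<close>

text \<open>Elements of the exterior power are functions of arbitrary list functions, and
  \<open>wedge\<close> is 0 off the covectors; hence linearity can be claimed only between
  covectors.\<close>

lemma exterior_power_linear:
  assumes "\<alpha> \<in> exterior_power k" "\<eta> \<in> k_covectors k" "\<theta> \<in> k_covectors k"
  shows "\<alpha> (\<lambda>vs. a * \<eta> vs + b * \<theta> vs) = a * \<alpha> \<eta> + b * \<alpha> \<theta>"
  using assms(1) unfolding exterior_power_def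
proof (induction rule: span_induct_alt)
  case base
  then show ?case by simp
next
  case (step c x y)
  then obtain vs where x: "x = wedge vs" "length vs = k" by auto
  have "(\<lambda>vs. a * \<eta> vs + b * \<theta> vs) \<in> k_covectors k"
    using assms unfolding k_covectors_def by (auto simp: linear_iff algebra_simps)
  then have "x (\<lambda>vs. a * \<eta> vs + b * \<theta> vs) = a * x \<eta> + b * x \<theta>"
    using assms by (simp add: x wedge_def)
  then show ?case using step.IH by (simp add: scaleR_fun_def algebra_simps)
qed

context riemannian
begin

lemma chain_integral_lincomb:
  assumes A: "A \<in> pointed_chains U k" and w: "\<omega> \<in> B_forms M U k r" "\<eta> \<in> B_forms M U k r"
  shows "chain_integral A (a *\<^sub>R \<omega> + b *\<^sub>R \<eta>) = a * chain_integral A \<omega> + b * chain_integral A \<eta>"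
proof -
  have "A p ((a *\<^sub>R \<omega> + b *\<^sub>R \<eta>) p) = a * A p (\<omega> p) + b * A p (\<eta> p)" if "A p \<noteq> 0" for p
  proof -
    have p: "p \<in> U" "A p \<in> exterior_power k" using A that by (auto simp: pointed_chains_def)
    have "(a *\<^sub>R \<omega> + b *\<^sub>R \<eta>) p = (\<lambda>vs. a * \<omega> p vs + b * \<eta> p vs)" by (simp add: scaleR_fun_def plus_fun_def)
    then show ?thesis using exterior_power_linear[OF p(2) B_formsD(1)[OF w(1) p(1)] B_formsD(1)[OF w(2) p(1)]] by simp
  qed
  then show ?thesis unfolding chain_integral_def by (simp add: sum.distrib sum_distrib_left)
qed

lemma exterior_power_bounded:
  assumes U: "open U" and p: "p \<in> U" and \<alpha>: "\<alpha> \<in> exterior_power k"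
  shows "\<exists>K\<ge>0. \<forall>\<omega>\<in>B_forms M U k r. \<bar>\<alpha> (\<omega> p)\<bar> \<le> K * C_norm M U k r \<omega>"
  using \<alpha> unfolding exterior_power_def
proof (induction rule: span_induct_alt)
  case base
  then show ?case by (intro exI[of _ 0]) simp
next
  case (step c x y)
  then obtain vs where x: "x = wedge vs" "length vs = k" by auto
  obtain K where K: "K \<ge> 0" "\<And>\<omega>. \<omega> \<in> B_forms M U k r \<Longrightarrow> \<bar>y (\<omega> p)\<bar> \<le> K * C_norm M U k r \<omega>" using step.IH by blast
  obtain s where s: "s > 0" "\<forall>v\<in>set vs. rmetric M p (s *\<^sub>R v) (s *\<^sub>R v) \<le> 1" using ex_unit_scale by blast
  have "\<bar>(c *\<^sub>R x + y) (\<omega> p)\<bar> \<le> (\<bar>c\<bar> / s ^ k + K) * C_norm M U k r \<omega>" if w: "\<omega> \<in> B_forms M U k r" for \<omega>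
  proof -
    note cov = B_formsD(1)[OF w p]
    have "s ^ k * \<bar>\<omega> p vs\<bar> = \<bar>\<omega> p (map (\<lambda>v. s *\<^sub>R v) vs)\<bar>"
      using multilinear_scale_all[OF k_covectors_multilinear[OF cov] x(2), of s] s by (simp add: abs_mult)
    also have "\<dots> \<le> C_norm M U k r \<omega>"
      using form_value_le_C_norm[OF U w p, of 0 "map (\<lambda>v. s *\<^sub>R v) vs"] x s by auto
    finally have "\<bar>x (\<omega> p)\<bar> \<le> C_norm M U k r \<omega> / s ^ k" using s cov by (simp add: x wedge_def field_simps)
    then have "\<bar>c\<bar> * \<bar>x (\<omega> p)\<bar> \<le> \<bar>c\<bar> * (C_norm M U k r \<omega> / s ^ k)" by (rule mult_left_mono) simp
    moreover have "\<bar>(c *\<^sub>R x + y) (\<omega> p)\<bar> \<le> \<bar>c\<bar> * \<bar>x (\<omega> p)\<bar> + \<bar>y (\<omega> p)\<bar>"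
      by (simp add: scaleR_fun_def abs_mult[symmetric] abs_triangle_ineq)
    ultimately show ?thesis using K(2)[OF w] by (simp add: distrib_right)
  qed
  then show ?case using K s by (intro exI[of _ "\<bar>c\<bar> / s ^ k + K"]) auto
qed

lemma chain_integral_bounded:
  assumes U: "open U" and A: "A \<in> pointed_chains U k"
  shows "\<exists>K\<ge>0. \<forall>\<omega>\<in>B_forms M U k r. \<bar>chain_integral A \<omega>\<bar> \<le> K * C_norm M U k r \<omega>"
proof -
  have fin: "finite {p. A p \<noteq> 0}" using A by (simp add: pointed_chains_def)
  have "\<forall>p. \<exists>K. A p \<noteq> 0 \<longrightarrow> K \<ge> 0 \<and> (\<forall>\<omega>\<in>B_forms M U k r. \<bar>A p (\<omega> p)\<bar> \<le> K * C_norm M U k r \<omega>)"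
    using exterior_power_bounded[OF U] A by (auto simp: pointed_chains_def)
  from choice[OF this] obtain K where K: "\<And>p. A p \<noteq> 0 \<Longrightarrow> K p \<ge> 0"
    "\<And>p \<omega>. A p \<noteq> 0 \<Longrightarrow> \<omega> \<in> B_forms M U k r \<Longrightarrow> \<bar>A p (\<omega> p)\<bar> \<le> K p * C_norm M U k r \<omega>" by blast
  have "\<bar>chain_integral A \<omega>\<bar> \<le> (\<Sum>p | A p \<noteq> 0. K p) * C_norm M U k r \<omega>" if "\<omega> \<in> B_forms M U k r" for \<omega>
    unfolding chain_integral_def sum_distrib_right
    using K(2)[OF _ that] by (intro order_trans[OF sum_abs] sum_mono) auto
  moreover have "(\<Sum>p | A p \<noteq> 0. K p) \<ge> 0" using K(1) by (intro sum_nonneg) auto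
  ultimately show ?thesis by blast
qed

text \<open>Without this bound the \<open>Sup\<close> in \<open>B_norm\<close> would be an
  unspecified value. It comes from estimating a chain at its finitely many points.\<close>

lemma B_norm_bdd_above:
  assumes U: "open U" and A: "A \<in> pointed_chains U k"
  shows "bdd_above (insert 0 {chain_integral A \<omega> / C_norm M U k r \<omega> | \<omega>. \<omega> \<in> B_forms M U k r \<and> \<omega> \<noteq> 0})"
proof -
  obtain K where K: "K \<ge> 0" "\<And>\<omega>. \<omega> \<in> B_forms M U k r \<Longrightarrow> \<bar>chain_integral A \<omega>\<bar> \<le> K * C_norm M U k r \<omega>"
    using chain_integral_bounded[OF U A] by blast
  have "chain_integral A \<omega> / C_norm M U k r \<omega> \<le> K" if "\<omega> \<in> B_forms M U k r" for \<omega>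
  \<comment> \<open>For norm 0 the quotient is 0 by the convention on division.\<close>
  proof (cases "C_norm M U k r \<omega> = 0")
    case False
    then have "0 < C_norm M U k r \<omega>" using C_norm_nonneg[OF that] by simp
    then show ?thesis using K(2)[OF that] by (simp add: divide_le_eq abs_le_iff)
  qed (use K in simp)
  then show ?thesis using K(1) by (intro bdd_aboveI[of _ K]) auto
qed

lemma chain_integral_le:
  assumes U: "open U" and A: "A \<in> pointed_chains U k" and w: "\<omega> \<in> B_forms M U k r"
  shows "\<bar>chain_integral A \<omega>\<bar> \<le> B_norm M U k r A * C_norm M U k r \<omega>"
proof -
  have le: "chain_integral A \<omega> \<le> B_norm M U k r A * C_norm M U k r \<omega>" if w: "\<omega> \<in> B_forms M U k r" for \<omega>
  proof (cases "C_norm M U k r \<omega> = 0")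
    case True
    \<comment> \<open>Quotients say nothing about forms of norm 0; for them the crude bound forces a
      zero integral.\<close>
    then show ?thesis using chain_integral_bounded[OF U A, of r] w by fastforce
  next
    case False
    then have pos: "0 < C_norm M U k r \<omega>" using C_norm_nonneg[OF w] by simp
    have "\<omega> \<noteq> 0" using False B_forms_zero(2)[OF U, of k r] by auto
    then have "chain_integral A \<omega> / C_norm M U k r \<omega> \<le> B_norm M U k r A"
      unfolding B_norm_def using w by (intro cSup_upper B_norm_bdd_above[OF U A]) auto
    then show ?thesis using pos by (simp add: divide_le_eq)
  qed
  have "(-1) *\<^sub>R \<omega> \<in> B_forms M U k r" using w subspace_scale[OF subspace_B_forms[OF U]] by blast
  from le[OF this] le[OF w] show ?thesis
    using chain_integral_lincomb[OF A w w, of "-1" 0] C_norm_scaleR[OF U w, of "-1"] by (simp add: abs_le_iff)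
qed

text \<open>Rescaling forms to norm exactly \<open>K\<close> compares \<open>K * B_norm\<close> with
  a supremum over the ball of radius \<open>K\<close>. This converts domination by
  \<open>B_norm\<close> into domination by a sup norm over forms.\<close>

lemma B_norm_le:
  assumes U: "open U" and A: "A \<in> pointed_chains U k" and K: "0 < K" "0 \<le> B"
    and le: "\<And>\<omega>. \<omega> \<in> B_forms M U k r \<Longrightarrow> C_norm M U k r \<omega> \<le> K \<Longrightarrow> \<bar>chain_integral A \<omega>\<bar> \<le> B"
  shows "K * B_norm M U k r A \<le> B"
proof -
  have "B_norm M U k r A \<le> B / K"
    unfolding B_norm_def
  proof (rule cSup_least)
    fix t assume "t \<in> insert 0 {chain_integral A \<omega> / C_norm M U k r \<omega> | \<omega>. \<omega> \<in> B_forms M U k r \<and> \<omega> \<noteq> 0}"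
    then consider "t = 0" | \<omega> where "t = chain_integral A \<omega> / C_norm M U k r \<omega>" "\<omega> \<in> B_forms M U k r" by auto
    then show "t \<le> B / K"
    proof cases
      case (2 \<omega>)
      show ?thesis
      proof (cases "C_norm M U k r \<omega> = 0")
        case False
        then have pos: "0 < C_norm M U k r \<omega>" using C_norm_nonneg[OF 2(2)] by simp
        let ?c = "K / C_norm M U k r \<omega>"
        have "\<bar>chain_integral A (?c *\<^sub>R \<omega>)\<bar> \<le> B"
          using 2 pos K subspace_scale[OF subspace_B_forms[OF U]] by (intro le) (auto simp: C_norm_scaleR[OF U])
        moreover have "chain_integral A (?c *\<^sub>R \<omega>) = ?c * chain_integral A \<omega>"
          using chain_integral_lincomb[OF A 2(2) 2(2), of ?c 0] by simp
        ultimately have "?c * chain_integral A \<omega> \<le> B" by (metis abs_le_D1)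
        then have "K * t \<le> B" using 2(1) by simp
        then show ?thesis using K by (simp add: field_simps)
      qed (use 2 K in simp)
    qed (use K in simp)
  qed simp
  then show ?thesis using K by (simp add: field_simps)
qed

text \<open>The norm controls intrinsic derivatives up to order \<open>s\<close> uniformly on the
  ball; converting them into partial derivatives in charts makes the ball an admissible family for a
  mean.\<close>

lemma tensor_family_C_norm_ball:
  assumes U: "open U"
  shows "tensor_family U k s {h \<in> B_forms M U k s. C_norm M U k s h \<le> K} (\<lambda>h. h)"
proof -
  let ?I = "{h \<in> B_forms M U k s. C_norm M U k s h \<le> K}"
  have C: "h \<in> C_forms M U k s" if "h \<in> ?I" for h using that by (simp add: B_forms_def)
  have "tensor_family U (0 + k) s ?I (\<lambda>h. (cov_deriv M ^^ 0) h)"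
  proof (rule tensor_family_of_bounds[OF U, where r = s])
    show "tensor_family U k s {h} (\<lambda>h. h)" if "h \<in> ?I" for h
      unfolding tensor_family_def
    proof (intro conjI ballI allI impI)
      note T = tensor_familyD[OF C_forms_tensor_family[OF U C[OF that], of "{h}"]]
      show "multilinear k (h' p)" if "h' \<in> {h}" "p \<in> U" for h' p using T(1)[of h p] that by simp
      show "equi_C s (snd c ` (fst c \<inter> U)) {h} (\<lambda>h x. tensor_in_chart M c h x vs)"
        if "c \<in> charts M" "length vs = k" for c vs
        by (rule equi_C_cong[OF open_chart_image[OF that(1) U] T(2)[OF that]]) simp
    qed
    show "tensor_family U (j + k) 0 ?I (\<lambda>h. (cov_deriv M ^^ j) h)" if "j \<le> s" for j
    proof (rule tensor_family_0_of_bounds[OF U, where B = K])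
      show "multilinear (j + k) ((cov_deriv M ^^ j) h p)" if "h \<in> ?I" "p \<in> U" for h p
        using multilinear_cov_deriv_iterate[OF U C[OF that(1)] \<open>j \<le> s\<close> that(2)] .
      show "tensor_norm M p (j + k) ((cov_deriv M ^^ j) h p) \<le> K" if "h \<in> ?I" "p \<in> U" for h p
        using tensor_norm_le_C_norm[of h U k s p j] that \<open>j \<le> s\<close> by auto
    qed
  qed simp
  then show ?thesis by simp
qed

lemma bounded_fun_tensor_family:
  assumes U: "open U" and H: "tensor_family U m r I H" and p: "p \<in> U" and vs: "length vs = m"
  shows "bounded_fun I (\<lambda>i. H i p vs)"
  using equi_bounded_imp_bounded_fun[OF equi_C_bounded[OF tensor_familyD(2)[OF H chart_at(1) vs]], of "snd (chart_at M p) p" p]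
    chart_at(2)[of p] p by (simp add: tensor_in_chart_chart_at)

text \<open>The partial derivative passes under the mean by the Taylor argument, and the Christoffel
  correction is a finite sum that passes by linearity.\<close>

lemma mean_cov_deriv:
  assumes U: "open U" and \<Lambda>: "mean_functional I \<Lambda>" and H: "tensor_family U m (Suc (Suc r)) I H"
    and T: "\<And>p vs. p \<in> U \<Longrightarrow> length vs = m \<Longrightarrow> T p vs = \<Lambda> (\<lambda>i. H i p vs)"
    and p: "p \<in> U" and ws: "length ws = Suc m"
  shows "cov_deriv M T p ws = \<Lambda> (\<lambda>i. cov_deriv M (H i) p ws)"
proof -
  interpret mean_functional I \<Lambda> by fact
  obtain v vs where vs: "ws = v # vs" "length vs = m" using ws by (cases ws) auto
  define c where "c = chart_at M p"
  define x where "x = snd c p"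
  have c: "c \<in> charts M" and x: "x \<in> snd c ` (fst c \<inter> U)" using chart_at p by (auto simp: c_def x_def)
  note S = open_chart_image[OF c U]
  have E: "equi_C (Suc (Suc 0)) (snd c ` (fst c \<inter> U)) I (\<lambda>i y. tensor_in_chart M c (H i) y vs)"
    using tensor_familyD(2)[OF H c vs(2)] by (rule equi_C_mono) simp
  have "((\<lambda>y. tensor_in_chart M c T y vs) has_derivative
      (\<lambda>v. \<Lambda> (\<lambda>i. frechet_derivative (\<lambda>y. tensor_in_chart M c (H i) y vs) (at x) v))) (at x)"
    by (rule has_derivative_transform_within_open[OF has_derivative[OF S x E] S x])
      (use c vs in \<open>auto simp: tensor_in_chart_def T\<close>)
  note D = frechet_derivative_eqI[OF this]
  have b1: "bounded_fun I (\<lambda>i. frechet_derivative (\<lambda>y. tensor_in_chart M c (H i) y vs) (at x) v)"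
    by (rule equi_bounded_imp_bounded_fun[OF equi_C_bounded[of "Suc 0"] x]) (use E in simp)
  have b2: "bounded_fun I (\<lambda>i. H i p us)" if "length us = m" for us
    using bounded_fun_tensor_family[OF U H p that] .
  show ?thesis
    unfolding cov_deriv_def vs(1) list.case Let_def c_def[symmetric] x_def[symmetric] D
    using b1 b2 vs by (simp add: T[OF p] sum diff bounded_fun_sum)
qed

text \<open>The step from \<open>j\<close> to \<open>j + 1\<close> differentiates a family of which
  \<open>s - j\<close> orders are left, and differentiation under the mean asks for two; hence the
  bound on \<open>j\<close>.\<close>

lemma mean_cov_deriv_iterate:
  assumes U: "open U" and \<Lambda>: "mean_functional I \<Lambda>" and H: "tensor_family U k s I H"
    and T: "\<And>p vs. p \<in> U \<Longrightarrow> length vs = k \<Longrightarrow> T p vs = \<Lambda> (\<lambda>i. H i p vs)"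
  shows "Suc j \<le> s \<Longrightarrow> p \<in> U \<Longrightarrow> length vs = j + k \<Longrightarrow> (cov_deriv M ^^ j) T p vs = \<Lambda> (\<lambda>i. (cov_deriv M ^^ j) (H i) p vs)"
proof (induction j arbitrary: p vs)
  case 0
  then show ?case using T by simp
next
  case (Suc j)
  have "tensor_family U (j + k) (Suc (Suc 0)) I (\<lambda>i. (cov_deriv M ^^ j) (H i))"
    using Suc.prems by (intro tensor_family_mono[OF tensor_family_cov_deriv_iterate[OF U H]]) auto
  then show ?case
    unfolding funpow.simps comp_def
    by (rule mean_cov_deriv[OF U \<Lambda>]) (use Suc in auto)
qed

text \<open>For every order \<open>s\<close>, domination by \<open>K s * B_norm\<close> makes
  \<open>f\<close> a mean over the ball of radius \<open>K s\<close>. Order \<open>r\<close> of the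
  form is controlled through \<open>s = r + 2\<close>, since means lose two orders of
  differentiability.\<close>

lemma form_of_functional:
  assumes U: "open U" and f: "linear_on (pointed_chains U k) f" and K: "\<And>r. 0 < K r"
    and le: "\<And>r A. A \<in> pointed_chains U k \<Longrightarrow> f A \<le> K r * B_norm M U k r A"
  shows "\<exists>\<omega>\<in>B_smooth_forms M U k. (\<forall>A\<in>pointed_chains U k. f A = chain_integral A \<omega>) \<and>
    (\<forall>r. C_norm M U k r \<omega> \<le> K (Suc (Suc r)))"
proof -
  let ?P = "pointed_chains U k"
  define I where "I = (\<lambda>s. {h \<in> B_forms M U k s. C_norm M U k s h \<le> K s})"
  \<comment> \<open>Defined from \<open>f\<close> and not from a mean, so it does not depend on the
    order \<open>s\<close> whose mean is used to study it.\<close>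
  define \<omega> where "\<omega> = (\<lambda>p vs. if p \<in> U \<and> length vs = k then f (point_chain p vs) else 0)"
  have B: "h \<in> B_forms M U k s" if "h \<in> I s" for h s using that by (simp add: I_def)
  have fam: "tensor_family U k s (I s) (\<lambda>h. h)" for s unfolding I_def by (rule tensor_family_C_norm_ball[OF U])
  have "\<exists>\<Lambda>. mean_functional (I s) \<Lambda> \<and> (\<forall>A\<in>?P. \<Lambda> (chain_integral A) = f A)" for s
  proof (rule mean_functional_representation[OF subspace_pointed_chains f, of "I s" chain_integral])
    show "I s \<noteq> {}" using B_forms_zero[OF U, of k s] K[of s] by (auto simp: I_def)
    show "bounded_fun (I s) (chain_integral A)" if A: "A \<in> ?P" for A
    proof -
      obtain L where L: "L \<ge> 0" "\<And>h. h \<in> B_forms M U k s \<Longrightarrow> \<bar>chain_integral A h\<bar> \<le> L * C_norm M U k s h"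
        using chain_integral_bounded[OF U A] by blast
      have "\<bar>chain_integral A h\<bar> \<le> L * K s" if "h \<in> I s" for h
        using L(2)[OF B[OF that]] that L(1) by (auto simp: I_def intro: order_trans mult_left_mono)
      then show ?thesis unfolding bounded_fun_def by blast
    qed
    show "f A \<le> b" if "A \<in> ?P" "0 \<le> b" "\<And>h. h \<in> I s \<Longrightarrow> \<bar>chain_integral A h\<bar> \<le> b" for A b
      using le[OF that(1), of s] B_norm_le[OF U that(1) K that(2), of s s] that(3) by (auto simp: I_def)
  qed (auto simp: chain_integral_add chain_integral_scaleR)
  then obtain \<Lambda> where \<Lambda>: "\<And>s. mean_functional (I s) (\<Lambda> s)" "\<And>s A. A \<in> ?P \<Longrightarrow> \<Lambda> s (chain_integral A) = f A"
    using choice[of "\<lambda>s \<Lambda>. mean_functional (I s) \<Lambda> \<and> (\<forall>A\<in>?P. \<Lambda> (chain_integral A) = f A)"] by blast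
  have bI: "bounded_fun (I s) (\<lambda>h. h p vs)" if "p \<in> U" "length vs = k" for p vs s
    using bounded_fun_tensor_family[OF U fam that] .
  have \<omega>_eq: "\<omega> p vs = \<Lambda> s (\<lambda>h. h p vs)" if p: "p \<in> U" and vs: "length vs = k" for p vs s
  proof -
    have "\<Lambda> s (\<lambda>h. h p vs) = \<Lambda> s (chain_integral (point_chain p vs))"
    proof (rule mean_functional.cong[OF \<Lambda>(1) bI[OF p vs]])
      show "h p vs = chain_integral (point_chain p vs) h" if "h \<in> I s" for h
        using chain_integral_point_chain[of h p vs] B_formsD(1)[OF B[OF that] p] vs by simp
    qed
    also have "\<dots> = \<omega> p vs" using \<Lambda>(2)[OF point_chain_mem[OF p vs]] p vs by (simp add: \<omega>_def)
    finally show ?thesis ..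
  qed
  \<comment> \<open>Multilinearity and alternation hold for every form in the ball, hence for the
    mean of their values; the ball of order 0 is used.\<close>
  have cov: "\<omega> p \<in> k_covectors k" if p: "p \<in> U" for p
    unfolding k_covectors_def
  proof (intro CollectI conjI allI impI)
    fix vs :: "'e list"
    interpret mean_functional "I 0" "\<Lambda> 0" by (rule \<Lambda>)
    note hp = B_formsD(1)[OF B[of _ 0] p]
    show "\<omega> p vs = 0" if "length vs \<noteq> k" using that by (simp add: \<omega>_def)
    show "\<omega> p vs = 0" if "length vs = k \<and> \<not> distinct vs"
    proof -
      have "\<omega> p vs = \<Lambda> 0 (\<lambda>_. 0)"
        using that hp by (simp add: \<omega>_eq[OF p, of _ 0]) (intro cong bI p, auto simp: k_covectors_def)
      then show ?thesis by (simp add: zero)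
    qed
    fix i assume i: "length vs = k \<and> i < k"
    have lin: "linear (\<lambda>v. h p (vs[i := v]))" if "h \<in> I 0" for h
      using hp[OF that] i by (simp add: k_covectors_def)
    show "linear (\<lambda>v. \<omega> p (vs[i := v]))"
    proof (rule linearI)
      fix u w c
      have "\<Lambda> 0 (\<lambda>h. h p (vs[i := u + w])) = \<Lambda> 0 (\<lambda>h. h p (vs[i := u]) + h p (vs[i := w]))"
        using linear_add[OF lin] i by (intro cong bI p) auto
      also have "\<dots> = \<Lambda> 0 (\<lambda>h. h p (vs[i := u])) + \<Lambda> 0 (\<lambda>h. h p (vs[i := w]))"
        using i by (intro add bI p) auto
      finally show "\<omega> p (vs[i := u + w]) = \<omega> p (vs[i := u]) + \<omega> p (vs[i := w])"
        using i by (simp add: \<omega>_eq[OF p, of _ 0])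
      have "\<Lambda> 0 (\<lambda>h. h p (vs[i := c *\<^sub>R u])) = \<Lambda> 0 (\<lambda>h. c * h p (vs[i := u]))"
        using linear_scale[OF lin] i by (intro cong bI p) auto
      also have "\<dots> = c * \<Lambda> 0 (\<lambda>h. h p (vs[i := u]))"
        using i by (intro scale bI p) auto
      finally show "\<omega> p (vs[i := c *\<^sub>R u]) = c *\<^sub>R \<omega> p (vs[i := u])"
        using i by (simp add: \<omega>_eq[OF p, of _ 0])
    qed
  qed
  have C: "\<omega> \<in> C_forms M U k r" for r
    unfolding C_forms_def
  proof (intro CollectI conjI ballI allI impI cov)
    show "\<omega> p = 0" if "p \<notin> U" for p using that by (simp add: \<omega>_def zero_fun_def)
    fix c and vs :: "'e list" assume c: "c \<in> charts M"
    note S = open_chart_image[OF c U]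
    show "C_on r (snd c ` (fst c \<inter> U)) (\<lambda>x. tensor_in_chart M c \<omega> x vs)"
    proof (cases "length vs = k")
      case True
      have "C_on r (snd c ` (fst c \<inter> U)) (\<lambda>x. \<Lambda> (Suc (Suc r)) (\<lambda>h. tensor_in_chart M c h x vs))"
        using mean_functional.C_on[OF \<Lambda>(1) S tensor_familyD(2)[OF fam c True]] .
      then show ?thesis
        by (rule C_on_cong[OF S, THEN iffD1, rotated])
          (use c True in \<open>auto simp: tensor_in_chart_def \<omega>_eq[of _ _ "Suc (Suc r)"]\<close>)
    next
      case False
      then have "(\<lambda>x. tensor_in_chart M c \<omega> x vs) = (\<lambda>_. 0)" by (simp add: tensor_in_chart_def \<omega>_def)
      then show ?thesis by (simp add: C_on_zero)
    qed
  qed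
  have bound: "tensor_norm M p (j + k) ((cov_deriv M ^^ j) \<omega> p) \<le> K (Suc (Suc r))" if p: "p \<in> U" and j: "j \<le> r" for p j r
  proof (rule tensor_norm_le)
    fix vs :: "'e list" assume vs: "length vs = j + k" "\<forall>v\<in>set vs. rmetric M p v v \<le> 1"
    let ?s = "Suc (Suc r)"
    have "(cov_deriv M ^^ j) \<omega> p vs = \<Lambda> ?s (\<lambda>h. (cov_deriv M ^^ j) h p vs)"
    proof (rule mean_cov_deriv_iterate[OF U \<Lambda>(1)[of ?s] fam[of ?s]])
      show "\<omega> q us = \<Lambda> ?s (\<lambda>h. h q us)" if "q \<in> U" "length us = k" for q us
        using that by (rule \<omega>_eq)
    qed (use j p vs in auto)
    also have "\<bar>\<dots>\<bar> \<le> K ?s"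
    proof (rule mean_functional.bound[OF \<Lambda>(1)])
      show "0 \<le> K ?s" using K[of ?s] by simp
      fix h assume h: "h \<in> I ?s"
      have "\<bar>(cov_deriv M ^^ j) h p vs\<bar> \<le> C_norm M U k ?s h"
        using j by (intro form_value_le_C_norm[OF U B[OF h] p _ vs]) simp
      also have "\<dots> \<le> K ?s" using h by (simp add: I_def)
      finally show "\<bar>(cov_deriv M ^^ j) h p vs\<bar> \<le> K ?s" .
    qed
    finally show "\<bar>(cov_deriv M ^^ j) \<omega> p vs\<bar> \<le> K ?s" .
  qed
  have "\<omega> \<in> B_smooth_forms M U k"
    using C bound by (auto simp: B_smooth_forms_def B_forms_def deriv_norms_def intro!: bdd_aboveI[of _ "K (Suc (Suc _))"])
  moreover have "C_norm M U k r \<omega> \<le> K (Suc (Suc r))" for r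
    using bound K[of "Suc (Suc r)"] by (intro C_norm_le) auto
  moreover have "f A = chain_integral A \<omega>" if A: "A \<in> ?P" for A
  proof -
    interpret mean_functional "I 0" "\<Lambda> 0" by (rule \<Lambda>)
    \<comment> \<open>Boundedness is carried along in the induction because additivity of the mean
      is available for bounded functions only.\<close>
    have *: "bounded_fun (I 0) (\<lambda>h. \<alpha> (h p)) \<and> \<Lambda> 0 (\<lambda>h. \<alpha> (h p)) = \<alpha> (\<omega> p)" if p: "p \<in> U" and "\<alpha> \<in> exterior_power k" for \<alpha> p
      using that(2) unfolding exterior_power_def
    proof (induction rule: span_induct_alt)
      case base
      then show ?case by (simp add: zero bounded_fun_const)
    next
      case (step c x y)
      then obtain vs where x: "x = wedge vs" "length vs = k" by auto
      have xh: "x (h p) = h p vs" if "h \<in> I 0" for h using B_formsD(1)[OF B[OF that] p] x by (simp add: wedge_def)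
      have b: "bounded_fun (I 0) (\<lambda>h. x (h p))"
        using bI[OF p x(2), of 0] by (simp add: bounded_fun_def xh)
      have "\<Lambda> 0 (\<lambda>h. x (h p)) = \<Lambda> 0 (\<lambda>h. h p vs)" using xh by (intro cong b) auto
      also have "\<dots> = x (\<omega> p)" using \<omega>_eq[OF p x(2), of 0] cov[OF p] x by (simp add: wedge_def)
      finally have "\<Lambda> 0 (\<lambda>h. c * x (h p) + y (h p)) = c * x (\<omega> p) + y (\<omega> p)"
        using step.IH b by (simp add: add scale bounded_fun_scale)
      moreover have "bounded_fun (I 0) (\<lambda>h. c * x (h p) + y (h p))"
        using step.IH b by (simp add: bounded_fun_add bounded_fun_scale)
      ultimately show ?case by (simp add: scaleR_fun_def)
    qed
    have Ap: "p \<in> U" "A p \<in> exterior_power k" if "A p \<noteq> 0" for p using A that by (auto simp: pointed_chains_def)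
    have "f A = \<Lambda> 0 (\<lambda>h. \<Sum>p | A p \<noteq> 0. A p (h p))"
      using \<Lambda>(2)[OF A, of 0] unfolding chain_integral_def[abs_def] by simp
    also have "\<dots> = (\<Sum>p | A p \<noteq> 0. \<Lambda> 0 (\<lambda>h. A p (h p)))" using * Ap by (intro sum) auto
    also have "\<dots> = chain_integral A \<omega>" unfolding chain_integral_def using * Ap by (intro sum.cong) auto
    finally show ?thesis .
  qed
  ultimately show ?thesis by blast
qed

end

section \<open>Seminorms on locally convex spaces\<close>

lemma openin_seminorm_ball:
  assumes V: "subspace V" and p: "p \<in> P" "seminorm_on V p" and a: "a \<in> V"
  shows "openin (seminorm_topology V P) {y\<in>V. p (y - a) < r}"
  unfolding openin_seminorm_topology
proof (intro conjI ballI)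
  fix x assume x: "x \<in> {y\<in>V. p (y - a) < r}"
  have "{y\<in>V. \<forall>p\<in>{p}. p (y - x) < r - p (x - a)} \<subseteq> {y\<in>V. p (y - a) < r}"
    using seminorm_on_triangle[OF p(2) V _ _ a, of _ x] x by fastforce
  then show "\<exists>F \<epsilon>. finite F \<and> F \<subseteq> P \<and> 0 < \<epsilon> \<and> {y\<in>V. \<forall>p\<in>F. p (y - x) < \<epsilon>} \<subseteq> {y\<in>V. p (y - a) < r}"
    using x p(1) by (intro exI[of _ "{p}"] exI[of _ "r - p (x - a)"]) auto
qed auto

text \<open>Serves as a competitor in the universal property of the inductive limit: a seminorm
  whose topology makes all \<open>lam r\<close> continuous has open balls in
  \<open>L\<close>.\<close>

lemma lcs_seminorm_topology:
  assumes V: "subspace V" and q: "seminorm_on V q"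
  shows "lcs (seminorm_topology V {q})"
proof -
  let ?X = "seminorm_topology V {q}"
  have open_iff: "openin ?X W \<longleftrightarrow> W \<subseteq> V \<and> (\<forall>x\<in>W. \<exists>\<epsilon>>0. {y\<in>V. q (y - x) < \<epsilon>} \<subseteq> W)" for W
  proof -
    have "(\<exists>F \<epsilon>. finite F \<and> F \<subseteq> {q} \<and> 0 < \<epsilon> \<and> {y\<in>V. \<forall>p\<in>F. p (y - x) < \<epsilon>} \<subseteq> W) \<longleftrightarrow>
        (\<exists>\<epsilon>>0. {y\<in>V. q (y - x) < \<epsilon>} \<subseteq> W)" for x
    proof
      assume "\<exists>F \<epsilon>. finite F \<and> F \<subseteq> {q} \<and> 0 < \<epsilon> \<and> {y\<in>V. \<forall>p\<in>F. p (y - x) < \<epsilon>} \<subseteq> W"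
      then obtain F \<epsilon> where "F \<subseteq> {q}" "(0::real) < \<epsilon>" "{y\<in>V. \<forall>p\<in>F. p (y - x) < \<epsilon>} \<subseteq> W" by blast
      then show "\<exists>\<epsilon>>0. {y\<in>V. q (y - x) < \<epsilon>} \<subseteq> W" by (intro exI[of _ \<epsilon>]) auto
    next
      assume "\<exists>\<epsilon>>0. {y\<in>V. q (y - x) < \<epsilon>} \<subseteq> W"
      then obtain \<epsilon> where "\<epsilon> > 0" "{y\<in>V. q (y - x) < \<epsilon>} \<subseteq> W" by blast
      then show "\<exists>F \<epsilon>. finite F \<and> F \<subseteq> {q} \<and> 0 < \<epsilon> \<and> {y\<in>V. \<forall>p\<in>F. p (y - x) < \<epsilon>} \<subseteq> W"
        by (intro exI[of _ "{q}"] exI[of _ \<epsilon>]) auto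
    qed
    then show ?thesis unfolding openin_seminorm_topology by simp
  qed
  have ball: "openin ?X {y\<in>V. q (y - a) < r}" if "a \<in> V" for a r
    by (rule openin_seminorm_ball[OF V _ q that]) simp
  have top: "topspace ?X = V" by (rule topspace_seminorm_topology)
  have add: "continuous_map (prod_topology ?X ?X) ?X (\<lambda>(x, y). x + y)"
    unfolding continuous_map_def
  proof (intro conjI allI impI)
    show "(\<lambda>(x, y). x + y) \<in> topspace (prod_topology ?X ?X) \<rightarrow> topspace ?X"
      using subspace_add[OF V] by (auto simp: top)
    fix W assume W: "openin ?X W"
    show "openin (prod_topology ?X ?X) {z \<in> topspace (prod_topology ?X ?X). (\<lambda>(x, y). x + y) z \<in> W}"
      unfolding openin_prod_topology_alt
    proof (intro allI impI)
      fix x y assume "(x, y) \<in> {z \<in> topspace (prod_topology ?X ?X). (\<lambda>(x, y). x + y) z \<in> W}"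
      then have xy: "x \<in> V" "y \<in> V" "x + y \<in> W" by (auto simp: top)
      then obtain e where e: "e > 0" "{z\<in>V. q (z - (x + y)) < e} \<subseteq> W" using W open_iff by blast
      have "{z\<in>V. q (z - x) < e / 2} \<times> {z\<in>V. q (z - y) < e / 2} \<subseteq> {z \<in> topspace (prod_topology ?X ?X). (\<lambda>(x, y). x + y) z \<in> W}"
      proof clarify
        fix a b assume ab: "a \<in> V" "q (a - x) < e / 2" "b \<in> V" "q (b - y) < e / 2"
        have "q ((a - x) + (b - y)) < e"
          using seminorm_onD(2)[OF q, of "a - x" "b - y"] ab xy subspace_diff[OF V] by fastforce
        then have "a + b \<in> W" using e ab subspace_add[OF V] by (auto simp: algebra_simps)
        then show "(a, b) \<in> topspace (prod_topology ?X ?X) \<and> a + b \<in> W" using ab by (simp add: top)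
      qed
      then show "\<exists>A B. openin ?X A \<and> openin ?X B \<and> x \<in> A \<and> y \<in> B \<and> A \<times> B \<subseteq> {z \<in> topspace (prod_topology ?X ?X). (\<lambda>(x, y). x + y) z \<in> W}"
        using ball[OF xy(1), of "e / 2"] ball[OF xy(2), of "e / 2"] xy e seminorm_on_zero[OF q V]
        by (intro exI[of _ "{z\<in>V. q (z - x) < e / 2}"] exI[of _ "{z\<in>V. q (z - y) < e / 2}"] conjI) simp_all
    qed
  qed
  have scale: "continuous_map (prod_topology euclideanreal ?X) ?X (\<lambda>(c, x). c *\<^sub>R x)"
    unfolding continuous_map_def
  proof (intro conjI allI impI)
    show "(\<lambda>(c, x). c *\<^sub>R x) \<in> topspace (prod_topology euclideanreal ?X) \<rightarrow> topspace ?X"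
      using subspace_scale[OF V] by (auto simp: top)
    fix W assume W: "openin ?X W"
    show "openin (prod_topology euclideanreal ?X) {z \<in> topspace (prod_topology euclideanreal ?X). (\<lambda>(c, x). c *\<^sub>R x) z \<in> W}"
      unfolding openin_prod_topology_alt
    proof (intro allI impI)
      fix c x assume "(c, x) \<in> {z \<in> topspace (prod_topology euclideanreal ?X). (\<lambda>(c, x). c *\<^sub>R x) z \<in> W}"
      then have cx: "x \<in> V" "c *\<^sub>R x \<in> W" by (auto simp: top)
      then obtain e where e: "e > 0" "{z\<in>V. q (z - c *\<^sub>R x) < e} \<subseteq> W" using W open_iff by blast
      \<comment> \<open>\<open>a *\<^sub>R b - c *\<^sub>R x\<close> is split into
        \<open>a *\<^sub>R (b - x)\<close> and \<open>(a - c) *\<^sub>R x\<close>; the bound 1 in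
        \<open>d1\<close> gives \<open>\<bar>a\<bar> \<le> \<bar>c\<bar> + 1\<close>, and each part
        then contributes at most \<open>e / 2\<close>.\<close>
      define d1 where "d1 = min 1 (e / (2 * (q x + 1)))"
      define d2 where "d2 = e / (2 * (\<bar>c\<bar> + 1))"
      have qx: "0 \<le> q x" using seminorm_onD(1)[OF q cx(1)] .
      have d: "d1 > 0" "d2 > 0" using e qx by (auto simp: d1_def d2_def)
      have "ball c d1 \<times> {z\<in>V. q (z - x) < d2} \<subseteq> {z \<in> topspace (prod_topology euclideanreal ?X). (\<lambda>(c, x). c *\<^sub>R x) z \<in> W}"
      proof clarify
        fix a b assume ab: "a \<in> ball c d1" "b \<in> V" "q (b - x) < d2"
        have ac: "\<bar>a - c\<bar> < d1" using ab(1) by (simp add: dist_real_def abs_minus_commute)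
        have "\<bar>a - c\<bar> < 1" using ac by (simp add: d1_def)
        then have "\<bar>a\<bar> \<le> \<bar>c\<bar> + 1" by linarith
        have "q (a *\<^sub>R (b - x) + (a - c) *\<^sub>R x) \<le> \<bar>a\<bar> * q (b - x) + \<bar>a - c\<bar> * q x"
          using seminorm_onD(2)[OF q, of "a *\<^sub>R (b - x)" "(a - c) *\<^sub>R x"] seminorm_onD(3)[OF q] ab cx
          by (simp add: subspace_diff[OF V] subspace_scale[OF V])
        also have "\<dots> < e"
        proof -
          have "\<bar>a\<bar> * q (b - x) \<le> (\<bar>c\<bar> + 1) * q (b - x)"
            using \<open>\<bar>a\<bar> \<le> \<bar>c\<bar> + 1\<close> seminorm_onD(1)[OF q, of "b - x"] ab cx V by (intro mult_right_mono) (auto intro: subspace_diff)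
          also have "\<dots> < (\<bar>c\<bar> + 1) * d2" using ab by (intro mult_strict_left_mono) auto
          also have "\<dots> = e / 2" by (simp add: d2_def field_simps)
          finally have 1: "\<bar>a\<bar> * q (b - x) < e / 2" .
          have "\<bar>a - c\<bar> * q x \<le> e / (2 * (q x + 1)) * (q x + 1)"
            using ac qx e by (intro mult_mono) (auto simp: d1_def)
          also have "\<dots> = e / 2" using qx by (simp add: field_simps)
          finally show ?thesis using 1 by simp
        qed
        also have "a *\<^sub>R (b - x) + (a - c) *\<^sub>R x = a *\<^sub>R b - c *\<^sub>R x" by (simp add: algebra_simps)
        finally have "a *\<^sub>R b \<in> W" using e ab subspace_scale[OF V] by auto
        then show "(a, b) \<in> topspace (prod_topology euclideanreal ?X) \<and> a *\<^sub>R b \<in> W" using ab by (simp add: top)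
      qed
      then show "\<exists>A B. openin euclideanreal A \<and> openin ?X B \<and> c \<in> A \<and> x \<in> B \<and> A \<times> B \<subseteq> {z \<in> topspace (prod_topology euclideanreal ?X). (\<lambda>(c, x). c *\<^sub>R x) z \<in> W}"
        using ball cx d seminorm_on_zero[OF q V]
        by (intro exI[of _ "ball c d1"] exI[of _ "{z\<in>V. q (z - x) < d2}"]) auto
    qed
  qed
  have "\<exists>C. openin ?X C \<and> convex C \<and> 0 \<in> C \<and> C \<subseteq> W" if W: "openin ?X W" "0 \<in> W" for W
  proof -
    have "\<exists>\<epsilon>>0. {y\<in>V. q (y - 0) < \<epsilon>} \<subseteq> W" using iffD1[OF open_iff W(1)] W(2) by (elim conjE bspec)
    then obtain e where e: "e > 0" "{z\<in>V. q (z - 0) < e} \<subseteq> W" by blast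
    have "convex {z\<in>V. q (z - 0) < e}"
      unfolding convex_def
    proof clarify
      fix x y u v assume *: "x \<in> V" "q (x - 0) < e" "y \<in> V" "q (y - 0) < e" "(0::real) \<le> u" "0 \<le> v" "u + v = 1"
      have "q (u *\<^sub>R x + v *\<^sub>R y) \<le> u * q x + v * q y"
        using seminorm_onD(2)[OF q, of "u *\<^sub>R x" "v *\<^sub>R y"] * V by (simp add: seminorm_onD(3)[OF q] subspace_scale)
      also have "\<dots> < e" using * by (simp add: convex_bound_lt)
      finally show "u *\<^sub>R x + v *\<^sub>R y \<in> V \<and> q (u *\<^sub>R x + v *\<^sub>R y - 0) < e"
        using * V by (simp add: subspace_scale subspace_add)
    qed
    then show ?thesis using e ball[of 0 e] subspace_0[OF V] seminorm_on_zero[OF q V]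
      by (intro exI[of _ "{z\<in>V. q (z - 0) < e}"]) auto
  qed
  then show ?thesis unfolding lcs_def top using V add scale by blast
qed

section \<open>Neighbourhoods, gauges and continuous seminorms\<close>

lemma openin_lcs_affine_preimage:
  assumes X: "lcs X" and W: "openin X W" and a: "a \<in> topspace X"
  shows "openin X {x \<in> topspace X. c *\<^sub>R x + a \<in> W}"
proof -
  have "continuous_map X X ((\<lambda>(c, x). c *\<^sub>R x) \<circ> (\<lambda>x. (c, x)))"
    using X by (intro continuous_map_compose[of X "prod_topology euclideanreal X"])
      (auto simp: lcs_def continuous_map_pairedI)
  then have "continuous_map X X (\<lambda>x. c *\<^sub>R x)" by (simp add: comp_def)
  then have "continuous_map X X ((\<lambda>(x, y). x + y) \<circ> (\<lambda>x. (c *\<^sub>R x, a)))"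
    using X a by (intro continuous_map_compose[of X "prod_topology X X"])
      (auto simp: lcs_def continuous_map_pairedI)
  then have "continuous_map X X (\<lambda>x. c *\<^sub>R x + a)" by (simp add: comp_def)
  then show ?thesis using W by (simp add: continuous_map_def)
qed

lemma lcs_absorbing:
  assumes X: "lcs X" and W: "openin X W" "0 \<in> W" and x: "x \<in> topspace X"
  shows "\<exists>s>0. \<forall>t. \<bar>t\<bar> < s \<longrightarrow> t *\<^sub>R x \<in> W"
proof -
  have "continuous_map euclideanreal X ((\<lambda>(c, x). c *\<^sub>R x) \<circ> (\<lambda>c. (c, x)))"
    using X x by (intro continuous_map_compose[of euclideanreal "prod_topology euclideanreal X"])
      (auto simp: lcs_def continuous_map_pairedI)
  then have "openin euclideanreal {c \<in> topspace euclideanreal. c *\<^sub>R x \<in> W}"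
    using W by (simp add: continuous_map_def comp_def)
  then have "open {c. c *\<^sub>R x \<in> W}" by simp
  moreover have "0 \<in> {c. c *\<^sub>R x \<in> W}" using W by simp
  ultimately obtain s where "s > 0" "ball 0 s \<subseteq> {c. c *\<^sub>R x \<in> W}" using openE by blast
  then show ?thesis by (intro exI[of _ s]) (auto simp: subset_iff dist_real_def)
qed

text \<open>The seminorm is the gauge of \<open>D\<close>, a convex neighbourhood intersected with
  its negative so that the gauge is even. Values below 1 force membership in \<open>D\<close>, and
  \<open>D\<close> itself is the neighbourhood on which the gauge is at most 1.\<close>

lemma minkowski_seminorm:
  assumes X: "lcs X" and W: "openin X W" "0 \<in> W"
  shows "\<exists>q. seminorm_on (topspace X) q \<and> (\<forall>x\<in>topspace X. q x < 1 \<longrightarrow> x \<in> W) \<and>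
    (\<exists>O'. openin X O' \<and> 0 \<in> O' \<and> (\<forall>x\<in>O'. q x \<le> 1))"
proof -
  let ?V = "topspace X"
  have V: "subspace ?V" using X by (simp add: lcs_def)
  obtain C where C: "openin X C" "convex C" "0 \<in> C" "C \<subseteq> W" using X W unfolding lcs_def by blast
  define D where "D = C \<inter> {x \<in> ?V. (-1) *\<^sub>R x + 0 \<in> C}"
  have D: "openin X D" "0 \<in> D" "D \<subseteq> W" "D \<subseteq> ?V"
    unfolding D_def using C openin_lcs_affine_preimage[OF X C(1) subspace_0[OF V], of "-1"] subspace_0[OF V] openin_subset[OF C(1)]
    by auto
  have conv: "convex D"
    unfolding D_def
  proof (intro convex_Int C(2))
    show "convex {x \<in> ?V. (-1) *\<^sub>R x + 0 \<in> C}"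
      unfolding convex_def
    proof clarify
      fix x y u v assume *: "x \<in> ?V" "y \<in> ?V" "(-1) *\<^sub>R x + 0 \<in> C" "(-1) *\<^sub>R y + 0 \<in> C" "(0::real) \<le> u" "0 \<le> v" "u + v = 1"
      have "u *\<^sub>R ((-1) *\<^sub>R x + 0) + v *\<^sub>R ((-1) *\<^sub>R y + 0) \<in> C"
        using C(2) * unfolding convex_def by blast
      then show "u *\<^sub>R x + v *\<^sub>R y \<in> ?V \<and> (-1) *\<^sub>R (u *\<^sub>R x + v *\<^sub>R y) + 0 \<in> C"
        using * V by (simp add: subspace_add subspace_scale algebra_simps)
    qed
  qed
  have sym: "- x \<in> D" if "x \<in> D" for x using that V openin_subset[OF C(1)] by (auto simp: D_def subspace_neg)
  have shrink: "t *\<^sub>R x \<in> D" if "x \<in> D" "0 \<le> t" "t \<le> 1" for x t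
    using convexD[OF conv that(1) D(2), of t "1 - t"] that by simp
  define T where "T = (\<lambda>x. {t. t > 0 \<and> (1/t) *\<^sub>R x \<in> D})"
  define q where "q = (\<lambda>x. Inf (T x))"
  have ne: "T x \<noteq> {}" if x: "x \<in> ?V" for x
  proof -
    obtain s where s: "s > 0" "\<And>t. \<bar>t\<bar> < s \<Longrightarrow> t *\<^sub>R x \<in> D" using lcs_absorbing[OF X D(1,2) x] by blast
    have "2 / s \<in> T x" using s(1) s(2)[of "s / 2"] by (simp add: T_def)
    then show ?thesis by blast
  qed
  have bdd: "bdd_below (T x)" for x by (intro bdd_belowI[of _ 0]) (auto simp: T_def)
  have q_le: "q x \<le> t" if "t \<in> T x" for x t unfolding q_def using that bdd by (rule cInf_lower)
  have q_less: "\<exists>t\<in>T x. t < r" if "x \<in> ?V" "q x < r" for x r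
    using that cInf_lessD[OF ne[OF that(1)]] by (auto simp: q_def)
  have tri: "q (x + y) \<le> q x + q y" if xy: "x \<in> ?V" "y \<in> ?V" for x y
  proof (rule field_le_epsilon)
    fix e :: real assume e: "0 < e"
    obtain s where s: "s \<in> T x" "s < q x + e / 2" using q_less[OF xy(1), of "q x + e / 2"] e by auto
    obtain t where t: "t \<in> T y" "t < q y + e / 2" using q_less[OF xy(2), of "q y + e / 2"] e by auto
    have st: "s > 0" "t > 0" using s t by (auto simp: T_def)
    \<comment> \<open>The weights \<open>s / (s + t)\<close> and \<open>t / (s + t)\<close> combine
      two scaled members of \<open>D\<close> into the scaled sum, which is subadditivity of the
      gauge.\<close>
    have "(s / (s + t)) *\<^sub>R ((1/s) *\<^sub>R x) + (t / (s + t)) *\<^sub>R ((1/t) *\<^sub>R y) \<in> D"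
      using s t st by (intro convexD[OF conv]) (auto simp: T_def add_divide_distrib[symmetric])
    moreover have "(s / (s + t)) *\<^sub>R ((1/s) *\<^sub>R x) + (t / (s + t)) *\<^sub>R ((1/t) *\<^sub>R y) = (1 / (s + t)) *\<^sub>R (x + y)"
      using st by (simp add: scaleR_add_right)
    ultimately have "s + t \<in> T (x + y)" using st by (simp add: T_def)
    then show "q (x + y) \<le> q x + q y + e" using q_le[of "s + t" "x + y"] s t by simp
  qed
  have hom_le: "q (c *\<^sub>R x) \<le> \<bar>c\<bar> * q x" if c: "c \<noteq> 0" and x: "x \<in> ?V" for c x
  proof (rule field_le_epsilon)
    fix e :: real assume e: "0 < e"
    obtain t where t: "t \<in> T x" "t < q x + e / \<bar>c\<bar>" using q_less[OF x, of "q x + e / \<bar>c\<bar>"] e c by auto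
    have "(1 / (\<bar>c\<bar> * t)) *\<^sub>R (c *\<^sub>R x) = (if c > 0 then (1/t) *\<^sub>R x else - ((1/t) *\<^sub>R x))"
      using c t by (auto simp: T_def)
    also have "\<dots> \<in> D" using t sym by (auto simp: T_def)
    finally have "\<bar>c\<bar> * t \<in> T (c *\<^sub>R x)" using t c by (simp add: T_def)
    then have "q (c *\<^sub>R x) \<le> \<bar>c\<bar> * t" by (rule q_le)
    also have "\<dots> \<le> \<bar>c\<bar> * (q x + e / \<bar>c\<bar>)" using t by (intro mult_left_mono) auto
    also have "\<dots> = \<bar>c\<bar> * q x + e" using c by (simp add: distrib_left)
    finally show "q (c *\<^sub>R x) \<le> \<bar>c\<bar> * q x + e" .
  qed
  have "T 0 = {0<..}" using D by (auto simp: T_def)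
  then have "q 0 = 0" by (simp add: q_def)
  then have "seminorm_on ?V q" by (rule seminorm_onI[OF V _ tri hom_le])
  moreover have "x \<in> W" if x: "x \<in> ?V" "q x < 1" for x
  proof -
    obtain t where t: "t \<in> T x" "t < 1" using q_less[OF x] by blast
    then have "0 < t" "(1/t) *\<^sub>R x \<in> D" by (auto simp: T_def)
    then show ?thesis using shrink[of "(1/t) *\<^sub>R x" t] t D(3) by auto
  qed
  moreover have "q x \<le> 1" if "x \<in> D" for x using that by (intro q_le) (simp add: T_def)
  ultimately show ?thesis using D by (intro exI[of _ q]) auto
qed

text \<open>For a seminorm on a locally convex space, being at most 1 on some neighbourhood of 0 is
  equivalent to continuity, and it is the property that a gauge provides.\<close>

definition continuous_seminorm :: "'a::real_vector topology \<Rightarrow> ('a \<Rightarrow> real) \<Rightarrow> bool"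
  where "continuous_seminorm X q \<longleftrightarrow> seminorm_on (topspace X) q \<and>
    (\<exists>W. openin X W \<and> 0 \<in> W \<and> (\<forall>x\<in>W. q x \<le> 1))"

lemma openin_continuous_seminorm_ball:
  assumes X: "lcs X" and q: "continuous_seminorm X q" and a: "a \<in> topspace X"
  shows "openin X {x \<in> topspace X. q (x - a) < r}"
proof (subst openin_subopen, intro ballI)
  let ?V = "topspace X"
  have V: "subspace ?V" using X by (simp add: lcs_def)
  have q': "seminorm_on ?V q" using q by (simp add: continuous_seminorm_def)
  obtain W where W: "openin X W" "0 \<in> W" "\<And>x. x \<in> W \<Longrightarrow> q x \<le> 1" using q by (auto simp: continuous_seminorm_def)
  fix b assume b: "b \<in> {x \<in> ?V. q (x - a) < r}"
  \<comment> \<open>Scaling by \<open>c\<close> gives \<open>q (x - b) \<le> 1 / c\<close>, which is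
    half of the gap between \<open>q (b - a)\<close> and \<open>r\<close>.\<close>
  define c where "c = 2 / (r - q (b - a))"
  have c: "c > 0" using b by (simp add: c_def)
  define T where "T = {x \<in> ?V. c *\<^sub>R x + (- c) *\<^sub>R b \<in> W}"
  have "openin X T" unfolding T_def
    using b by (intro openin_lcs_affine_preimage[OF X W(1)] subspace_scale[OF V]) simp
  moreover have "b \<in> T" using b W by (simp add: T_def)
  moreover have "T \<subseteq> {x \<in> ?V. q (x - a) < r}"
  proof
    fix x assume x: "x \<in> T"
    have "q (c *\<^sub>R (x - b)) \<le> 1" using x W(3) by (auto simp: T_def scaleR_diff_right)
    then have "q (x - b) \<le> 1 / c"
      using seminorm_onD(3)[OF q', of "x - b" c] x b V c by (simp add: T_def subspace_diff field_simps)
    also have "\<dots> < r - q (b - a)" using b by (simp add: c_def)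
    finally show "x \<in> {x \<in> ?V. q (x - a) < r}"
      using seminorm_on_triangle[OF q' V, of x b a] x b a by (auto simp: T_def)
  qed
  ultimately show "\<exists>T. openin X T \<and> b \<in> T \<and> T \<subseteq> {x \<in> ?V. q (x - a) < r}" by blast
qed

lemma tvs_dualI:
  assumes X: "lcs X" and q: "continuous_seminorm X q" and f: "linear_on (topspace X) f"
    and le: "\<And>x. x \<in> topspace X \<Longrightarrow> \<bar>f x\<bar> \<le> q x" and off: "\<And>x. x \<notin> topspace X \<Longrightarrow> f x = 0"
  shows "f \<in> tvs_dual X"
proof -
  have V: "subspace (topspace X)" using X by (simp add: lcs_def)
  have "continuous_map X euclideanreal f"
    unfolding continuous_map_def
  proof (intro conjI allI impI)
    fix S :: "real set" assume "openin euclideanreal S"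
    then have S: "open S" by simp
    show "openin X {x \<in> topspace X. f x \<in> S}"
    proof (subst openin_subopen, intro ballI)
      fix b assume b: "b \<in> {x \<in> topspace X. f x \<in> S}"
      then obtain e where e: "e > 0" "ball (f b) e \<subseteq> S" using S openE by blast
      have "{x \<in> topspace X. q (x - b) < e} \<subseteq> {x \<in> topspace X. f x \<in> S}"
      proof clarify
        fix x assume x: "x \<in> topspace X" "q (x - b) < e"
        then have "\<bar>f x - f b\<bar> < e"
          using le[of "x - b"] linear_on_diff[OF f V, of x b] b V by (simp add: subspace_diff)
        then show "f x \<in> S" using e by (auto simp: subset_iff dist_real_def abs_minus_commute)
      qed
      moreover have "b \<in> {x \<in> topspace X. q (x - b) < e}"
        using b e seminorm_on_zero[OF _ V, of q] q by (simp add: continuous_seminorm_def)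
      ultimately show "\<exists>T. openin X T \<and> b \<in> T \<and> T \<subseteq> {x \<in> topspace X. f x \<in> S}"
        using openin_continuous_seminorm_ball[OF X q, of b e] b by blast
    qed
  qed simp
  then show ?thesis using f off by (simp add: tvs_dual_def)
qed

lemma continuous_seminorm_tvs_dual:
  assumes X: "lcs X" and f: "f \<in> tvs_dual X"
  shows "continuous_seminorm X (\<lambda>x. \<bar>f x\<bar>)"
proof -
  have V: "subspace (topspace X)" using X by (simp add: lcs_def)
  have lin: "linear_on (topspace X) f" and c: "continuous_map X euclideanreal f" using f by (auto simp: tvs_dual_def)
  have "openin X {x \<in> topspace X. f x \<in> ball 0 1}"
    by (rule openin_continuous_map_preimage[OF c]) simp
  moreover have "0 \<in> {x \<in> topspace X. f x \<in> ball 0 1}" using linear_on_zero[OF lin V] subspace_0[OF V] by simp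
  ultimately show ?thesis
    unfolding continuous_seminorm_def using seminorm_on_abs_linear[OF lin]
    by (intro conjI exI[of _ "{x \<in> topspace X. f x \<in> ball 0 1}"]) (auto simp: dist_real_def)
qed

lemma tvs_dual_lincomb:
  assumes f: "f \<in> tvs_dual X" "g \<in> tvs_dual X"
  shows "(\<lambda>x. a * f x + b * g x) \<in> tvs_dual X"
proof -
  have "continuous_map X euclideanreal (\<lambda>x. a * f x + b * g x)"
    using f by (intro continuous_map_add continuous_map_real_mult) (auto simp: tvs_dual_def)
  then show ?thesis using f by (auto simp: tvs_dual_def linear_on_def algebra_simps)
qed

text \<open>Rescaling \<open>x\<close> to norm \<open>d / 2\<close> brings it strictly inside the
  ball, which is where the factor 2 comes from.\<close>

lemma bounded_on_norm_ball:
  assumes E: "banach_on E N" and q: "seminorm_on V q" and l: "linear_on E l" "l ` E \<subseteq> V"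
    and d: "0 < d" "\<And>x. x \<in> E \<Longrightarrow> N x < d \<Longrightarrow> q (l x) \<le> 1" and x: "x \<in> E"
  shows "q (l x) \<le> 2 / d * N x"
proof -
  have sub: "subspace E" and N: "0 \<le> N x" "N x = 0 \<longleftrightarrow> x = 0" "\<And>c. N (c *\<^sub>R x) = \<bar>c\<bar> * N x"
    using E x by (auto simp: banach_on_def)
  show ?thesis
  proof (cases "x = 0")
    case True
    have "l (0 *\<^sub>R x) = 0" using linear_onD(2)[OF l(1) x, of 0] by simp
    then have "q (l x) = q (0 *\<^sub>R l x)" using True by simp
    also have "\<dots> = 0" using seminorm_onD(3)[OF q, of "l x" 0] l x by auto
    finally show ?thesis using N(1) d by simp
  next
    case False
    then have pos: "N x > 0" using N by simp
    define c where "c = d / (2 * N x)"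
    have c: "c > 0" using pos d by (simp add: c_def)
    have "q (l (c *\<^sub>R x)) \<le> 1" using pos d N(3)[of c] c sub x by (intro d(2)) (auto simp: c_def intro: subspace_scale)
    then have "c * q (l x) \<le> 1"
      using linear_onD(2)[OF l(1) x, of c] seminorm_onD(3)[OF q, of "l x" c] l(2) x c by auto
    then show ?thesis using pos d by (simp add: c_def field_simps)
  qed
qed

section \<open>The space of differential chains\<close>

text \<open>Neighbourhoods of 0 are given by finitely many norms, so absorption by each of them
  amounts to a separate bound for each norm.\<close>

lemma tvs_bounded_B_space_iff:
  fixes M :: "('m::topological_space, 'e::{real_inner, heine_borel}) rmanifold"
  assumes "riemannian M" and U: "open U"
  shows "tvs_bounded (B_space M U k) S \<longleftrightarrow>
    S \<subseteq> B_smooth_forms M U k \<and> (\<forall>r. \<exists>K. \<forall>\<omega>\<in>S. C_norm M U k r \<omega> \<le> K)"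
proof -
  interpret riemannian M by fact
  let ?B = "B_smooth_forms M U k" and ?X = "B_space M U k"
  have Bsub: "subspace ?B" unfolding B_smooth_forms_def using subspace_B_forms[OF U] by (intro subspace_Inter) auto
  have Br: "\<omega> \<in> B_forms M U k r" if "\<omega> \<in> ?B" for \<omega> r using that by (simp add: B_smooth_forms_def)
  have sem: "seminorm_on ?B (C_norm M U k r)" for r
    using seminorm_on_C_norm[OF U, of k r] Br unfolding seminorm_on_def by blast
  have top: "topspace ?X = ?B" by (simp add: B_space_def topspace_seminorm_topology)
  show ?thesis
  proof (intro iffI conjI allI)
    assume S: "tvs_bounded ?X S"
    then show "S \<subseteq> ?B" by (simp add: tvs_bounded_def top)
    fix r
    have "openin ?X {\<omega>\<in>?B. C_norm M U k r (\<omega> - 0) < 1}"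
      unfolding B_space_def by (intro openin_seminorm_ball[OF Bsub _ sem subspace_0[OF Bsub]]) simp
    moreover have "0 \<in> {\<omega>\<in>?B. C_norm M U k r (\<omega> - 0) < 1}"
      using subspace_0[OF Bsub] seminorm_on_zero[OF sem Bsub] by simp
    ultimately obtain t where t: "t > 0" "S \<subseteq> (\<lambda>\<omega>. t *\<^sub>R \<omega>) ` {\<omega>\<in>?B. C_norm M U k r (\<omega> - 0) < 1}"
      using S unfolding tvs_bounded_def by blast
    have "C_norm M U k r \<omega> \<le> t" if \<omega>: "\<omega> \<in> S" for \<omega>
    proof -
      obtain \<eta> where "\<eta> \<in> ?B" "C_norm M U k r \<eta> < 1" "\<omega> = t *\<^sub>R \<eta>" using \<omega> t(2) by auto
      then show ?thesis using t(1) seminorm_onD(3)[OF sem, of \<eta> r t] by simp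
    qed
    then show "\<exists>K. \<forall>\<omega>\<in>S. C_norm M U k r \<omega> \<le> K" by blast
  next
    assume S: "S \<subseteq> ?B \<and> (\<forall>r. \<exists>K. \<forall>\<omega>\<in>S. C_norm M U k r \<omega> \<le> K)"
    show "tvs_bounded ?X S"
      unfolding tvs_bounded_def top
    proof (intro conjI allI impI)
      show "S \<subseteq> ?B" using S by blast
      fix W assume "openin ?X W \<and> 0 \<in> W"
      then obtain F e where F: "finite F" "F \<subseteq> range (C_norm M U k)" "0 < e" "{y\<in>?B. \<forall>p\<in>F. p (y - 0) < e} \<subseteq> W"
        unfolding B_space_def openin_seminorm_topology by blast
      have "\<forall>p\<in>F. \<exists>K. \<forall>\<omega>\<in>S. p \<omega> \<le> K" using F(2) S by blast
      then obtain K where K: "\<And>p \<omega>. p \<in> F \<Longrightarrow> \<omega> \<in> S \<Longrightarrow> p \<omega> \<le> K p" by metis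
      \<comment> \<open>\<open>t * e\<close> exceeds each of the finitely many bounds; the summand 1
        makes the inequality strict and \<open>t\<close> positive.\<close>
      define t where "t = ((\<Sum>p\<in>F. \<bar>K p\<bar>) + 1) / e"
      have sum0: "0 \<le> (\<Sum>p\<in>F. \<bar>K p\<bar>)" by (simp add: sum_nonneg)
      have "0 < (\<Sum>p\<in>F. \<bar>K p\<bar>) + 1" using sum0 by linarith
      then have t: "t > 0" using F(3) unfolding t_def by (rule divide_pos_pos)
      have "S \<subseteq> (\<lambda>\<omega>. t *\<^sub>R \<omega>) ` W"
      proof
        fix \<omega> assume \<omega>: "\<omega> \<in> S"
        then have B: "\<omega> \<in> ?B" using S by blast
        have "p ((1/t) *\<^sub>R \<omega>) < e" if p: "p \<in> F" for p
        proof -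
          obtain r where "p = C_norm M U k r" using p F(2) by blast
          then have "p ((1/t) *\<^sub>R \<omega>) = p \<omega> / t" using seminorm_onD(3)[OF sem B, of r "1/t"] t by simp
          moreover have "p \<omega> \<le> (\<Sum>p\<in>F. \<bar>K p\<bar>)"
            using K[OF p \<omega>] member_le_sum[OF p, of "\<lambda>p. \<bar>K p\<bar>"] F(1) by simp
          then have "p \<omega> < t * e" using F(3) by (simp add: t_def)
          ultimately show ?thesis using t by (simp add: divide_less_eq mult.commute)
        qed
        then have "(1/t) *\<^sub>R \<omega> \<in> W" using F(4) B subspace_scale[OF Bsub B, of "1/t"] by auto
        then show "\<omega> \<in> (\<lambda>\<omega>. t *\<^sub>R \<omega>) ` W" using t by (intro image_eqI[of _ _ "(1/t) *\<^sub>R \<omega>"]) auto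
      qed
      then show "\<exists>t>0. S \<subseteq> (\<lambda>\<omega>. t *\<^sub>R \<omega>) ` W" using t by blast
    qed
  qed
qed

text \<open>The completions and the limit enter only through their defining properties, so the
  result holds for every realisation; \<open>C\<close> is the space of differential chains.\<close>

locale differential_chains = riemannian M
  for M :: "('m::topological_space, 'e::{real_inner, heine_borel}) rmanifold" +
  fixes U :: "'m set" and k :: nat
    and E :: "nat \<Rightarrow> 'b::real_vector set" and N :: "nat \<Rightarrow> 'b \<Rightarrow> real"
    and e :: "nat \<Rightarrow> ('m \<Rightarrow> ('e list \<Rightarrow> real) \<Rightarrow> real) \<Rightarrow> 'b" and i :: "nat \<Rightarrow> 'b \<Rightarrow> 'b"
    and L :: "'l::real_vector topology" and lam :: "nat \<Rightarrow> 'b \<Rightarrow> 'l"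
    and C :: "'c::real_vector topology" and \<kappa> :: "'l \<Rightarrow> 'c"
  assumes U: "open U"
    and completion: "\<And>r. banach_completion (pointed_chains U k) (B_norm M U k r) (E r) (N r) (e r)"
    and canonical: "canonical_maps (pointed_chains U k) E N e i"
    and limit: "lc_inductive_limit (\<lambda>r. norm_topology (E r) (N r)) i L lam"
    and lcs_completion: "lcs_completion L C \<kappa>"
begin

abbreviation "P \<equiv> pointed_chains U k :: ('m \<Rightarrow> ('e list \<Rightarrow> real) \<Rightarrow> real) set"
abbreviation "B \<equiv> B_smooth_forms M U k"
abbreviation "V \<equiv> topspace C"

definition \<iota> :: "('m \<Rightarrow> ('e list \<Rightarrow> real) \<Rightarrow> real) \<Rightarrow> 'c"
  where "\<iota> = (\<lambda>A. \<kappa> (lam 0 (e 0 A)))"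

lemma top_norm [simp]: "topspace (norm_topology (E r) (N r)) = E r"
  by (simp add: norm_topology_def topspace_seminorm_topology)

lemma E_banach: "banach_on (E r) (N r)"
  using completion[of r] by (simp add: banach_completion_def)

lemma E_sub: "subspace (E r)" and N_sem: "seminorm_on (E r) (N r)"
  using E_banach[of r] unfolding banach_on_def seminorm_on_def by auto

lemma e_lin: "linear_on P (e r)" and e_mem: "A \<in> P \<Longrightarrow> e r A \<in> E r"
  and N_e: "A \<in> P \<Longrightarrow> N r (e r A) = B_norm M U k r A"
  and e_dense: "x \<in> E r \<Longrightarrow> 0 < \<epsilon> \<Longrightarrow> \<exists>A\<in>P. N r (x - e r A) < \<epsilon>"
  using completion[of r] unfolding banach_completion_def by blast+

lemma i_lin: "linear_on (E r) (i r)" and i_e: "A \<in> P \<Longrightarrow> i r (e r A) = e (Suc r) A"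
  and i_cont: "continuous_map (norm_topology (E r) (N r)) (norm_topology (E (Suc r)) (N (Suc r))) (i r)"
  using canonical unfolding canonical_maps_def by blast+

lemma i_mem: "x \<in> E r \<Longrightarrow> i r x \<in> E (Suc r)"
  using i_cont[of r] by (auto simp: continuous_map_def)

lemma lam_lin: "linear_on (E r) (lam r)" and lam_i: "x \<in> E r \<Longrightarrow> lam (Suc r) (i r x) = lam r x"
  and top_L: "topspace L = (\<Union>r. lam r ` E r)"
  and lam_0: "x \<in> E r \<Longrightarrow> lam r x = 0 \<Longrightarrow> \<exists>n. iterate_from i r n x = 0"
  and lcs_L: "lcs L" and lam_cont: "continuous_map (norm_topology (E r) (N r)) L (lam r)"
  using limit unfolding lc_inductive_limit_def by (simp_all add: E_sub)

lemma L_finest: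
  assumes "lcs L'" "topspace L' = topspace L" "\<And>r. continuous_map (norm_topology (E r) (N r)) L' (lam r)" "openin L' W"
  shows "openin L W"
proof -
  have "\<forall>L'. lcs L' \<and> topspace L' = topspace L \<and> (\<forall>r. continuous_map (norm_topology (E r) (N r)) L' (lam r)) \<longrightarrow>
      (\<forall>W. openin L' W \<longrightarrow> openin L W)"
    using limit unfolding lc_inductive_limit_def by (elim conjE)
  then show ?thesis using assms by blast
qed

lemma lam_mem: "x \<in> E r \<Longrightarrow> lam r x \<in> topspace L"
  using top_L by blast

lemma lcs_C: "lcs C" and Hausdorff_C: "Hausdorff_space C" and \<kappa>_lin: "linear_on (topspace L) \<kappa>"
  and \<kappa>_mem: "y \<in> topspace L \<Longrightarrow> \<kappa> y \<in> V"
  and L_pullback: "L = pullback_topology (topspace L) \<kappa> C"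
  and \<kappa>_dense: "C closure_of (\<kappa> ` topspace L) = V"
  using lcs_completion unfolding lcs_completion_def by auto

lemma \<kappa>_dense_open:
  assumes "openin C T" "J \<in> T"
  shows "\<exists>y\<in>topspace L. \<kappa> y \<in> T"
proof -
  have "J \<in> C closure_of (\<kappa> ` topspace L)" using assms openin_subset[OF assms(1)] \<kappa>_dense by auto
  then have "\<forall>T. J \<in> T \<and> openin C T \<longrightarrow> (\<exists>z. z \<in> \<kappa> ` topspace L \<and> z \<in> T)" by (simp add: in_closure_of)
  then have "\<exists>z. z \<in> \<kappa> ` topspace L \<and> z \<in> T" using assms by simp
  then show ?thesis by auto
qed

lemma V_sub: "subspace V" and L_sub: "subspace (topspace L)"
  using lcs_C lcs_L by (auto simp: lcs_def)

lemma B_sub: "subspace B"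
  unfolding B_smooth_forms_def using subspace_B_forms[OF U] by (intro subspace_Inter) auto

lemma B_r: "\<omega> \<in> B \<Longrightarrow> \<omega> \<in> B_forms M U k r"
  by (simp add: B_smooth_forms_def)

lemma openin_L_iff: "openin L W \<longleftrightarrow> (\<exists>O'. openin C O' \<and> W = {y \<in> topspace L. \<kappa> y \<in> O'})"
  by (subst L_pullback) (auto simp: openin_pullback_topology)

lemma lam_e: "A \<in> P \<Longrightarrow> lam r (e r A) = lam 0 (e 0 A)"
proof (induction r)
  case (Suc r)
  have "lam (Suc r) (e (Suc r) A) = lam (Suc r) (i r (e r A))" using i_e[OF Suc.prems] by simp
  also have "\<dots> = lam r (e r A)" by (rule lam_i[OF e_mem[OF Suc.prems]])
  finally show ?case using Suc by simp
qed simp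

lemma \<iota>_eq: "A \<in> P \<Longrightarrow> \<iota> A = \<kappa> (lam r (e r A))"
  using lam_e[of A r] by (simp add: \<iota>_def)

lemma \<iota>_mem: "A \<in> P \<Longrightarrow> \<iota> A \<in> V"
  unfolding \<iota>_def by (intro \<kappa>_mem lam_mem e_mem)

lemma kl_lin: "linear_on (E r) (\<lambda>x. \<kappa> (lam r x))"
  using linear_onD[OF lam_lin] linear_onD[OF \<kappa>_lin] lam_mem unfolding linear_on_def by simp

lemma \<iota>_lin: "linear_on P \<iota>"
  unfolding \<iota>_def linear_on_def using linear_onD[OF kl_lin[of 0]] linear_onD[OF e_lin[of 0]] e_mem by simp

section \<open>Seminorms and density on the inductive limit and its completion\<close>

lemma norm_bound_of_nbhd:
  assumes q: "seminorm_on (topspace L) q" and W: "openin L W" "0 \<in> W" "\<And>y. y \<in> W \<Longrightarrow> q y \<le> 1"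
  shows "\<exists>K>0. \<forall>x\<in>E r. q (lam r x) \<le> K * N r x"
proof -
  have "openin (norm_topology (E r) (N r)) {x \<in> E r. lam r x \<in> W}"
    using openin_continuous_map_preimage[OF lam_cont W(1)] by simp
  moreover have "0 \<in> {x \<in> E r. lam r x \<in> W}"
    using W(2) subspace_0[OF E_sub] linear_on_zero[OF lam_lin E_sub] by simp
  ultimately obtain F d where d: "F \<subseteq> {N r}" "0 < d" "{x\<in>E r. \<forall>p\<in>F. p (x - 0) < d} \<subseteq> {x \<in> E r. lam r x \<in> W}"
    unfolding norm_topology_def openin_seminorm_topology by blast
  have "q (lam r x) \<le> 2 / d * N r x" if "x \<in> E r" for x
  proof (rule bounded_on_norm_ball[OF E_banach q lam_lin _ d(2) _ that])
    show "lam r ` E r \<subseteq> topspace L" using lam_mem by blast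
    show "q (lam r x) \<le> 1" if "x \<in> E r" "N r x < d" for x
      using that d by (intro W(3)) auto
  qed
  then show ?thesis using d(2) by (intro exI[of _ "2 / d"]) auto
qed

text \<open>Compare with the topology of the single seminorm \<open>q\<close>: the bounds make every
  \<open>lam r\<close> continuous into it, so the limit topology, being the finest such, is at least
  as fine.\<close>

lemma openin_L_seminorm_ball:
  assumes q: "seminorm_on (topspace L) q" and K: "\<And>r. \<exists>K. \<forall>x\<in>E r. q (lam r x) \<le> K * N r x"
  shows "openin L {y \<in> topspace L. q y < \<epsilon>}"
proof (rule L_finest[where L' = "seminorm_topology (topspace L) {q}"])
  show "lcs (seminorm_topology (topspace L) {q})" by (rule lcs_seminorm_topology[OF L_sub q])
  show "openin (seminorm_topology (topspace L) {q}) {y \<in> topspace L. q y < \<epsilon>}"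
    using openin_seminorm_ball[OF L_sub _ q subspace_0[OF L_sub], of "{q}" \<epsilon>] by simp
  show "continuous_map (norm_topology (E r) (N r)) (seminorm_topology (topspace L) {q}) (lam r)" for r
    unfolding continuous_map_def
  proof (intro conjI allI impI)
    show "lam r \<in> topspace (norm_topology (E r) (N r)) \<rightarrow> topspace (seminorm_topology (topspace L) {q})"
      using lam_mem by (auto simp: topspace_seminorm_topology)
    fix W assume W: "openin (seminorm_topology (topspace L) {q}) W"
    obtain K where K: "\<And>x. x \<in> E r \<Longrightarrow> q (lam r x) \<le> K * N r x" using K by blast
    show "openin (norm_topology (E r) (N r)) {x \<in> topspace (norm_topology (E r) (N r)). lam r x \<in> W}"
      unfolding norm_topology_def openin_seminorm_topology topspace_seminorm_topology
    proof (intro conjI ballI)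
      fix x assume x: "x \<in> {x \<in> E r. lam r x \<in> W}"
      then obtain F d where d: "F \<subseteq> {q}" "0 < d" "{y\<in>topspace L. \<forall>p\<in>F. p (y - lam r x) < d} \<subseteq> W"
        using W unfolding openin_seminorm_topology by blast
      \<comment> \<open>The sign of \<open>K\<close> is unknown, so \<open>\<bar>K\<bar> + 1\<close>
        is used as a positive bound.\<close>
      have "{y\<in>E r. \<forall>p\<in>{N r}. p (y - x) < d / (\<bar>K\<bar> + 1)} \<subseteq> {x \<in> E r. lam r x \<in> W}"
      proof clarify
        fix y assume y: "y \<in> E r" "\<forall>p\<in>{N r}. p (y - x) < d / (\<bar>K\<bar> + 1)"
        have yx: "y - x \<in> E r" using x y subspace_diff[OF E_sub] by blast
        have "q (lam r y - lam r x) = q (lam r (y - x))" using linear_on_diff[OF lam_lin E_sub y(1)] x by simp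
        also have "\<dots> \<le> K * N r (y - x)" by (rule K[OF yx])
        also have "\<dots> \<le> (\<bar>K\<bar> + 1) * N r (y - x)" using seminorm_onD(1)[OF N_sem yx] by (intro mult_right_mono) auto
        also have "\<dots> < d" using y by (simp add: field_simps)
        finally have "lam r y \<in> W" using d(1,3) lam_mem[OF y(1)] by auto
        then show "lam r y \<in> W" .
      qed
      then show "\<exists>F \<epsilon>. finite F \<and> F \<subseteq> {N r} \<and> 0 < \<epsilon> \<and> {y\<in>E r. \<forall>p\<in>F. p (y - x) < \<epsilon>} \<subseteq> {x \<in> E r. lam r x \<in> W}"
        using d(2) by (intro exI[of _ "{N r}"] exI[of _ "d / (\<bar>K\<bar> + 1)"]) auto
    qed auto
  qed
qed (simp add: topspace_seminorm_topology)

text \<open>Yields, for each order, the constant with which a continuous seminorm on chains is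
  dominated by the norm of \<open>E r\<close>; for a gauge these constants become the radii
  \<open>K r\<close> of the balls of forms.\<close>

lemma continuous_seminorm_L_bound:
  assumes q: "continuous_seminorm C q"
  shows "\<exists>K>0. \<forall>x\<in>E r. q (\<kappa> (lam r x)) \<le> K * N r x"
proof -
  obtain W where W: "openin C W" "0 \<in> W" "\<And>x. x \<in> W \<Longrightarrow> q x \<le> 1" using q by (auto simp: continuous_seminorm_def)
  have q': "seminorm_on V q" using q by (simp add: continuous_seminorm_def)
  have s: "seminorm_on (topspace L) (\<lambda>y. q (\<kappa> y))"
    unfolding seminorm_on_def using \<kappa>_mem linear_onD[OF \<kappa>_lin] seminorm_onD[OF q'] by simp
  show ?thesis
  proof (rule norm_bound_of_nbhd[OF s])
    show "openin L {y \<in> topspace L. \<kappa> y \<in> W}" using openin_L_iff W(1) by blast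
    show "0 \<in> {y \<in> topspace L. \<kappa> y \<in> W}" using W(2) subspace_0[OF L_sub] linear_on_zero[OF \<kappa>_lin L_sub] by simp
  qed (use W in auto)
qed

text \<open>Two approximations of size \<open>\<epsilon> / 2\<close>: \<open>J\<close> by the image
  of some \<open>x\<close> in a Banach space \<open>E r\<close>, then \<open>x\<close> by a pointed
  chain, where the bound of \<open>q\<close> on \<open>E r\<close> measures the error.\<close>

lemma \<iota>_dense:
  assumes q: "continuous_seminorm C q" and J: "J \<in> V" and \<epsilon>: "0 < \<epsilon>"
  shows "\<exists>A\<in>P. q (J - \<iota> A) < \<epsilon>"
proof -
  have q': "seminorm_on V q" using q by (simp add: continuous_seminorm_def)
  define T where "T = {x \<in> V. q (x - J) < \<epsilon> / 2}"
  have "openin C T" unfolding T_def by (rule openin_continuous_seminorm_ball[OF lcs_C q J])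
  moreover have "J \<in> T" using J \<epsilon> seminorm_on_zero[OF q' V_sub] by (simp add: T_def)
  ultimately obtain y where "y \<in> topspace L" "\<kappa> y \<in> T" using \<kappa>_dense_open by blast
  then have y: "y \<in> topspace L" "q (\<kappa> y - J) < \<epsilon> / 2" by (auto simp: T_def)
  obtain r x where x: "x \<in> E r" "y = lam r x" using y(1) top_L by blast
  obtain K where K: "K > 0" "\<And>x. x \<in> E r \<Longrightarrow> q (\<kappa> (lam r x)) \<le> K * N r x"
    using continuous_seminorm_L_bound[OF q] by blast
  obtain A where A: "A \<in> P" "N r (x - e r A) < \<epsilon> / (2 * K)" using e_dense[OF x(1), of "\<epsilon> / (2 * K)"] \<epsilon> K(1) by auto
  have "q (\<kappa> y - \<iota> A) = q (\<kappa> (lam r (x - e r A)))"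
    using linear_on_diff[OF kl_lin E_sub x(1) e_mem[OF A(1)]] x(2) \<iota>_eq[OF A(1)] by simp
  also have "\<dots> \<le> K * N r (x - e r A)" using x e_mem[OF A(1)] by (intro K(2) subspace_diff[OF E_sub])
  also have "\<dots> < \<epsilon> / 2" using A(2) K(1) by (simp add: field_simps)
  finally have "q (\<kappa> y - \<iota> A) < \<epsilon> / 2" .
  moreover have "q (J - \<kappa> y) = q (\<kappa> y - J)"
    using seminorm_on_minus[OF q', of "\<kappa> y - J"] \<kappa>_mem[OF y(1)] J subspace_diff[OF V_sub] by simp
  ultimately have "q (J - \<iota> A) < \<epsilon>"
    using seminorm_on_triangle[OF q' V_sub J \<kappa>_mem[OF y(1)] \<iota>_mem[OF A(1)]] y(2) by simp
  then show ?thesis using A(1) by blast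
qed

text \<open>Density of pointed chains; this is the uniqueness behind the \<open>THE\<close> of
  \<open>form_extension\<close>.\<close>

lemma tvs_dual_eqI:
  assumes f: "f \<in> tvs_dual C" "g \<in> tvs_dual C" and eq: "\<And>A. A \<in> P \<Longrightarrow> f (\<iota> A) = g (\<iota> A)"
  shows "f = g"
proof
  fix J
  define h where "h = (\<lambda>x. 1 * f x + (-1) * g x)"
  have h: "h \<in> tvs_dual C" unfolding h_def by (rule tvs_dual_lincomb[OF f])
  show "f J = g J"
  proof (cases "J \<in> V")
    case False
    then show ?thesis using f by (simp add: tvs_dual_def)
  next
    case True
    have "\<bar>h J\<bar> < \<epsilon>" if \<epsilon>: "\<epsilon> > 0" for \<epsilon>
    proof -
      obtain A where A: "A \<in> P" "\<bar>h (J - \<iota> A)\<bar> < \<epsilon>"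
        using \<iota>_dense[OF continuous_seminorm_tvs_dual[OF lcs_C h] True \<epsilon>] by blast
      have "h (J - \<iota> A) = h J - h (\<iota> A)"
        using linear_on_diff[OF _ V_sub True \<iota>_mem[OF A(1)], of h] h unfolding tvs_dual_def by blast
      then show ?thesis using A eq[OF A(1)] by (simp add: h_def)
    qed
    from this[of "\<bar>h J\<bar>"] have "h J = 0" by auto
    then show ?thesis by (simp add: h_def)
  qed
qed

end

section \<open>Extension of forms to continuous functionals on chains\<close>

context differential_chains
begin

text \<open>On pointed chains integration is dominated by the norm of \<open>E r\<close> with
  constant \<open>C_norm\<close>, so it extends with the same constant.\<close>

lemma form_on_E:
  assumes w: "\<omega> \<in> B"
  shows "\<exists>f. linear_on (E r) f \<and> (\<forall>A\<in>P. f (e r A) = chain_integral A \<omega>) \<and>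
    (\<forall>x\<in>E r. \<bar>f x\<bar> \<le> C_norm M U k r \<omega> * N r x)"
proof -
  have c: "0 \<le> C_norm M U k r \<omega>" by (rule C_norm_nonneg[OF B_r[OF w]])
  have "\<exists>f. linear_on (E r) f \<and> (\<forall>A\<in>P. f (e r A) = chain_integral A \<omega>) \<and>
    (\<forall>x\<in>E r. \<bar>f x\<bar> \<le> C_norm M U k r \<omega> * N r x) \<and> (\<forall>x. x \<notin> E r \<longrightarrow> f x = 0)"
  proof (rule dominated_extension[OF E_sub subspace_pointed_chains e_lin])
    show "e r ` P \<subseteq> E r" using e_mem by blast
    have "C_norm M U k r \<omega> * N r (x + y) \<le> C_norm M U k r \<omega> * N r x + C_norm M U k r \<omega> * N r y"
      if "x \<in> E r" "y \<in> E r" for x y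
      using mult_left_mono[OF seminorm_onD(2)[OF N_sem that] c] by (simp add: distrib_left)
    then show "seminorm_on (E r) (\<lambda>x. C_norm M U k r \<omega> * N r x)"
      unfolding seminorm_on_def using c seminorm_onD[OF N_sem] by simp
    show "linear_on P (\<lambda>A. chain_integral A \<omega>)"
      unfolding linear_on_def by (simp add: chain_integral_add chain_integral_scaleR)
    show "chain_integral A \<omega> \<le> C_norm M U k r \<omega> * N r (e r A)" if "A \<in> P" for A
      using chain_integral_le[OF U that B_r[OF w], of r] N_e[OF that, of r] by (simp add: mult.commute abs_le_iff)
  qed
  then show ?thesis by blast
qed

lemma iterate_mem: "x \<in> E r \<Longrightarrow> iterate_from i r n x \<in> E (r + n)"
  by (induction n) (simp_all add: i_mem)

lemma lam_iterate: "x \<in> E r \<Longrightarrow> lam (r + n) (iterate_from i r n x) = lam r x"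
  by (induction n) (simp_all add: lam_i iterate_mem)

lemma i_bounded: "\<exists>K. \<forall>x\<in>E r. N (Suc r) (i r x) \<le> K * N r x"
proof -
  let ?Y = "norm_topology (E (Suc r)) (N (Suc r))"
  have Y: "openin ?Y {y\<in>E (Suc r). N (Suc r) (y - 0) < 1}"
    unfolding norm_topology_def by (intro openin_seminorm_ball[OF E_sub _ N_sem subspace_0[OF E_sub]]) simp
  have "openin (norm_topology (E r) (N r)) {x \<in> E r. i r x \<in> {y\<in>E (Suc r). N (Suc r) (y - 0) < 1}}"
    using openin_continuous_map_preimage[OF i_cont Y] by (simp only: top_norm)
  moreover have "0 \<in> {x \<in> E r. i r x \<in> {y\<in>E (Suc r). N (Suc r) (y - 0) < 1}}"
    using subspace_0[OF E_sub] linear_on_zero[OF i_lin E_sub] seminorm_on_zero[OF N_sem E_sub] by simp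
  ultimately obtain F d where d: "F \<subseteq> {N r}" "0 < d"
    "{x\<in>E r. \<forall>p\<in>F. p (x - 0) < d} \<subseteq> {x \<in> E r. i r x \<in> {y\<in>E (Suc r). N (Suc r) (y - 0) < 1}}"
    unfolding norm_topology_def openin_seminorm_topology by blast
  have "N (Suc r) (i r x) \<le> 2 / d * N r x" if "x \<in> E r" for x
  proof (rule bounded_on_norm_ball[OF E_banach N_sem i_lin _ d(2) _ that])
    show "i r ` E r \<subseteq> E (Suc r)" using i_mem by blast
    show "N (Suc r) (i r x) \<le> 1" if x: "x \<in> E r" "N r x < d" for x
    proof -
      have "x \<in> {x\<in>E r. \<forall>p\<in>F. p (x - 0) < d}" using x d(1) by auto
      then show ?thesis using d(3) by fastforce
    qed
  qed
  then show ?thesis by blast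
qed

text \<open>The extensions on the Banach spaces agree along the maps \<open>i r\<close> because
  pointed chains are dense, so they descend to the limit. Two representatives of a limit element are
  compared at a common level, where their difference is eventually killed by the maps.\<close>

lemma form_on_L:
  assumes w: "\<omega> \<in> B"
  shows "\<exists>F. linear_on (topspace L) F \<and> (\<forall>A\<in>P. F (lam 0 (e 0 A)) = chain_integral A \<omega>) \<and>
    (\<forall>r. \<forall>x\<in>E r. \<bar>F (lam r x)\<bar> \<le> C_norm M U k r \<omega> * N r x)"
proof -
  let ?c = "\<lambda>r. C_norm M U k r \<omega>"
  have "\<forall>r. \<exists>f. linear_on (E r) f \<and> (\<forall>A\<in>P. f (e r A) = chain_integral A \<omega>) \<and>
      (\<forall>x\<in>E r. \<bar>f x\<bar> \<le> ?c r * N r x)"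
    using form_on_E[OF w] by blast
  from choice[OF this] obtain f where f: "\<And>r. linear_on (E r) (f r)" "\<And>r A. A \<in> P \<Longrightarrow> f r (e r A) = chain_integral A \<omega>"
    "\<And>r x. x \<in> E r \<Longrightarrow> \<bar>f r x\<bar> \<le> ?c r * N r x"
    by blast
  have c: "0 \<le> ?c r" for r by (rule C_norm_nonneg[OF B_r[OF w]])
  have fi: "f (Suc r) (i r x) = f r x" if x: "x \<in> E r" for r x
  proof -
    obtain K where K: "\<And>x. x \<in> E r \<Longrightarrow> N (Suc r) (i r x) \<le> K * N r x" using i_bounded by blast
    \<comment> \<open>\<open>K'\<close> collects the two operator bounds applied to the
      approximation error; the summand 1 makes it positive.\<close>
    define K' where "K' = ?c (Suc r) * \<bar>K\<bar> + ?c r + 1"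
    have K': "K' > 0" using c by (simp add: K'_def add_nonneg_pos)
    have "\<bar>f (Suc r) (i r x) - f r x\<bar> \<le> \<epsilon>" if \<epsilon>: "0 < \<epsilon>" for \<epsilon>
    proof -
      obtain A where A: "A \<in> P" "N r (x - e r A) < \<epsilon> / K'" using e_dense[OF x, of "\<epsilon> / K'"] \<epsilon> K' by auto
      define y where "y = x - e r A"
      have y: "y \<in> E r" unfolding y_def by (intro subspace_diff[OF E_sub] x e_mem A)
      have Ny: "0 \<le> N r y" by (rule seminorm_onD(1)[OF N_sem y])
      have "f (Suc r) (i r x) - f r x = f (Suc r) (i r y) - f r y"
        using linear_on_diff[OF i_lin E_sub x e_mem[OF A(1)]] linear_on_diff[OF f(1) E_sub x e_mem[OF A(1)]]
          linear_on_diff[OF f(1)[of "Suc r"] E_sub i_mem[OF x] e_mem[OF A(1)]] i_e[OF A(1)] f(2)[OF A(1)]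
        by (simp add: y_def)
      also have "\<bar>\<dots>\<bar> \<le> ?c (Suc r) * N (Suc r) (i r y) + ?c r * N r y"
        using f(3)[OF i_mem[OF y]] f(3)[OF y] by simp
      also have "\<dots> \<le> ?c (Suc r) * (\<bar>K\<bar> * N r y) + ?c r * N r y"
      proof -
        have "N (Suc r) (i r y) \<le> \<bar>K\<bar> * N r y"
          using K[OF y] mult_right_mono[OF abs_ge_self[of K] Ny] by simp
        then show ?thesis using c by (intro add_right_mono mult_left_mono) auto
      qed
      also have "\<dots> \<le> K' * N r y" using Ny by (simp add: K'_def algebra_simps)
      also have "\<dots> \<le> \<epsilon>" using A(2) K' by (simp add: y_def field_simps)
      finally show ?thesis .
    qed
    from field_le_epsilon[of "\<bar>f (Suc r) (i r x) - f r x\<bar>" 0] this show ?thesis by simp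
  qed
  have fit: "f (r + n) (iterate_from i r n x) = f r x" if "x \<in> E r" for r n x
    using that by (induction n) (simp_all add: fi iterate_mem)
  have common: "\<exists>x'\<in>E (r + n). lam (r + n) x' = lam r x \<and> f (r + n) x' = f r x" if "x \<in> E r" for r n x
    using iterate_mem[OF that] lam_iterate[OF that] fit[OF that] by blast
  \<comment> \<open>A kernel element of \<open>lam r\<close> need not be 0 in \<open>E r\<close>; it
    becomes 0 at a later level, where \<open>f\<close> still has the same value.\<close>
  have zero: "f r x = 0" if x: "x \<in> E r" and 0: "lam r x = 0" for r x
  proof -
    obtain n where n: "iterate_from i r n x = 0" using lam_0[OF x 0] by blast
    show ?thesis using fit[OF x, of n] n linear_on_zero[OF f(1) E_sub, of "r + n"] by simp
  qed
  have pair: "\<exists>m. \<exists>x'\<in>E m. \<exists>y'\<in>E m. lam m x' = lam r x \<and> f m x' = f r x \<and> lam m y' = lam s y \<and> f m y' = f s y"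
    if "x \<in> E r" "y \<in> E s" for r s x y
  proof -
    have "\<exists>x'\<in>E (r + s). lam (r + s) x' = lam r x \<and> f (r + s) x' = f r x" using common[OF that(1)] .
    moreover have "\<exists>y'\<in>E (r + s). lam (r + s) y' = lam s y \<and> f (r + s) y' = f s y"
      using common[OF that(2), of r] by (simp add: add.commute)
    ultimately show ?thesis by blast
  qed
  have wd: "f r x = f s y" if x: "x \<in> E r" and y: "y \<in> E s" and eq: "lam r x = lam s y" for r s x y
  proof -
    obtain m x' y' where m: "x' \<in> E m" "y' \<in> E m" "lam m x' = lam r x" "f m x' = f r x" "lam m y' = lam s y" "f m y' = f s y"
      using pair[OF x y] by blast
    have "f m (x' - y') = 0"
      using m eq linear_on_diff[OF lam_lin E_sub m(1,2)] by (intro zero subspace_diff[OF E_sub]) auto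
    then show ?thesis using linear_on_diff[OF f(1) E_sub m(1,2)] m by simp
  qed
  define F where "F = (\<lambda>y. case SOME (r, x). x \<in> E r \<and> lam r x = y of (r, x) \<Rightarrow> f r x)"
  have F: "F (lam r x) = f r x" if x: "x \<in> E r" for r x
  proof -
    obtain s z where sz: "(SOME (s, z). z \<in> E s \<and> lam s z = lam r x) = (s, z)" by (rule prod.exhaust)
    have "(\<lambda>(s, z). z \<in> E s \<and> lam s z = lam r x) (SOME (s, z). z \<in> E s \<and> lam s z = lam r x)"
      by (rule someI[of _ "(r, x)"]) (use x in simp)
    then have "z \<in> E s" "lam s z = lam r x" unfolding sz by auto
    then have "f s z = f r x" by (intro wd x)
    then show ?thesis by (simp add: F_def sz)
  qed
  have "linear_on (topspace L) F"
    unfolding linear_on_def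
  proof (intro conjI ballI allI)
    fix y z assume "y \<in> topspace L" "z \<in> topspace L"
    then obtain r x s x2 where "x \<in> E r" "y = lam r x" "x2 \<in> E s" "z = lam s x2" unfolding top_L by blast
    then obtain m a b where m: "a \<in> E m" "b \<in> E m" "y = lam m a" "z = lam m b" using pair[of x r x2 s] by metis
    have "F (y + z) = F (lam m (a + b))" using m linear_onD(1)[OF lam_lin m(1,2)] by simp
    also have "\<dots> = f m a + f m b" using F[OF subspace_add[OF E_sub m(1,2)]] linear_onD(1)[OF f(1) m(1,2)] by simp
    finally show "F (y + z) = F y + F z" using m F by simp
  next
    fix c y assume "y \<in> topspace L"
    then obtain r x where x: "x \<in> E r" "y = lam r x" unfolding top_L by blast
    have "F (c *\<^sub>R y) = F (lam r (c *\<^sub>R x))" using x linear_onD(2)[OF lam_lin x(1)] by simp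
    also have "\<dots> = c *\<^sub>R f r x" using F[OF subspace_scale[OF E_sub x(1)]] linear_onD(2)[OF f(1) x(1)] by simp
    finally show "F (c *\<^sub>R y) = c *\<^sub>R F y" using x F by simp
  qed
  then show ?thesis using F f e_mem by (intro exI[of _ F]) auto
qed

text \<open>The topology of \<open>L\<close> is induced by \<open>\<kappa>\<close>, so the set where
  the functional on \<open>L\<close> is below 1 is the trace of a neighbourhood in \<open>C\<close>.
  The gauge of that neighbourhood dominates integration over pointed chains, and Hahn-Banach gives
  the extension.\<close>

lemma form_on_C:
  assumes w: "\<omega> \<in> B"
  shows "\<exists>f\<in>tvs_dual C. \<forall>A\<in>P. f (\<iota> A) = chain_integral A \<omega>"
proof -
  obtain F where F: "linear_on (topspace L) F" "\<And>A. A \<in> P \<Longrightarrow> F (lam 0 (e 0 A)) = chain_integral A \<omega>"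
    "\<And>r x. x \<in> E r \<Longrightarrow> \<bar>F (lam r x)\<bar> \<le> C_norm M U k r \<omega> * N r x"
    using form_on_L[OF w] by blast
  have "openin L {y \<in> topspace L. \<bar>F y\<bar> < 1}"
    using F(3) by (intro openin_L_seminorm_ball seminorm_on_abs_linear[OF F(1)]) blast
  then obtain W where W: "openin C W" "{y \<in> topspace L. \<bar>F y\<bar> < 1} = {y \<in> topspace L. \<kappa> y \<in> W}"
    unfolding openin_L_iff by blast
  have "0 \<in> {y \<in> topspace L. \<bar>F y\<bar> < 1}" using linear_on_zero[OF F(1) L_sub] subspace_0[OF L_sub] by simp
  then have "\<kappa> 0 \<in> W" using W(2) by blast
  then have W0: "0 \<in> W" using linear_on_zero[OF \<kappa>_lin L_sub] by simp
  obtain q where q: "seminorm_on V q" "\<And>x. x \<in> V \<Longrightarrow> q x < 1 \<Longrightarrow> x \<in> W"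
    "\<exists>O'. openin C O' \<and> 0 \<in> O' \<and> (\<forall>x\<in>O'. q x \<le> 1)"
    using minkowski_seminorm[OF lcs_C W(1) W0] by blast
  \<comment> \<open>If \<open>q\<close> were smaller somewhere, normalising to
    \<open>\<bar>F z\<bar> = 1\<close> would put \<open>z\<close> into the set where
    \<open>\<bar>F z\<bar> < 1\<close>.\<close>
  have Fq: "\<bar>F y\<bar> \<le> q (\<kappa> y)" if y: "y \<in> topspace L" for y
  proof (rule ccontr)
    assume "\<not> ?thesis"
    then have less: "q (\<kappa> y) < \<bar>F y\<bar>" by simp
    then have pos: "0 < \<bar>F y\<bar>" using seminorm_onD(1)[OF q(1) \<kappa>_mem[OF y]] by linarith
    define z where "z = (1 / \<bar>F y\<bar>) *\<^sub>R y"
    have z: "z \<in> topspace L" unfolding z_def by (rule subspace_scale[OF L_sub y])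
    have "q (\<kappa> z) = q (\<kappa> y) / \<bar>F y\<bar>"
      using linear_onD(2)[OF \<kappa>_lin y] seminorm_onD(3)[OF q(1) \<kappa>_mem[OF y]] by (simp add: z_def)
    also have "\<dots> < 1" using less pos by simp
    finally have "z \<in> {y \<in> topspace L. \<kappa> y \<in> W}" using q(2) \<kappa>_mem[OF z] z by simp
    then have "\<bar>F z\<bar> < 1" using W(2) by blast
    moreover have "\<bar>F z\<bar> = 1" using linear_onD(2)[OF F(1) y] pos by (simp add: z_def abs_mult)
    ultimately show False by simp
  qed
  have "\<exists>g. linear_on V g \<and> (\<forall>A\<in>P. g (\<iota> A) = chain_integral A \<omega>) \<and> (\<forall>x\<in>V. \<bar>g x\<bar> \<le> q x) \<and> (\<forall>x. x \<notin> V \<longrightarrow> g x = 0)"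
  proof (rule dominated_extension[OF V_sub subspace_pointed_chains \<iota>_lin _ q(1)])
    show "\<iota> ` P \<subseteq> V" using \<iota>_mem by blast
    show "linear_on P (\<lambda>A. chain_integral A \<omega>)"
      unfolding linear_on_def by (simp add: chain_integral_add chain_integral_scaleR)
    show "chain_integral A \<omega> \<le> q (\<iota> A)" if "A \<in> P" for A
      using Fq[OF lam_mem[OF e_mem[OF that]], of 0] F(2)[OF that] by (simp add: \<iota>_def abs_le_iff)
  qed
  then obtain g where g: "linear_on V g" "\<forall>A\<in>P. g (\<iota> A) = chain_integral A \<omega>" "\<forall>x\<in>V. \<bar>g x\<bar> \<le> q x" "\<forall>x. x \<notin> V \<longrightarrow> g x = 0"
    by blast
  have "g \<in> tvs_dual C"
    using g q by (intro tvs_dualI[OF lcs_C, of q]) (auto simp: continuous_seminorm_def)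
  then show ?thesis using g(2) by blast
qed

abbreviation "ext \<equiv> form_extension U k C \<iota>"

lemma ext_form:
  assumes w: "\<omega> \<in> B"
  shows "ext \<omega> \<in> tvs_dual C" "A \<in> P \<Longrightarrow> ext \<omega> (\<iota> A) = chain_integral A \<omega>"
proof -
  have "\<exists>!f. f \<in> tvs_dual C \<and> (\<forall>A\<in>P. f (\<iota> A) = chain_integral A \<omega>)"
  proof (rule ex_ex1I)
    show "\<exists>f. f \<in> tvs_dual C \<and> (\<forall>A\<in>P. f (\<iota> A) = chain_integral A \<omega>)" using form_on_C[OF w] by blast
    show "f = g" if "f \<in> tvs_dual C \<and> (\<forall>A\<in>P. f (\<iota> A) = chain_integral A \<omega>)"
      "g \<in> tvs_dual C \<and> (\<forall>A\<in>P. g (\<iota> A) = chain_integral A \<omega>)" for f g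
      using that by (intro tvs_dual_eqI) auto
  qed
  from theI'[OF this] show "ext \<omega> \<in> tvs_dual C" "A \<in> P \<Longrightarrow> ext \<omega> (\<iota> A) = chain_integral A \<omega>"
    unfolding form_extension_def by blast+
qed

lemma ext_eqI: "\<omega> \<in> B \<Longrightarrow> f \<in> tvs_dual C \<Longrightarrow> (\<And>A. A \<in> P \<Longrightarrow> f (\<iota> A) = chain_integral A \<omega>) \<Longrightarrow> ext \<omega> = f"
  using ext_form by (intro tvs_dual_eqI) auto

lemma ext_linear: "\<omega> \<in> B \<Longrightarrow> linear_on V (ext \<omega>)"
  using ext_form(1) by (simp add: tvs_dual_def)

lemma ext_lincomb:
  assumes "\<omega> \<in> B" "\<eta> \<in> B"
  shows "ext (a *\<^sub>R \<omega> + b *\<^sub>R \<eta>) = (\<lambda>x. a * ext \<omega> x + b * ext \<eta> x)"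
proof (rule ext_eqI)
  show "a *\<^sub>R \<omega> + b *\<^sub>R \<eta> \<in> B" using assms by (intro subspace_add[OF B_sub] subspace_scale[OF B_sub])
  show "(\<lambda>x. a * ext \<omega> x + b * ext \<eta> x) \<in> tvs_dual C" using assms by (intro tvs_dual_lincomb ext_form)
  show "a * ext \<omega> (\<iota> A) + b * ext \<eta> (\<iota> A) = chain_integral A (a *\<^sub>R \<omega> + b *\<^sub>R \<eta>)" if "A \<in> P" for A
    using chain_integral_lincomb[OF that B_r[OF assms(1), of 0] B_r[OF assms(2), of 0], of a b] assms that ext_form by simp
qed

text \<open>Continuity gives some constant on \<open>E r\<close>; density of pointed chains improves
  it to \<open>C_norm\<close>. This constant makes the estimate uniform over a bounded set of
  forms.\<close>

lemma ext_bound: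
  assumes w: "\<omega> \<in> B" and x: "x \<in> E r"
  shows "\<bar>ext \<omega> (\<kappa> (lam r x))\<bar> \<le> C_norm M U k r \<omega> * N r x"
proof -
  let ?f = "\<lambda>x. ext \<omega> (\<kappa> (lam r x))"
  have lin: "linear_on (E r) ?f"
    using linear_onD[OF kl_lin] linear_onD[OF ext_linear[OF w]] \<kappa>_mem[OF lam_mem] unfolding linear_on_def by simp
  have c: "0 \<le> C_norm M U k r \<omega>" by (rule C_norm_nonneg[OF B_r[OF w]])
  obtain K where K: "K > 0" "\<And>x. x \<in> E r \<Longrightarrow> \<bar>?f x\<bar> \<le> K * N r x"
    using continuous_seminorm_L_bound[OF continuous_seminorm_tvs_dual[OF lcs_C ext_form(1)[OF w]], of r] by blast
  show ?thesis
  proof (rule field_le_epsilon)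
    fix \<epsilon> :: real assume \<epsilon>: "0 < \<epsilon>"
    define K' where "K' = K + C_norm M U k r \<omega>"
    have K': "K' > 0" using K c by (simp add: K'_def add_pos_nonneg)
    obtain A where A: "A \<in> P" "N r (x - e r A) < \<epsilon> / K'" using e_dense[OF x, of "\<epsilon> / K'"] \<epsilon> K' by auto
    define y where "y = x - e r A"
    have y: "y \<in> E r" unfolding y_def by (intro subspace_diff[OF E_sub] x e_mem A)
    have "?f x = ?f y + ?f (e r A)" using linear_on_diff[OF lin E_sub x e_mem[OF A(1)]] by (simp add: y_def)
    moreover have "?f (e r A) = chain_integral A \<omega>" using ext_form(2)[OF w A(1)] \<iota>_eq[OF A(1), of r] by simp
    moreover have "\<bar>chain_integral A \<omega>\<bar> \<le> C_norm M U k r \<omega> * N r (e r A)"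
      using chain_integral_le[OF U A(1) B_r[OF w], of r] N_e[OF A(1), of r] by (simp add: mult.commute)
    moreover have "N r (e r A) \<le> N r x + N r y"
      using seminorm_onD(2)[OF N_sem x, of "- y"] seminorm_on_minus[OF N_sem y] y subspace_neg[OF E_sub y]
      by (simp add: y_def)
    then have "C_norm M U k r \<omega> * N r (e r A) \<le> C_norm M U k r \<omega> * (N r x + N r y)" using c by (rule mult_left_mono)
    ultimately have "\<bar>?f x\<bar> \<le> K * N r y + C_norm M U k r \<omega> * (N r x + N r y)" using K(2)[OF y] by simp
    also have "\<dots> = C_norm M U k r \<omega> * N r x + K' * N r y" by (simp add: K'_def algebra_simps)
    also have "K' * N r y \<le> \<epsilon>" using A(2) K' by (simp add: y_def field_simps)
    finally show "\<bar>?f x\<bar> \<le> C_norm M U k r \<omega> * N r x + \<epsilon>" by simp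
  qed
qed

text \<open>The supremum over \<open>S\<close> of the extended forms is a seminorm bounded on every
  \<open>E r\<close>, hence its unit ball is open in \<open>L\<close>. This ball is the trace of an
  open set of \<open>C\<close>, and density carries the estimate to all points of that set.\<close>

lemma bounded_equicontinuous:
  assumes S: "S \<subseteq> B" "\<And>r. \<exists>K. \<forall>\<omega>\<in>S. C_norm M U k r \<omega> \<le> K" "S \<noteq> {}"
  shows "\<exists>W. openin C W \<and> 0 \<in> W \<and> (\<forall>J\<in>W. \<forall>\<omega>\<in>S. \<bar>ext \<omega> J\<bar> \<le> 1)"
proof -
  define Q where "Q = (\<lambda>y. SUP \<omega>\<in>S. \<bar>ext \<omega> (\<kappa> y)\<bar>)"
  have B: "\<omega> \<in> B" if "\<omega> \<in> S" for \<omega> using S(1) that by blast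
  have bound: "\<exists>K. \<forall>x\<in>E r. \<forall>\<omega>\<in>S. \<bar>ext \<omega> (\<kappa> (lam r x))\<bar> \<le> K * N r x" for r
  proof -
    obtain K where K: "\<And>\<omega>. \<omega> \<in> S \<Longrightarrow> C_norm M U k r \<omega> \<le> K" using S(2) by blast
    have "\<bar>ext \<omega> (\<kappa> (lam r x))\<bar> \<le> K * N r x" if "x \<in> E r" "\<omega> \<in> S" for x \<omega>
      using ext_bound[OF B[OF that(2)] that(1)] mult_right_mono[OF K[OF that(2)] seminorm_onD(1)[OF N_sem that(1)]] by simp
    then show ?thesis by blast
  qed
  have bdd: "bdd_above ((\<lambda>\<omega>. \<bar>ext \<omega> (\<kappa> y)\<bar>) ` S)" if y: "y \<in> topspace L" for y
  proof -
    obtain r x where x: "x \<in> E r" "y = lam r x" using y top_L by blast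
    obtain K where "\<And>x \<omega>. x \<in> E r \<Longrightarrow> \<omega> \<in> S \<Longrightarrow> \<bar>ext \<omega> (\<kappa> (lam r x))\<bar> \<le> K * N r x" using bound by blast
    then show ?thesis using x by (intro bdd_aboveI2[of _ _ "K * N r x"]) simp
  qed
  have ge: "\<bar>ext \<omega> (\<kappa> y)\<bar> \<le> Q y" if "y \<in> topspace L" "\<omega> \<in> S" for y \<omega>
    unfolding Q_def by (rule cSUP_upper[OF that(2) bdd[OF that(1)]])
  have le: "Q y \<le> b" if "\<And>\<omega>. \<omega> \<in> S \<Longrightarrow> \<bar>ext \<omega> (\<kappa> y)\<bar> \<le> b" for y b
    unfolding Q_def using S(3) that by (rule cSUP_least)
  have sem: "seminorm_on (topspace L) Q"
    unfolding Q_def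
  proof (rule seminorm_on_SUP[OF L_sub S(3) _ bdd])
    show "linear_on (topspace L) (\<lambda>y. ext \<omega> (\<kappa> y))" if "\<omega> \<in> S" for \<omega>
      using linear_onD[OF \<kappa>_lin] linear_onD[OF ext_linear[OF B[OF that]]] \<kappa>_mem by (simp add: linear_on_def)
  qed
  have "openin L {y \<in> topspace L. Q y < 1}"
  proof (rule openin_L_seminorm_ball[OF sem])
    fix r
    obtain K where "\<And>x \<omega>. x \<in> E r \<Longrightarrow> \<omega> \<in> S \<Longrightarrow> \<bar>ext \<omega> (\<kappa> (lam r x))\<bar> \<le> K * N r x" using bound by blast
    then show "\<exists>K. \<forall>x\<in>E r. Q (lam r x) \<le> K * N r x" by (intro exI[of _ K] ballI le)
  qed
  then obtain W where W: "openin C W" "{y \<in> topspace L. Q y < 1} = {y \<in> topspace L. \<kappa> y \<in> W}"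
    unfolding openin_L_iff by blast
  have "0 \<in> {y \<in> topspace L. Q y < 1}" using seminorm_on_zero[OF sem L_sub] subspace_0[OF L_sub] by simp
  then have "\<kappa> 0 \<in> W" using W(2) by blast
  then have W0: "0 \<in> W" using linear_on_zero[OF \<kappa>_lin L_sub] by simp
  have "\<bar>ext \<omega> J\<bar> \<le> 1" if J: "J \<in> W" and w: "\<omega> \<in> S" for J \<omega>
  proof (rule ccontr)
    assume "\<not> ?thesis"
    then have gt: "1 < \<bar>ext \<omega> J\<bar>" by simp
    have cont: "continuous_map C euclideanreal (\<lambda>x. \<bar>ext \<omega> x\<bar>)"
      using ext_form(1)[OF B[OF w]] by (intro continuous_map_real_abs) (simp add: tvs_dual_def)
    have "openin C {x \<in> V. \<bar>ext \<omega> x\<bar> \<in> {1<..}}" by (rule openin_continuous_map_preimage[OF cont]) simp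
    \<comment> \<open>The part of \<open>W\<close> where the bound fails is open, so by density it
      would meet the image of \<open>L\<close>, where the bound is known.\<close>
    then have "openin C (W \<inter> {x \<in> V. \<bar>ext \<omega> x\<bar> \<in> {1<..}})" using W(1) by blast
    moreover have "J \<in> W \<inter> {x \<in> V. \<bar>ext \<omega> x\<bar> \<in> {1<..}}" using J gt openin_subset[OF W(1)] by auto
    ultimately obtain y where y: "y \<in> topspace L" "\<kappa> y \<in> W \<inter> {x \<in> V. \<bar>ext \<omega> x\<bar> \<in> {1<..}}"
      using \<kappa>_dense_open by blast
    then have "Q y < 1" using W(2) by blast
    then show False using ge[OF y(1) w] y(2) by simp
  qed
  then show ?thesis using W(1) W0 by blast
qed

text \<open>Every \<open>J\<close> is absorbed by the equicontinuity neighbourhood.\<close>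

lemma bounded_pointwise:
  assumes S: "S \<subseteq> B" "\<And>r. \<exists>K. \<forall>\<omega>\<in>S. C_norm M U k r \<omega> \<le> K" "S \<noteq> {}" and J: "J \<in> V"
  shows "\<exists>K. \<forall>\<omega>\<in>S. \<bar>ext \<omega> J\<bar> \<le> K"
proof -
  obtain W where W: "openin C W" "0 \<in> W" "\<And>J \<omega>. J \<in> W \<Longrightarrow> \<omega> \<in> S \<Longrightarrow> \<bar>ext \<omega> J\<bar> \<le> 1"
    using bounded_equicontinuous[OF S] by blast
  obtain s where s: "s > 0" "\<And>t. \<bar>t\<bar> < s \<Longrightarrow> t *\<^sub>R J \<in> W" using lcs_absorbing[OF lcs_C W(1,2) J] by blast
  have "\<bar>ext \<omega> J\<bar> \<le> 2 / s" if w: "\<omega> \<in> S" for \<omega>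
  proof -
    have "\<bar>ext \<omega> ((s/2) *\<^sub>R J)\<bar> \<le> 1" using s by (intro W(3) w) simp
    moreover have "ext \<omega> ((s/2) *\<^sub>R J) = (s/2) * ext \<omega> J"
      using linear_onD(2)[OF ext_linear J, of \<omega>] w S(1) by auto
    ultimately show ?thesis using s(1) by (simp add: abs_mult field_simps)
  qed
  then show ?thesis by blast
qed

section \<open>The evaluation map and the strong topology\<close>

abbreviation "u \<equiv> evaluation_map M U k C \<iota>"

lemma u_eq: "\<omega> \<in> B \<Longrightarrow> u J \<omega> = ext \<omega> J" and u_off: "\<omega> \<notin> B \<Longrightarrow> u J \<omega> = 0"
  by (simp_all add: evaluation_map_def)

lemma u_linear: "linear_on V u"
  unfolding linear_on_def
proof (intro conjI ballI allI ext)
  fix J J' \<omega> assume "J \<in> V" "J' \<in> V"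
  then show "u (J + J') \<omega> = (u J + u J') \<omega>"
    using linear_onD(1)[OF ext_linear] by (cases "\<omega> \<in> B") (simp_all add: u_eq u_off)
next
  fix c J \<omega> assume "J \<in> V"
  then show "u (c *\<^sub>R J) \<omega> = (c *\<^sub>R u J) \<omega>"
    using linear_onD(2)[OF ext_linear] by (cases "\<omega> \<in> B") (simp_all add: u_eq u_off scaleR_fun_def)
qed

lemma top_B: "topspace (B_space M U k) = B"
  by (simp add: B_space_def topspace_seminorm_topology)

lemma C_norm_seminorm: "seminorm_on B (C_norm M U k r)"
  using seminorm_on_C_norm[OF U, of k r] B_r unfolding seminorm_on_def by blast

text \<open>A linear functional on the metrizable space \<open>B\<close> that is bounded on bounded sets is continuous.\<close>

lemma u_norm_bound:
  assumes J: "J \<in> V"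
  shows "\<exists>r K. \<forall>\<omega>\<in>B. \<bar>ext \<omega> J\<bar> \<le> K * C_norm M U k r \<omega>"
proof (rule ccontr)
  assume neg: "\<not> ?thesis"
  have "\<exists>\<omega>. \<omega> \<in> B \<and> real n * C_norm M U k n \<omega> < \<bar>ext \<omega> J\<bar>" for n
    using neg by (meson not_le)
  then obtain w where w: "\<And>n. w n \<in> B" "\<And>n. real n * C_norm M U k n (w n) < \<bar>ext (w n) J\<bar>" by metis
  \<comment> \<open>Scaled so that the absolute value at \<open>J\<close> is \<open>n\<close> while
    the \<open>n\<close>-th norm is at most 1: the sequence is bounded in every norm, but its values
    at \<open>J\<close> are not.\<close>
  define \<eta> where "\<eta> = (\<lambda>n. (real n / \<bar>ext (w n) J\<bar>) *\<^sub>R w n)"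
  have pos: "0 < \<bar>ext (w n) J\<bar>" for n
    using w(2)[of n] mult_nonneg_nonneg[OF of_nat_0_le_iff C_norm_nonneg[OF B_r[OF w(1)]], of n n n] by linarith
  have \<eta>B: "\<eta> n \<in> B" for n unfolding \<eta>_def by (rule subspace_scale[OF B_sub w(1)])
  have small: "C_norm M U k n (\<eta> n) \<le> 1" for n
    using w(2)[of n] pos[of n] seminorm_onD(3)[OF C_norm_seminorm w(1)[of n], of n "real n / \<bar>ext (w n) J\<bar>"]
    by (simp add: \<eta>_def divide_le_eq)
  have "\<exists>K. \<forall>\<omega>\<in>range \<eta>. C_norm M U k r \<omega> \<le> K" for r
  proof -
    \<comment> \<open>The finitely many terms before \<open>r\<close> are summed; later ones are at
      most 1 since the norms increase with the order.\<close>
    have "C_norm M U k r (\<eta> n) \<le> (\<Sum>l<r. C_norm M U k r (\<eta> l)) + 1" for n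
    proof (cases "n < r")
      case True
      then have "C_norm M U k r (\<eta> n) \<le> (\<Sum>l<r. C_norm M U k r (\<eta> l))"
        using C_norm_nonneg[OF B_r[OF \<eta>B]] member_le_sum[of n "{..<r}" "\<lambda>l. C_norm M U k r (\<eta> l)"] by auto
      then show ?thesis by simp
    next
      case False
      then have "C_norm M U k r (\<eta> n) \<le> 1"
        using C_norm_mono[OF B_r[OF \<eta>B], of r n n] small[of n] by simp
      moreover have "0 \<le> (\<Sum>l<r. C_norm M U k r (\<eta> l))" using C_norm_nonneg[OF B_r[OF \<eta>B]] by (simp add: sum_nonneg)
      ultimately show ?thesis by simp
    qed
    then show ?thesis by blast
  qed
  then obtain K where K: "\<And>n. \<bar>ext (\<eta> n) J\<bar> \<le> K"
    using bounded_pointwise[of "range \<eta>" J] \<eta>B J by blast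
  have "\<bar>ext (\<eta> n) J\<bar> = real n" for n
    using ext_lincomb[OF w(1)[of n] w(1)[of n], of "real n / \<bar>ext (w n) J\<bar>" 0] pos[of n] by (simp add: \<eta>_def abs_mult)
  then show False using K reals_Archimedean2[of K] by (metis not_le)
qed

lemma u_mem:
  assumes J: "J \<in> V"
  shows "u J \<in> tvs_dual (B_space M U k)"
proof -
  obtain r K where K: "\<And>\<omega>. \<omega> \<in> B \<Longrightarrow> \<bar>ext \<omega> J\<bar> \<le> K * C_norm M U k r \<omega>" using u_norm_bound[OF J] by blast
  have lin: "linear_on B (u J)"
    unfolding linear_on_def
  proof (intro conjI ballI allI)
    show "u J (\<omega> + \<eta>) = u J \<omega> + u J \<eta>" if "\<omega> \<in> B" "\<eta> \<in> B" for \<omega> \<eta>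
      using ext_lincomb[OF that, of 1 1] that subspace_add[OF B_sub that] by (simp add: u_eq)
    show "u J (c *\<^sub>R \<omega>) = c *\<^sub>R u J \<omega>" if "\<omega> \<in> B" for c \<omega>
      using ext_lincomb[OF that that, of c 0] that subspace_scale[OF B_sub that] by (simp add: u_eq)
  qed
  have "continuous_map (B_space M U k) euclideanreal (u J)"
    unfolding continuous_map_def top_B
  proof (intro conjI allI impI)
    fix T :: "real set" assume "openin euclideanreal T"
    then have T: "open T" by simp
    show "openin (B_space M U k) {\<omega> \<in> B. u J \<omega> \<in> T}"
      unfolding B_space_def openin_seminorm_topology
    proof (intro conjI ballI)
      fix \<omega> assume w: "\<omega> \<in> {\<omega> \<in> B. u J \<omega> \<in> T}"
      then obtain d where d: "d > 0" "ball (u J \<omega>) d \<subseteq> T" using T openE by blast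
      have "{y \<in> B. \<forall>p\<in>{C_norm M U k r}. p (y - \<omega>) < d / (\<bar>K\<bar> + 1)} \<subseteq> {\<omega> \<in> B. u J \<omega> \<in> T}"
      proof clarify
        fix \<eta> assume \<eta>: "\<eta> \<in> B" "\<forall>p\<in>{C_norm M U k r}. p (\<eta> - \<omega>) < d / (\<bar>K\<bar> + 1)"
        have df: "\<eta> - \<omega> \<in> B" using \<eta> w subspace_diff[OF B_sub] by blast
        have "\<bar>u J \<eta> - u J \<omega>\<bar> = \<bar>ext (\<eta> - \<omega>) J\<bar>"
          using linear_on_diff[OF lin B_sub \<eta>(1), of \<omega>] w df \<eta>(1) by (simp add: u_eq)
        also have "\<dots> \<le> K * C_norm M U k r (\<eta> - \<omega>)" by (rule K[OF df])
        also have "\<dots> \<le> (\<bar>K\<bar> + 1) * C_norm M U k r (\<eta> - \<omega>)"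
          using C_norm_nonneg[OF B_r[OF df]] by (intro mult_right_mono) auto
        also have "\<dots> < d" using \<eta> by (simp add: field_simps)
        finally show "u J \<eta> \<in> T" using d(2) by (auto simp: subset_iff dist_real_def abs_minus_commute)
      qed
      then show "\<exists>F \<epsilon>. finite F \<and> F \<subseteq> range (C_norm M U k) \<and> 0 < \<epsilon> \<and> {y \<in> B. \<forall>p\<in>F. p (y - \<omega>) < \<epsilon>} \<subseteq> {\<omega> \<in> B. u J \<omega> \<in> T}"
        using d(1) by (intro exI[of _ "{C_norm M U k r}"] exI[of _ "d / (\<bar>K\<bar> + 1)"]) auto
    qed auto
  qed simp
  then show ?thesis using lin u_off by (simp add: tvs_dual_def top_B)
qed

text \<open>\<open>S\<close> is the polar of the gauge ball, described by forms. Functionals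
  dominated by the gauge are forms by \<open>form_of_functional\<close>, which also supplies the
  bounds in every norm; for each \<open>J\<close> one of them attains the gauge at \<open>J\<close>,
  so \<open>S\<close> recovers the neighbourhood.\<close>

lemma neighbourhood_polar:
  assumes W: "openin C W" "0 \<in> W"
  shows "\<exists>S\<subseteq>B. (\<forall>r. \<exists>K. \<forall>\<omega>\<in>S. C_norm M U k r \<omega> \<le> K) \<and> S \<noteq> {} \<and>
    (\<forall>J\<in>V. (\<forall>\<omega>\<in>S. \<bar>ext \<omega> J\<bar> < 1) \<longrightarrow> J \<in> W)"
proof -
  obtain q where q: "seminorm_on V q" "\<And>x. x \<in> V \<Longrightarrow> q x < 1 \<Longrightarrow> x \<in> W"
    "\<exists>O'. openin C O' \<and> 0 \<in> O' \<and> (\<forall>x\<in>O'. q x \<le> 1)"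
    using minkowski_seminorm[OF lcs_C W] by blast
  have qc: "continuous_seminorm C q" using q by (simp add: continuous_seminorm_def)
  have "\<forall>r. \<exists>K>0. \<forall>x\<in>E r. q (\<kappa> (lam r x)) \<le> K * N r x"
    using continuous_seminorm_L_bound[OF qc] by blast
  from choice[OF this] obtain K where K: "\<And>r. K r > 0" "\<And>r x. x \<in> E r \<Longrightarrow> q (\<kappa> (lam r x)) \<le> K r * N r x"
    by blast
  have dom: "q (\<iota> A) \<le> K r * B_norm M U k r A" if "A \<in> P" for A r
    using K(2)[OF e_mem[OF that], of r] \<iota>_eq[OF that, of r] N_e[OF that, of r] by simp
  have rep: "\<exists>\<omega>\<in>B. (\<forall>A\<in>P. f A = chain_integral A \<omega>) \<and> (\<forall>r. C_norm M U k r \<omega> \<le> K (Suc (Suc r)))"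
    if "linear_on P f" "\<And>A. A \<in> P \<Longrightarrow> f A \<le> q (\<iota> A)" for f
    using that dom order_trans by (intro form_of_functional[OF U that(1) K(1)]) blast
  \<comment> \<open>The norm bounds are built in because the representation delivers them together
    with the form.\<close>
  define S where "S = {\<omega> \<in> B. (\<forall>A\<in>P. chain_integral A \<omega> \<le> q (\<iota> A)) \<and> (\<forall>r. C_norm M U k r \<omega> \<le> K (Suc (Suc r)))}"
  show ?thesis
  proof (intro exI[of _ S] conjI allI ballI impI)
    show "S \<subseteq> B" by (auto simp: S_def)
    show "\<exists>K. \<forall>\<omega>\<in>S. C_norm M U k r \<omega> \<le> K" for r by (auto simp: S_def)
    have norm: "\<exists>\<omega>\<in>S. ext \<omega> J = q J" if J: "J \<in> V" for J
    proof -
      \<comment> \<open>Hahn-Banach from the line through \<open>J\<close>, parametrised by the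
        reals so that \<open>J = 0\<close> is covered too.\<close>
      have "\<exists>g. linear_on V g \<and> (\<forall>t\<in>UNIV. g (t *\<^sub>R J) = t * q J) \<and> (\<forall>x\<in>V. \<bar>g x\<bar> \<le> q x) \<and> (\<forall>x. x \<notin> V \<longrightarrow> g x = 0)"
      proof (rule dominated_extension[OF V_sub _ _ _ q(1)])
        show "subspace (UNIV :: real set)" by simp
        show "linear_on UNIV (\<lambda>t. t *\<^sub>R J)" by (simp add: linear_on_def scaleR_add_left)
        show "linear_on UNIV (\<lambda>t. t * q J)" by (simp add: linear_on_def distrib_right)
        show "range (\<lambda>t. t *\<^sub>R J) \<subseteq> V" using subspace_scale[OF V_sub J] by blast
        show "t * q J \<le> q (t *\<^sub>R J)" for t
          using seminorm_onD(3)[OF q(1) J, of t] mult_right_mono[OF abs_ge_self[of t] seminorm_onD(1)[OF q(1) J]] by simp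
      qed
      then obtain g where g: "linear_on V g" "\<And>t. g (t *\<^sub>R J) = t * q J" "\<forall>x\<in>V. \<bar>g x\<bar> \<le> q x" "\<forall>x. x \<notin> V \<longrightarrow> g x = 0"
        by blast
      have gd: "g \<in> tvs_dual C" using g by (intro tvs_dualI[OF lcs_C qc]) auto
      have glin: "linear_on P (\<lambda>A. g (\<iota> A))"
        using linear_onD[OF \<iota>_lin] linear_onD[OF g(1)] \<iota>_mem unfolding linear_on_def by simp
      have gq: "g (\<iota> A) \<le> q (\<iota> A)" if "A \<in> P" for A using g(3) \<iota>_mem[OF that] by (auto simp: abs_le_iff)
      obtain \<omega> where w: "\<omega> \<in> B" "\<And>A. A \<in> P \<Longrightarrow> g (\<iota> A) = chain_integral A \<omega>" "\<And>r. C_norm M U k r \<omega> \<le> K (Suc (Suc r))"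
        using rep[OF glin gq] by blast
      have "ext \<omega> = g" by (rule ext_eqI[OF w(1) gd w(2)])
      moreover have "\<omega> \<in> S" using w gq by (auto simp: S_def)
      ultimately show ?thesis using g(2)[of 1] by (intro bexI[of _ \<omega>]) simp_all
    qed
    then show "S \<noteq> {}" using subspace_0[OF V_sub] by blast
    show "J \<in> W" if J: "J \<in> V" and lt: "\<forall>\<omega>\<in>S. \<bar>ext \<omega> J\<bar> < 1" for J
    proof -
      obtain \<omega> where "\<omega> \<in> S" "ext \<omega> J = q J" using norm[OF J] by blast
      then show ?thesis using bspec[OF lt, of \<omega>] q(2)[OF J] by (simp add: abs_less_iff)
    qed
  qed
qed

abbreviation "seminorms \<equiv> {(\<lambda>f. SUP \<omega>\<in>S. \<bar>f \<omega>\<bar>) | S. tvs_bounded (B_space M U k) S \<and> S \<noteq> {}}"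

lemma bounded_iff: "tvs_bounded (B_space M U k) S \<longleftrightarrow> S \<subseteq> B \<and> (\<forall>r. \<exists>K. \<forall>\<omega>\<in>S. C_norm M U k r \<omega> \<le> K)"
  by (rule tvs_bounded_B_space_iff[OF riemannian_axioms U])

lemma continuous_u: "continuous_map C (strong_dual (B_space M U k)) u"
  unfolding continuous_map_def strong_dual_def topspace_seminorm_topology
proof (intro conjI allI impI)
  show "u \<in> V \<rightarrow> tvs_dual (B_space M U k)" using u_mem by blast
  fix T assume T: "openin (seminorm_topology (tvs_dual (B_space M U k)) seminorms) T"
  show "openin C {J \<in> V. u J \<in> T}"
  proof (subst openin_subopen, intro ballI)
    fix J assume J: "J \<in> {J \<in> V. u J \<in> T}"
    then obtain F d where F: "finite F" "F \<subseteq> seminorms" "0 < d"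
      "{g\<in>tvs_dual (B_space M U k). \<forall>p\<in>F. p (g - u J) < d} \<subseteq> T"
      using T unfolding openin_seminorm_topology by blast
    have "\<exists>O'. openin C O' \<and> J \<in> O' \<and> (\<forall>J'\<in>O'. p (u J' - u J) < d)" if p: "p \<in> F" for p
    proof -
      obtain S where S: "p = (\<lambda>f. SUP \<omega>\<in>S. \<bar>f \<omega>\<bar>)" "tvs_bounded (B_space M U k) S" "S \<noteq> {}" using p F(2) by blast
      have SB: "S \<subseteq> B" "\<And>r. \<exists>K. \<forall>\<omega>\<in>S. C_norm M U k r \<omega> \<le> K" using S(2) bounded_iff by auto
      obtain W where W: "openin C W" "0 \<in> W" "\<And>J \<omega>. J \<in> W \<Longrightarrow> \<omega> \<in> S \<Longrightarrow> \<bar>ext \<omega> J\<bar> \<le> 1"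
        using bounded_equicontinuous[OF SB S(3)] by blast
      \<comment> \<open>The factor \<open>2/d\<close> turns the bound 1 into \<open>d / 2\<close>,
        so the supremum over \<open>S\<close> stays strictly below \<open>d\<close>.\<close>
      define O' where "O' = {x \<in> V. (2/d) *\<^sub>R x + (- (2/d)) *\<^sub>R J \<in> W}"
      have "openin C O'" unfolding O'_def
        using J by (intro openin_lcs_affine_preimage[OF lcs_C W(1)] subspace_scale[OF V_sub]) simp
      moreover have "J \<in> O'" using J W(2) by (simp add: O'_def)
      moreover have "p (u J' - u J) < d" if J': "J' \<in> O'" for J'
      proof -
        have V': "J' \<in> V" "J \<in> V" using J J' by (auto simp: O'_def)
        have "\<bar>(u J' - u J) \<omega>\<bar> \<le> d / 2" if w: "\<omega> \<in> S" for \<omega>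
        proof -
          have wB: "\<omega> \<in> B" using w SB by blast
          have 1: "\<bar>ext \<omega> ((2/d) *\<^sub>R (J' - J))\<bar> \<le> 1"
            using J' by (intro W(3) w) (simp add: O'_def scaleR_diff_right)
          have "ext \<omega> ((2/d) *\<^sub>R (J' - J)) = (2/d) * (ext \<omega> J' - ext \<omega> J)"
            using linear_onD(2)[OF ext_linear[OF wB] subspace_diff[OF V_sub V']] linear_on_diff[OF ext_linear[OF wB] V_sub V'] by simp
          with 1 have "\<bar>(2/d) * (ext \<omega> J' - ext \<omega> J)\<bar> \<le> 1" by simp
          then have "2 / d * \<bar>ext \<omega> J' - ext \<omega> J\<bar> \<le> 1" using F(3) by (simp only: abs_mult) simp
          then show ?thesis using F(3) wB by (simp add: u_eq field_simps)
        qed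
        then have "p (u J' - u J) \<le> d / 2" unfolding S(1) using S(3) by (intro cSUP_least)
        then show ?thesis using F(3) by simp
      qed
      ultimately show ?thesis by blast
    qed
    then obtain Op where Op: "\<And>p. p \<in> F \<Longrightarrow> openin C (Op p)" "\<And>p. p \<in> F \<Longrightarrow> J \<in> Op p"
      "\<And>p J'. p \<in> F \<Longrightarrow> J' \<in> Op p \<Longrightarrow> p (u J' - u J) < d"
      using bchoice[of F "\<lambda>p O'. openin C O' \<and> J \<in> O' \<and> (\<forall>J'\<in>O'. p (u J' - u J) < d)"] by blast
    \<comment> \<open>Intersecting with \<open>V\<close> covers an empty \<open>F\<close>.\<close>
    define O' where "O' = V \<inter> (\<Inter>p\<in>F. Op p)"
    have "openin C O'"
    proof (cases "F = {}")
      case False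
      then show ?thesis unfolding O'_def using Op(1) F(1) by (intro openin_Int openin_topspace openin_Inter) auto
    qed (simp add: O'_def)
    moreover have "J \<in> O'" using J Op(2) by (simp add: O'_def)
    moreover have "O' \<subseteq> {J \<in> V. u J \<in> T}"
    proof
      fix J' assume J': "J' \<in> O'"
      then have "u J' \<in> {g\<in>tvs_dual (B_space M U k). \<forall>p\<in>F. p (g - u J) < d}"
        using Op(3) u_mem by (auto simp: O'_def)
      then show "J' \<in> {J \<in> V. u J \<in> T}" using F(4) J' by (auto simp: O'_def)
    qed
    ultimately show "\<exists>O'. openin C O' \<and> J \<in> O' \<and> O' \<subseteq> {J \<in> V. u J \<in> T}" by blast
  qed
qed

text \<open>The Hausdorff axiom separates two points by a translate of a neighbourhood of 0, and
  forms in its polar set distinguish them.\<close>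

lemma inj_u: "inj_on u V"
proof (rule inj_onI, rule ccontr)
  fix J J' assume J: "J \<in> V" "J' \<in> V" "u J = u J'" "J \<noteq> J'"
  obtain W where W: "openin C W" "J' \<in> W" "J \<notin> W"
    using Hausdorff_C J unfolding Hausdorff_space_def disjnt_def by blast
  define W' where "W' = {x \<in> V. 1 *\<^sub>R x + J' \<in> W}"
  have W': "openin C W'" unfolding W'_def by (rule openin_lcs_affine_preimage[OF lcs_C W(1) J(2)])
  have W'0: "0 \<in> W'" using W J subspace_0[OF V_sub] by (simp add: W'_def)
  obtain S where S: "S \<subseteq> B" "\<forall>r. \<exists>K. \<forall>\<omega>\<in>S. C_norm M U k r \<omega> \<le> K" "S \<noteq> {}"
    "\<forall>J\<in>V. (\<forall>\<omega>\<in>S. \<bar>ext \<omega> J\<bar> < 1) \<longrightarrow> J \<in> W'"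
    using neighbourhood_polar[OF W' W'0] by (elim exE conjE) (rule that)
  have "J - J' \<in> W'"
  proof (rule S(4)[rule_format, OF subspace_diff[OF V_sub J(1,2)]])
    fix \<omega> assume "\<omega> \<in> S"
    then have wB: "\<omega> \<in> B" using S by blast
    have "ext \<omega> J = ext \<omega> J'" using u_eq[OF wB] J(3) by metis
    then show "\<bar>ext \<omega> (J - J')\<bar> < 1" using linear_on_diff[OF ext_linear[OF wB] V_sub J(1,2)] by simp
  qed
  then show False using W(3) by (simp add: W'_def)
qed

text \<open>Translate \<open>T\<close> to a neighbourhood of 0 and take its polar set, which is
  bounded. The strong seminorm ball around \<open>u J\<close> that it defines meets the range of
  \<open>u\<close> only in images of points of \<open>T\<close>.\<close>

lemma open_u:
  assumes T: "openin C T"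
  shows "openin (subtopology (strong_dual (B_space M U k)) (u ` V)) (u ` T)"
proof (subst openin_subopen, intro ballI)
  let ?D = "tvs_dual (B_space M U k)"
  have TV: "T \<subseteq> V" using openin_subset[OF T] .
  fix g assume "g \<in> u ` T"
  then obtain J where J: "J \<in> T" "g = u J" by blast
  have JV: "J \<in> V" using J TV by blast
  define W where "W = {x \<in> V. 1 *\<^sub>R x + J \<in> T}"
  have W: "openin C W" unfolding W_def by (rule openin_lcs_affine_preimage[OF lcs_C T JV])
  have W0: "0 \<in> W" using J subspace_0[OF V_sub] by (simp add: W_def)
  obtain S where S: "S \<subseteq> B" "\<forall>r. \<exists>K. \<forall>\<omega>\<in>S. C_norm M U k r \<omega> \<le> K" "S \<noteq> {}"
    "\<forall>J\<in>V. (\<forall>\<omega>\<in>S. \<bar>ext \<omega> J\<bar> < 1) \<longrightarrow> J \<in> W"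
    using neighbourhood_polar[OF W W0] by (elim exE conjE) (rule that)
  have Sb: "tvs_bounded (B_space M U k) S" using S bounded_iff by blast
  define p where "p = (\<lambda>f. SUP \<omega>\<in>S. \<bar>f \<omega> :: real\<bar>)"
  \<comment> \<open>Continuous functionals are bounded on the bounded set \<open>S\<close>, so the
    supremum \<open>p\<close> really dominates each value.\<close>
  have bddf: "\<exists>K. \<forall>\<omega>\<in>S. \<bar>f \<omega>\<bar> \<le> K" if f: "f \<in> ?D" for f
  proof -
    have lin: "linear_on B f" and cont: "continuous_map (B_space M U k) euclideanreal f" using f by (auto simp: tvs_dual_def top_B)
    have "openin (B_space M U k) {\<omega> \<in> topspace (B_space M U k). f \<omega> \<in> ball 0 1}"
      by (rule openin_continuous_map_preimage[OF cont]) simp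
    moreover have "0 \<in> {\<omega> \<in> topspace (B_space M U k). f \<omega> \<in> ball 0 1}"
      using linear_on_zero[OF lin B_sub] subspace_0[OF B_sub] by (simp add: top_B)
    ultimately obtain t where t: "t > 0" "S \<subseteq> (\<lambda>\<omega>. t *\<^sub>R \<omega>) ` {\<omega> \<in> topspace (B_space M U k). f \<omega> \<in> ball 0 1}"
      using Sb unfolding tvs_bounded_def by blast
    have "\<bar>f \<omega>\<bar> \<le> t" if w: "\<omega> \<in> S" for \<omega>
    proof -
      obtain \<eta> where "\<omega> = t *\<^sub>R \<eta>" "\<eta> \<in> B" "\<bar>f \<eta>\<bar> < 1" using w t(2) by (auto simp: top_B)
      then show ?thesis using linear_onD(2)[OF lin, of \<eta> t] t(1) by (simp add: abs_mult)
    qed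
    then show ?thesis by blast
  qed
  have p_ge: "\<bar>f \<omega>\<bar> \<le> p f" if f: "f \<in> ?D" and w: "\<omega> \<in> S" for f \<omega>
  proof -
    obtain K where "\<forall>\<omega>\<in>S. \<bar>f \<omega>\<bar> \<le> K" using bddf[OF f] by blast
    then show ?thesis unfolding p_def by (intro cSUP_upper w bdd_aboveI2[of _ _ K]) auto
  qed
  have p_le: "p f \<le> b" if "\<And>\<omega>. \<omega> \<in> S \<Longrightarrow> \<bar>f \<omega>\<bar> \<le> b" for f b
    unfolding p_def using S(3) that by (rule cSUP_least)
  have D_sub: "subspace ?D"
  proof (rule subspaceI)
    show "0 \<in> ?D" by (simp add: tvs_dual_def linear_on_def zero_fun_def)
    show "f + h \<in> ?D" if "f \<in> ?D" "h \<in> ?D" for f h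
      using tvs_dual_lincomb[OF that, of 1 1] by (simp add: plus_fun_def)
    show "c *\<^sub>R f \<in> ?D" if "f \<in> ?D" for c f
      using tvs_dual_lincomb[OF that that, of c 0] by (simp add: scaleR_fun_def)
  qed
  define T' where "T' = {f \<in> ?D. p (f - u J) < 1}"
  have "openin (strong_dual (B_space M U k)) T'"
    unfolding strong_dual_def openin_seminorm_topology
  proof (intro conjI ballI)
    show "T' \<subseteq> ?D" by (auto simp: T'_def)
    fix f assume f: "f \<in> T'"
    have "{h \<in> ?D. \<forall>p\<in>{p}. p (h - f) < 1 - p (f - u J)} \<subseteq> T'"
    proof clarify
      fix h assume h: "h \<in> ?D" "\<forall>p\<in>{p}. p (h - f) < 1 - p (f - u J)"
      have mem: "f \<in> ?D" "h - f \<in> ?D" "f - u J \<in> ?D"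
        using f h u_mem[OF JV] subspace_diff[OF D_sub] by (auto simp: T'_def)
      have "p (h - u J) \<le> p (h - f) + p (f - u J)"
      proof (rule p_le)
        fix \<omega> assume w: "\<omega> \<in> S"
        show "\<bar>(h - u J) \<omega>\<bar> \<le> p (h - f) + p (f - u J)"
          using p_ge[OF mem(2) w] p_ge[OF mem(3) w] by simp
      qed
      then show "h \<in> T'" using h by (simp add: T'_def)
    qed
    moreover have "{p} \<subseteq> seminorms" using Sb S(3) by (auto simp: p_def)
    moreover have "0 < 1 - p (f - u J)" using f by (simp add: T'_def)
    ultimately show "\<exists>F \<epsilon>. finite F \<and> F \<subseteq> seminorms \<and> 0 < \<epsilon> \<and> {h \<in> ?D. \<forall>p\<in>F. p (h - f) < \<epsilon>} \<subseteq> T'"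
      by (intro exI[of _ "{p}"] exI[of _ "1 - p (f - u J)"]) simp
  qed
  then have "openin (subtopology (strong_dual (B_space M U k)) (u ` V)) (u ` V \<inter> T')"
    by (rule openin_subtopology_Int2)
  moreover have "g \<in> u ` V \<inter> T'"
  proof -
    have "p (u J - u J) \<le> 0" by (rule p_le) simp
    then show ?thesis using J JV u_mem[OF JV] by (simp add: T'_def)
  qed
  moreover have "u ` V \<inter> T' \<subseteq> u ` T"
  proof
    fix h assume "h \<in> u ` V \<inter> T'"
    then obtain J' where J': "J' \<in> V" "h = u J'" "p (u J' - u J) < 1" by (auto simp: T'_def)
    have "J' - J \<in> W"
    proof (rule S(4)[rule_format, OF subspace_diff[OF V_sub J'(1) JV]])
      fix \<omega> assume w: "\<omega> \<in> S"
      then have wB: "\<omega> \<in> B" using S(1) by blast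
      have "\<bar>(u J' - u J) \<omega>\<bar> \<le> p (u J' - u J)"
        by (rule p_ge[OF subspace_diff[OF D_sub u_mem[OF J'(1)] u_mem[OF JV]] w])
      then show "\<bar>ext \<omega> (J' - J)\<bar> < 1"
        using J'(3) linear_on_diff[OF ext_linear[OF wB] V_sub J'(1) JV] by (simp add: u_eq[OF wB])
    qed
    then have "J' \<in> T" by (simp add: W_def)
    then show "h \<in> u ` T" using J' by blast
  qed
  ultimately show "\<exists>T'. openin (subtopology (strong_dual (B_space M U k)) (u ` V)) T' \<and> g \<in> T' \<and> T' \<subseteq> u ` T" by blast
qed

lemma embedding_u: "embedding_map C (strong_dual (B_space M U k)) u"
  unfolding embedding_map_def
proof (rule bijective_open_imp_homeomorphic_map)
  show "continuous_map C (subtopology (strong_dual (B_space M U k)) (u ` V)) u"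
    using continuous_u by (simp add: continuous_map_in_subtopology)
  show "open_map C (subtopology (strong_dual (B_space M U k)) (u ` V)) u"
    unfolding open_map_def using open_u by blast
  show "u ` V = topspace (subtopology (strong_dual (B_space M U k)) (u ` V))"
    using continuous_map_image_subset_topspace[OF continuous_u] by auto
qed (rule inj_u)

end

theorem theorem3p0p5:
  fixes M :: "('m::{t2_space, second_countable_topology}, 'e::{real_inner, heine_borel}) rmanifold"
    and U :: "'m set" and k :: nat
    and E :: "nat \<Rightarrow> 'b::real_vector set" and N :: "nat \<Rightarrow> 'b \<Rightarrow> real"
    and e :: "nat \<Rightarrow> ('m \<Rightarrow> ('e list \<Rightarrow> real) \<Rightarrow> real) \<Rightarrow> 'b" and i :: "nat \<Rightarrow> 'b \<Rightarrow> 'b"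
    and L :: "'l::real_vector topology" and lam :: "nat \<Rightarrow> 'b \<Rightarrow> 'l"
    and C :: "'c::real_vector topology" and \<kappa> :: "'l \<Rightarrow> 'c"
  defines "u \<equiv> evaluation_map M U k C (\<lambda>A. \<kappa> (lam 0 (e 0 A)))"
  assumes "riemannian_manifold M" and "open U" and "k \<le> dim (UNIV :: 'e set)"
    and "\<And>r. banach_completion (pointed_chains U k) (B_norm M U k r) (E r) (N r) (e r)"
    and "canonical_maps (pointed_chains U k) E N e i"
    and "lc_inductive_limit (\<lambda>r. norm_topology (E r) (N r)) i L lam"
    and "lcs_completion L C \<kappa>"
  shows "linear_on (topspace C) u \<and> embedding_map C (strong_dual (B_space M U k)) u"
proof -
  interpret differential_chains M U k E N e i L lam C \<kappa>
    by unfold_locales (use assms in auto)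
  show ?thesis
    unfolding u_def \<iota>_def[symmetric] using u_linear embedding_u by blast
qed

end
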